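(* Let $\Gamma$ be a finite connected simplicial graph and $\mathcal{G}=\{G_u\mid u\in V(\Gamma)\}$ a collection of groups indexed by $V(\Gamma)$. Endow $\Gamma \mathcal{G}$ with the word metric coming from the union of generating sets of the vertex-groups. Let $G$ be a finitely generated group and $\varphi_1, \varphi_2, \ldots$ an infinite collection of morphisms $G \to \Gamma \mathcal{G}$. Assume that the limit of the twisted actions $$\left\{ \begin{array}{ccc} G & \to & \mathrm{Isom}(\Gamma \mathcal{G}) \\ h & \mapsto & (x \mapsto \varphi_n(h) \cdot x) \end{array} \right. \quad (n\ge1)$$ defines an action of $G$ on the asymptotic cone $\mathrm{Cone}(\Gamma \mathcal{G}):= \mathrm{Cone}(\Gamma \mathcal{G},(1/\lambda_n),o)$. If this action has bounded orbits, then either $G$ has a global fixed point (in $\mathrm{Cone}(\Gamma\mathcal{G})$) or there exists some $i \geq 1$ such that $\varphi_i(G)$ lies in a star-subgroup.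
   Context: Given a simplicial graph $\Gamma$ and a collection of groups $\mathcal{G}=\{G_u\mid u\in V(\Gamma)\}$, the graph product $\Gamma\mathcal{G}$ is the quotient of the free product of the $G_u$ by the normal closure of all commutators $[g,h]$ with $g\in G_u$, $h\in G_v$, $\{u,v\}\in E(\Gamma)$. The vertex-groups $G_u$ are always assumed non-trivial. For every $u\in V(\Gamma)$ a generating set $S_u$ of $G_u$ is fixed, and $\Gamma\mathcal{G}$ carries the word metric $d$ associated with $\bigcup_u S_u$. A star-subgroup is a subgroup of the form $g\langle\mathrm{star}(u)\rangle g^{-1}$ with $g\in\Gamma\mathcal{G}$, $u\in V(\Gamma)$, where $\mathrm{star}(u)$ is the subgraph induced by $u$ and its neighbors and $\langle\mathrm{star}(u)\rangle$ is the subgroup generated by the vertex-groups indexed by its vertices. Asymptotic cones: fix a non-principal ultrafilter $\omega$ over $\mathbb{N}$, a sequence $\lambda_n\to+\infty$ of positive reals and a sequence of basepoints $o=(o_n)$ in $\Gamma\mathcal{G}$. A real sequence $(r_n)$ is $\omega$-bounded if there is $M$ with $\{n\mid |r_n|\le M\}\in\omega$. $\mathrm{Cone}(\Gamma\mathcal{G},(1/\lambda_n),o)$ is the metric space obtained from the set of sequences $(x_n)\in(\Gamma\mathcal{G})^{\mathbb{N}}$ such that $(d(o_n,x_n)/\lambda_n)$ is $\omega$-bounded, with pseudo-distance $\lim_\omega d(x_n,y_n)/\lambda_n$, by identifying points at distance zero. The limit of the twisted actions is $h\cdot(x_n)=(\varphi_n(h)x_n)$; it defines an action of $G$ on the cone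 precisely when $(d(o_n,\varphi_n(h)o_n)/\lambda_n)$ is $\omega$-bounded for every $h\in G$ (equivalently, for every $h$ in a generating set). *)

theory Defs
  imports "HOL-Analysis.Analysis" "HOL-Algebra.Generated_Groups" "HOL-Algebra.Group_Action" "Graph_Theory.Graph_Theory"
begin

section \<open>Free products and graph products of groups\<close>

text \<open>
  The free product of the groups \<open>\<G> u\<close>, \<open>u \<in> V\<close>, is the monoid of words in the syllables
  \<open>(u, g)\<close> with \<open>g \<in> \<G> u\<close>, modulo the congruence generated by deleting a trivial syllable and
  by multiplying two adjacent syllables of the same vertex-group.
\<close>

definition fp_words :: "'v set \<Rightarrow> ('v \<Rightarrow> 'a monoid) \<Rightarrow> ('v \<times> 'a) list set" where
  "fp_words V \<G> = lists (SIGMA u:V. carrier (\<G> u))"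

inductive fp_step :: "'v set \<Rightarrow> ('v \<Rightarrow> 'a monoid) \<Rightarrow> ('v \<times> 'a) list \<Rightarrow> ('v \<times> 'a) list \<Rightarrow> bool"
  for V \<G> where
  unit: "\<lbrakk>xs \<in> fp_words V \<G>; ys \<in> fp_words V \<G>; u \<in> V\<rbrakk>
    \<Longrightarrow> fp_step V \<G> (xs @ [(u, \<one>\<^bsub>\<G> u\<^esub>)] @ ys) (xs @ ys)"
| mult: "\<lbrakk>xs \<in> fp_words V \<G>; ys \<in> fp_words V \<G>; u \<in> V; g \<in> carrier (\<G> u); h \<in> carrier (\<G> u)\<rbrakk>
    \<Longrightarrow> fp_step V \<G> (xs @ [(u, g), (u, h)] @ ys) (xs @ [(u, g \<otimes>\<^bsub>\<G> u\<^esub> h)] @ ys)"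

definition fp_rel :: "'v set \<Rightarrow> ('v \<Rightarrow> 'a monoid) \<Rightarrow> (('v \<times> 'a) list \<times> ('v \<times> 'a) list) set" where
  "fp_rel V \<G> = {(v, w). v \<in> fp_words V \<G> \<and> w \<in> fp_words V \<G> \<and> equivclp (fp_step V \<G>) v w}"

definition free_product :: "'v set \<Rightarrow> ('v \<Rightarrow> 'a monoid) \<Rightarrow> ('v \<times> 'a) list set monoid" where
  "free_product V \<G> =
    \<lparr>carrier = fp_words V \<G> // fp_rel V \<G>,
     mult = (\<lambda>A B. \<Union>v\<in>A. \<Union>w\<in>B. fp_rel V \<G> `` {v @ w}),
     one = fp_rel V \<G> `` {[]}\<rparr>"

definition fp_emb :: "'v set \<Rightarrow> ('v \<Rightarrow> 'a monoid) \<Rightarrow> 'v \<Rightarrow> 'a \<Rightarrow> ('v \<times> 'a) list set" where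
  "fp_emb V \<G> u g = fp_rel V \<G> `` {[(u, g)]}"

definition normal_closure :: "('g, 'm) monoid_scheme \<Rightarrow> 'g set \<Rightarrow> 'g set" where
  "normal_closure P R = \<Inter>{N. N \<lhd> P \<and> R \<subseteq> N}"

definition commutator :: "('g, 'm) monoid_scheme \<Rightarrow> 'g \<Rightarrow> 'g \<Rightarrow> 'g" where
  "commutator P x y = x \<otimes>\<^bsub>P\<^esub> y \<otimes>\<^bsub>P\<^esub> inv\<^bsub>P\<^esub> x \<otimes>\<^bsub>P\<^esub> inv\<^bsub>P\<^esub> y"

text \<open>
  Graphs are the symmetric loop-free digraphs of \<open>Graph_Theory\<close>, so an edge \<open>{u, v}\<close> is
  represented by the two pairs \<open>(u, v)\<close> and \<open>(v, u)\<close> in \<open>arcs_ends\<close>.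
\<close>

definition gp_relators ::
  "('v, 'e) pre_digraph \<Rightarrow> ('v \<Rightarrow> 'a monoid) \<Rightarrow> ('v \<times> 'a) list set set" where
  "gp_relators \<Gamma> \<G> =
    {commutator (free_product (verts \<Gamma>) \<G>) (fp_emb (verts \<Gamma>) \<G> u g) (fp_emb (verts \<Gamma>) \<G> v h) |u v g h.
      (u, v) \<in> arcs_ends \<Gamma> \<and> g \<in> carrier (\<G> u) \<and> h \<in> carrier (\<G> v)}"

definition gp_kernel ::
  "('v, 'e) pre_digraph \<Rightarrow> ('v \<Rightarrow> 'a monoid) \<Rightarrow> ('v \<times> 'a) list set set" where
  "gp_kernel \<Gamma> \<G> = normal_closure (free_product (verts \<Gamma>) \<G>) (gp_relators \<Gamma> \<G>)"

definition graph_product ::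
  "('v, 'e) pre_digraph \<Rightarrow> ('v \<Rightarrow> 'a monoid) \<Rightarrow> ('v \<times> 'a) list set set monoid" where
  "graph_product \<Gamma> \<G> = free_product (verts \<Gamma>) \<G> Mod gp_kernel \<Gamma> \<G>"

definition gp_emb ::
  "('v, 'e) pre_digraph \<Rightarrow> ('v \<Rightarrow> 'a monoid) \<Rightarrow> 'v \<Rightarrow> 'a \<Rightarrow> ('v \<times> 'a) list set set" where
  "gp_emb \<Gamma> \<G> u g = gp_kernel \<Gamma> \<G> #>\<^bsub>free_product (verts \<Gamma>) \<G>\<^esub> fp_emb (verts \<Gamma>) \<G> u g"

definition star :: "('v, 'e) pre_digraph \<Rightarrow> 'v \<Rightarrow> 'v set" where
  "star \<Gamma> u = {v \<in> verts \<Gamma>. v = u \<or> (u, v) \<in> arcs_ends \<Gamma>}"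

definition parabolic ::
  "('v, 'e) pre_digraph \<Rightarrow> ('v \<Rightarrow> 'a monoid) \<Rightarrow> 'v set \<Rightarrow> ('v \<times> 'a) list set set set" where
  "parabolic \<Gamma> \<G> U = generate (graph_product \<Gamma> \<G>) (\<Union>v\<in>U. gp_emb \<Gamma> \<G> v ` carrier (\<G> v))"

definition star_subgroups ::
  "('v, 'e) pre_digraph \<Rightarrow> ('v \<Rightarrow> 'a monoid) \<Rightarrow> ('v \<times> 'a) list set set set set" where
  "star_subgroups \<Gamma> \<G> =
    {g <#\<^bsub>graph_product \<Gamma> \<G>\<^esub> parabolic \<Gamma> \<G> (star \<Gamma> u)
       #>\<^bsub>graph_product \<Gamma> \<G>\<^esub> inv\<^bsub>graph_product \<Gamma> \<G>\<^esub> g |g u.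
      g \<in> carrier (graph_product \<Gamma> \<G>) \<and> u \<in> verts \<Gamma>}"

section \<open>Word metrics\<close>

definition word_length :: "('g, 'm) monoid_scheme \<Rightarrow> 'g set \<Rightarrow> 'g \<Rightarrow> nat" where
  "word_length P S g =
    (LEAST n. \<exists>ws. length ws = n \<and> set ws \<subseteq> S \<union> (\<lambda>s. inv\<^bsub>P\<^esub> s) ` S \<and>
       foldr (\<lambda>x y. x \<otimes>\<^bsub>P\<^esub> y) ws \<one>\<^bsub>P\<^esub> = g)"

definition word_dist :: "('g, 'm) monoid_scheme \<Rightarrow> 'g set \<Rightarrow> 'g \<Rightarrow> 'g \<Rightarrow> real" where
  "word_dist P S x y = real (word_length P S (inv\<^bsub>P\<^esub> x \<otimes>\<^bsub>P\<^esub> y))"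

definition gp_dist ::
  "('v, 'e) pre_digraph \<Rightarrow> ('v \<Rightarrow> 'a monoid) \<Rightarrow> ('v \<Rightarrow> 'a set) \<Rightarrow>
    ('v \<times> 'a) list set set \<Rightarrow> ('v \<times> 'a) list set set \<Rightarrow> real" where
  "gp_dist \<Gamma> \<G> S = word_dist (graph_product \<Gamma> \<G>) (\<Union>u\<in>verts \<Gamma>. gp_emb \<Gamma> \<G> u ` S u)"

definition finitely_generated :: "('g, 'm) monoid_scheme \<Rightarrow> bool" where
  "finitely_generated P \<longleftrightarrow> (\<exists>A. finite A \<and> A \<subseteq> carrier P \<and> generate P A = carrier P)"

section \<open>Asymptotic cones\<close>

text \<open>
  An ultrafilter is represented by the filter whose eventually true predicates are its members;
  the limit along \<open>\<omega>\<close> is then the library's \<open>Lim \<omega>\<close>.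
\<close>

definition nonprincipal_ultrafilter :: "nat filter \<Rightarrow> bool" where
  "nonprincipal_ultrafilter \<omega> \<longleftrightarrow>
    \<omega> \<noteq> bot \<and> (\<forall>P. eventually P \<omega> \<or> eventually (\<lambda>n. \<not> P n) \<omega>) \<and> (\<forall>n. \<omega> \<noteq> principal {n})"

definition omega_bounded :: "nat filter \<Rightarrow> (nat \<Rightarrow> real) \<Rightarrow> bool" where
  "omega_bounded \<omega> r \<longleftrightarrow> (\<exists>B. eventually (\<lambda>n. \<bar>r n\<bar> \<le> B) \<omega>)"

definition cone_seqs ::
  "nat filter \<Rightarrow> 'x set \<Rightarrow> ('x \<Rightarrow> 'x \<Rightarrow> real) \<Rightarrow> (nat \<Rightarrow> real) \<Rightarrow> (nat \<Rightarrow> 'x) \<Rightarrow> (nat \<Rightarrow> 'x) set" where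
  "cone_seqs \<omega> M d r b = {x. (\<forall>n. x n \<in> M) \<and> omega_bounded \<omega> (\<lambda>n. d (b n) (x n) / r n)}"

definition cone_pseudodist ::
  "nat filter \<Rightarrow> ('x \<Rightarrow> 'x \<Rightarrow> real) \<Rightarrow> (nat \<Rightarrow> real) \<Rightarrow> (nat \<Rightarrow> 'x) \<Rightarrow> (nat \<Rightarrow> 'x) \<Rightarrow> real" where
  "cone_pseudodist \<omega> d r x y = Lim \<omega> (\<lambda>n. d (x n) (y n) / r n)"

definition cone_rel ::
  "nat filter \<Rightarrow> 'x set \<Rightarrow> ('x \<Rightarrow> 'x \<Rightarrow> real) \<Rightarrow> (nat \<Rightarrow> real) \<Rightarrow> (nat \<Rightarrow> 'x) \<Rightarrow>
    ((nat \<Rightarrow> 'x) \<times> (nat \<Rightarrow> 'x)) set" where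
  "cone_rel \<omega> M d r b =
    {(x, y). x \<in> cone_seqs \<omega> M d r b \<and> y \<in> cone_seqs \<omega> M d r b \<and> cone_pseudodist \<omega> d r x y = 0}"

definition asymptotic_cone ::
  "nat filter \<Rightarrow> 'x set \<Rightarrow> ('x \<Rightarrow> 'x \<Rightarrow> real) \<Rightarrow> (nat \<Rightarrow> real) \<Rightarrow> (nat \<Rightarrow> 'x) \<Rightarrow> (nat \<Rightarrow> 'x) set set" where
  "asymptotic_cone \<omega> M d r b = cone_seqs \<omega> M d r b // cone_rel \<omega> M d r b"

text \<open>
  For points of the cone the value does not depend on the chosen representatives. The value 0
  elsewhere is chosen because \<open>Metric_space\<close> requires a non-negative symmetric function on
  the whole type.
\<close>

definition cone_dist ::
  "nat filter \<Rightarrow> 'x set \<Rightarrow> ('x \<Rightarrow> 'x \<Rightarrow> real) \<Rightarrow> (nat \<Rightarrow> real) \<Rightarrow> (nat \<Rightarrow> 'x) \<Rightarrow>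
    (nat \<Rightarrow> 'x) set \<Rightarrow> (nat \<Rightarrow> 'x) set \<Rightarrow> real" where
  "cone_dist \<omega> M d r b p q =
    (if p \<in> asymptotic_cone \<omega> M d r b \<and> q \<in> asymptotic_cone \<omega> M d r b
     then cone_pseudodist \<omega> d r (SOME x. x \<in> p) (SOME y. y \<in> q) else 0)"

text \<open>
  The limit of the actions \<open>h \<mapsto> (x \<mapsto> \<phi> n h \<cdot> x)\<close> maps the class of \<open>(x n)\<close> to the class of
  \<open>(\<phi> n h \<cdot> x n)\<close>. If the latter sequence is not at bounded rescaled distance from the base
  points, the value is the empty set, which is not a point of the cone; hence
  \<open>group_action\<close> holds for \<open>limit_action\<close> only if the translates all stay in the cone.
\<close>

definition limit_action ::
  "nat filter \<Rightarrow> ('x, 'm) monoid_scheme \<Rightarrow> ('x \<Rightarrow> 'x \<Rightarrow> real) \<Rightarrow> (nat \<Rightarrow> real) \<Rightarrow> (nat \<Rightarrow> 'x) \<Rightarrow>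
    (nat \<Rightarrow> 'h \<Rightarrow> 'x) \<Rightarrow> 'h \<Rightarrow> (nat \<Rightarrow> 'x) set \<Rightarrow> (nat \<Rightarrow> 'x) set" where
  "limit_action \<omega> P d r b \<phi> h =
    (\<lambda>p\<in>asymptotic_cone \<omega> (carrier P) d r b.
       \<Union>x\<in>p. cone_rel \<omega> (carrier P) d r b `` {\<lambda>n. \<phi> n h \<otimes>\<^bsub>P\<^esub> x n})"

end

theory Submission
  imports Defs
begin

text \<open>
  The word metric of a graph product is controlled by the hyperplanes, the cosets of the subgroups
  \<open>\<langle>star v\<rangle>\<close>: every point has a projection to each of them, and the distance is comparable to
  the sum, over the colours \<open>v\<close>, of the distances between the projections. Hyperplanes of one colour
  are never transverse, so for each colour the resulting pseudo-distance is tree-graded, every point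
  is a cut point for it, and bounded orbits have centres: the middle of a geodesic between two
  orbit points at nearly maximal distance is either almost fixed, or it lies inside a hyperplane, and
  then this hyperplane is stabilised by the generators (so that the image is contained in a
  star-subgroup) or else another pair of orbit points has an almost fixed middle.

  If no image lies in a star-subgroup, this gives almost fixed points for every colour. A centre
  lies on a geodesic between two points of the orbit, so if the orbit is already collapsed
  with respect to some colours, the centre remains almost fixed with respect to these. Treating the
  colours one after the other and passing to a diagonal sequence yields a global fixed point.
\<close>

section \<open>Words in the vertex-groups\<close>

text \<open>Hyperplanes of different colours may cross, so the word metric itself need not be
  tree-graded; this is why every colour gets its own pseudo-distance. What ties the colours together
  is a single betweenness relation, given by factorisations of reduced words: since a reduced word
  crosses no hyperplane twice, a point between two others is between them for every colour at once,
  and a centre found for one colour stays under control in the others. A second obstacle is that the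
  ultrafilter handles only finitely many orbit points at a time. The geometric argument therefore
  runs at a fixed index, on two finite pieces of the orbit, one of which contains preimages of the
  other, with an explicit error e. The constant 14 is 1 + 13/2 + 13/2: the diameter is known up to
  e, and the error 13/2 * e in the position of the centre enters through two cut-point estimates.
  The bound on the distance from an old point to a new one must not depend on e, since the diagonal
  sequence has to stay in the same cone. All facts about hyperplanes rest on the uniqueness of
  normal forms, obtained by van der Waerden's device of letting words act on reduced words.\<close>

locale graph_of_groups =
  fixes \<Gamma> :: "('v, 'e) pre_digraph" and \<G> :: "'v \<Rightarrow> 'a monoid"
  assumes graph: "Digraph.graph \<Gamma>"
    and vertex_group: "\<And>u. u \<in> verts \<Gamma> \<Longrightarrow> group (\<G> u)"
begin

abbreviation adj :: "'v \<Rightarrow> 'v \<Rightarrow> bool" where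
  "adj u v \<equiv> (u, v) \<in> arcs_ends \<Gamma>"

abbreviation words :: "('v \<times> 'a) list set" where
  "words \<equiv> fp_words (verts \<Gamma>) \<G>"

lemma finite_verts: "finite (verts \<Gamma>)"
proof -
  interpret Digraph.graph \<Gamma> by (rule graph)
  show ?thesis by (rule finite_verts)
qed

lemma adj_sym: "adj u v \<Longrightarrow> adj v u"
proof -
  interpret Digraph.graph \<Gamma> by (rule graph)
  show "adj u v \<Longrightarrow> adj v u" by (rule arcs_ends_symmetric[OF sym_arcs])
qed

lemma adj_commute: "adj u v \<longleftrightarrow> adj v u"
  by (rule iffI) (rule adj_sym, assumption)+

lemma adj_irrefl: "\<not> adj u u"
proof -
  interpret Digraph.graph \<Gamma> by (rule graph)
  show ?thesis using no_loops by (auto simp: arcs_ends_conv)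
qed

lemma adj_verts: "adj u v \<Longrightarrow> u \<in> verts \<Gamma> \<and> v \<in> verts \<Gamma>"
proof -
  interpret Digraph.graph \<Gamma> by (rule graph)
  show "adj u v \<Longrightarrow> u \<in> verts \<Gamma> \<and> v \<in> verts \<Gamma>" by (auto simp: arcs_ends_conv)
qed

lemma words_Nil [simp]: "[] \<in> words"
  by (simp add: fp_words_def)

lemma words_Cons [simp]: "s # w \<in> words \<longleftrightarrow> fst s \<in> verts \<Gamma> \<and> snd s \<in> carrier (\<G> (fst s)) \<and> w \<in> words"
  by (cases s) (simp add: fp_words_def)

lemma words_append [simp]: "v @ w \<in> words \<longleftrightarrow> v \<in> words \<and> w \<in> words"
  by (simp add: fp_words_def)

text \<open>The syllable of colour \<open>u\<close> that can be shuffled to the head of the word,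
  with value 1 if there is none. A trivial syllable would give the same value, so the value 1 is
  conclusive on reduced words only.\<close>

primrec front :: "'v \<Rightarrow> ('v \<times> 'a) list \<Rightarrow> 'a" where
  "front u [] = \<one>\<^bsub>\<G> u\<^esub>"
| "front u (s # w) = (if fst s = u then snd s else if adj u (fst s) then front u w else \<one>\<^bsub>\<G> u\<^esub>)"

primrec drop_front :: "'v \<Rightarrow> ('v \<times> 'a) list \<Rightarrow> ('v \<times> 'a) list" where
  "drop_front u [] = []"
| "drop_front u (s # w) = (if fst s = u then w else if adj u (fst s) then s # drop_front u w else s # w)"

text \<open>Comparing the head with the tail through \<open>front\<close> suffices: as the tail is
  reduced, the value 1 means that no syllable of the same vertex-group can be brought next to the
  head.\<close>

primrec reduced :: "('v \<times> 'a) list \<Rightarrow> bool" where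
  "reduced [] \<longleftrightarrow> True"
| "reduced (s # w) \<longleftrightarrow> fst s \<in> verts \<Gamma> \<and> snd s \<in> carrier (\<G> (fst s)) \<and> snd s \<noteq> \<one>\<^bsub>\<G> (fst s)\<^esub> \<and>
     front (fst s) w = \<one>\<^bsub>\<G> (fst s)\<^esub> \<and> reduced w"

definition push :: "'v \<Rightarrow> 'a \<Rightarrow> ('v \<times> 'a) list \<Rightarrow> ('v \<times> 'a) list" where
  "push u g w = (if g = \<one>\<^bsub>\<G> u\<^esub> then w else (u, g) # w)"

text \<open>Left multiplication by a syllable on normal forms: the accessible syllable of
  \<open>u\<close> is taken out and merged with \<open>g\<close>, and \<open>push\<close> drops the
  product if it is trivial.\<close>

definition ins :: "'v \<Rightarrow> 'a \<Rightarrow> ('v \<times> 'a) list \<Rightarrow> ('v \<times> 'a) list" where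
  "ins u g w = push u (g \<otimes>\<^bsub>\<G> u\<^esub> front u w) (drop_front u w)"

definition act :: "('v \<times> 'a) list \<Rightarrow> ('v \<times> 'a) list \<Rightarrow> ('v \<times> 'a) list" where
  "act v w = foldr (\<lambda>s. ins (fst s) (snd s)) v w"

section \<open>Shuffles: exchanging neighbouring syllables of adjacent vertices\<close>

inductive shuffle :: "('v \<times> 'a) list \<Rightarrow> ('v \<times> 'a) list \<Rightarrow> bool"  (infix "\<asymp>" 50) where
  refl: "w \<asymp> w"
| swap: "adj (fst s) (fst t) \<Longrightarrow> s # t # w \<asymp> t # s # w"
| cons: "v \<asymp> w \<Longrightarrow> s # v \<asymp> s # w"
| trans: "u \<asymp> v \<Longrightarrow> v \<asymp> w \<Longrightarrow> u \<asymp> w"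

declare shuffle.trans [trans]

lemma shuffle_sym: "v \<asymp> w \<Longrightarrow> w \<asymp> v"
proof (induction rule: shuffle.induct)
  case (trans u v w)
  then show ?case by (blast intro: shuffle.trans)
qed (auto intro: shuffle.refl shuffle.swap shuffle.cons simp: adj_commute)

lemma shuffle_set: "v \<asymp> w \<Longrightarrow> set v = set w"
  by (induction rule: shuffle.induct) auto

lemma shuffle_words: "v \<asymp> w \<Longrightarrow> v \<in> words \<longleftrightarrow> w \<in> words"
  by (auto simp: fp_words_def lists_eq_set shuffle_set)

lemma shuffle_front: "v \<asymp> w \<Longrightarrow> front u v = front u w"
proof (induction rule: shuffle.induct)
  case (swap s t w)
  then show ?case using adj_sym[OF swap] by (auto simp: adj_irrefl)
qed auto

lemma shuffle_drop_front: "v \<asymp> w \<Longrightarrow> drop_front u v \<asymp> drop_front u w"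
proof (induction rule: shuffle.induct)
  case (swap s t w)
  then show ?case using adj_sym[OF swap]
    by (auto simp: adj_irrefl intro: shuffle.refl shuffle.swap)
next
  case (trans x v w)
  then show ?case by (blast intro: shuffle.trans)
qed (auto intro: shuffle.refl shuffle.cons)

lemma shuffle_push: "v \<asymp> w \<Longrightarrow> push u g v \<asymp> push u g w"
  by (auto simp: push_def intro: shuffle.cons)

lemma shuffle_reduced: "v \<asymp> w \<Longrightarrow> reduced v \<longleftrightarrow> reduced w"
proof (induction rule: shuffle.induct)
  case (swap s t w)
  then show ?case using adj_sym[OF swap] by (auto simp: adj_irrefl)
next
  case (cons v w s)
  then show ?case by (auto simp: shuffle_front)
qed auto

lemma shuffle_move: "\<forall>t\<in>set w. adj (fst s) (fst t) \<Longrightarrow> s # w \<asymp> w @ [s]"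
proof (induction w)
  case (Cons t w)
  have "s # t # w \<asymp> t # s # w" using Cons.prems by (intro shuffle.swap) simp
  also have "t # s # w \<asymp> t # w @ [s]" using Cons by (intro shuffle.cons) simp
  finally show ?case by simp
qed (simp add: shuffle.refl)

lemma reduced_words: "reduced w \<Longrightarrow> w \<in> words"
  by (induction w) auto

lemma front_closed: "w \<in> words \<Longrightarrow> u \<in> verts \<Gamma> \<Longrightarrow> front u w \<in> carrier (\<G> u)"
  by (induction w) (auto intro: group.is_monoid monoid.one_closed vertex_group)

lemma front_drop_front:
  "reduced w \<Longrightarrow> front u (drop_front u w) = \<one>\<^bsub>\<G> u\<^esub>"
  by (induction w) auto

text \<open>The search for \<open>u\<close> passes over syllables of adjacent vertices anyway, so
  taking one of them out neither uncovers nor hides anything.\<close>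

lemma front_drop_front_adj:
  "adj u v \<Longrightarrow> front u (drop_front v w) = front u w"
  by (induction w) (auto simp: adj_irrefl)

text \<open>Reducedness rules out that the value 1 comes from a trivial syllable, which
  \<open>drop_front\<close> would delete.\<close>

lemma drop_front_trivial:
  "reduced w \<Longrightarrow> front u w = \<one>\<^bsub>\<G> u\<^esub> \<Longrightarrow> drop_front u w = w"
  by (induction w) (auto split: if_splits)

lemma reduced_drop_front: "reduced w \<Longrightarrow> reduced (drop_front u w)"
  by (induction w) (auto simp: front_drop_front_adj adj_commute)

lemma drop_front_commute:
  "adj u v \<Longrightarrow> drop_front u (drop_front v w) = drop_front v (drop_front u w)"
  by (induction w) (auto simp: adj_irrefl adj_commute)

lemma front_push_adj: "adj u v \<Longrightarrow> front u (push v g w) = front u w"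
  by (auto simp: push_def adj_irrefl)

lemma drop_front_push_adj:
  "adj u v \<Longrightarrow> drop_front u (push v g w) = push v g (drop_front u w)"
  by (auto simp: push_def adj_irrefl)

lemma push_front: "reduced w \<Longrightarrow> push u (front u w) (drop_front u w) \<asymp> w"
proof (induction w)
  case Nil
  then show ?case by (simp add: push_def shuffle.refl)
next
  case (Cons s w)
  consider "fst s = u" | "fst s \<noteq> u" "adj u (fst s)" | "fst s \<noteq> u" "\<not> adj u (fst s)" by blast
  then show ?case
  proof cases
    case 1
    then show ?thesis using Cons.prems by (cases s) (auto simp: push_def shuffle.refl)
  next
    case 2
    have "push u (front u w) (s # drop_front u w) \<asymp> s # push u (front u w) (drop_front u w)"
      using 2 by (auto simp: push_def intro: shuffle.refl shuffle.swap)
    also have "s # push u (front u w) (drop_front u w) \<asymp> s # w"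
      using Cons by (auto intro: shuffle.cons)
    finally show ?thesis using 2 by simp
  next
    case 3
    then show ?thesis by (simp add: push_def shuffle.refl)
  qed
qed

lemma reduced_push:
  "\<lbrakk>reduced w; front u w = \<one>\<^bsub>\<G> u\<^esub>; u \<in> verts \<Gamma>; g \<in> carrier (\<G> u)\<rbrakk> \<Longrightarrow> reduced (push u g w)"
  by (simp add: push_def)

lemma front_push:
  "front u w = \<one>\<^bsub>\<G> u\<^esub> \<Longrightarrow> front u (push u g w) = g"
  by (simp add: push_def)

lemma drop_front_push:
  "reduced w \<Longrightarrow> front u w = \<one>\<^bsub>\<G> u\<^esub> \<Longrightarrow> drop_front u (push u g w) = w"
  by (simp add: push_def drop_front_trivial)

lemma shuffle_ins: "v \<asymp> w \<Longrightarrow> ins u g v \<asymp> ins u g w"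
  by (simp add: ins_def shuffle_front shuffle_push shuffle_drop_front)

context
  fixes u w
  assumes u: "u \<in> verts \<Gamma>" and w: "reduced w"
begin

interpretation Gu: group "\<G> u" using u by (rule vertex_group)

lemma front_reduced_closed: "front u w \<in> carrier (\<G> u)"
  using u w by (intro front_closed reduced_words)

lemma reduced_ins: "g \<in> carrier (\<G> u) \<Longrightarrow> reduced (ins u g w)"
  unfolding ins_def using u w front_reduced_closed
  by (intro reduced_push) (auto simp: front_drop_front reduced_drop_front)

lemma front_ins: "front u (ins u g w) = g \<otimes>\<^bsub>\<G> u\<^esub> front u w"
  unfolding ins_def using w by (simp add: front_push front_drop_front)

lemma ins_one: "ins u \<one>\<^bsub>\<G> u\<^esub> w \<asymp> w"
  unfolding ins_def using push_front[OF w] front_reduced_closed by simp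

text \<open>An equality and not just a shuffle: after inserting \<open>h\<close>, the syllable of
  \<open>u\<close> stands at the head or is absent, so the second insertion works in place.\<close>

lemma ins_ins:
  "\<lbrakk>g \<in> carrier (\<G> u); h \<in> carrier (\<G> u)\<rbrakk> \<Longrightarrow> ins u g (ins u h w) = ins u (g \<otimes>\<^bsub>\<G> u\<^esub> h) w"
  unfolding ins_def using w front_reduced_closed
  by (simp add: front_push drop_front_push front_drop_front reduced_drop_front Gu.m_assoc)

text \<open>Neither insertion sees the syllable of the other vertex, so both orders leave the same
  remainder behind two syllables that can be exchanged.\<close>

lemma ins_commute:
  assumes "adj u v"
  shows "ins u g (ins v h w) \<asymp> ins v h (ins u g w)"
proof -
  let ?g = "g \<otimes>\<^bsub>\<G> u\<^esub> front u w" and ?h = "h \<otimes>\<^bsub>\<G> v\<^esub> front v w"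
  let ?w = "drop_front u (drop_front v w)"
  have "ins u g (ins v h w) = push u ?g (push v ?h ?w)"
    using assms by (simp add: ins_def front_push_adj front_drop_front_adj drop_front_push_adj)
  moreover have "ins v h (ins u g w) = push v ?h (push u ?g ?w)"
    using assms adj_sym[OF assms]
    by (simp add: ins_def front_push_adj front_drop_front_adj drop_front_push_adj drop_front_commute)
  moreover have "push u ?g (push v ?h ?w) \<asymp> push v ?h (push u ?g ?w)"
    using assms by (auto simp: push_def intro: shuffle.refl shuffle.swap)
  ultimately show ?thesis by simp
qed

end

lemma front_ins_adj: "adj u v \<Longrightarrow> front u (ins v g w) = front u w"
  by (simp add: ins_def front_push_adj front_drop_front_adj)

lemma act_simps [simp]: "act [] w = w" "act (s # v) w = ins (fst s) (snd s) (act v w)"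
  by (simp_all add: act_def)

lemma act_append: "act (v @ w) x = act v (act w x)"
  by (simp add: act_def)

lemma shuffle_act: "v \<asymp> w \<Longrightarrow> act x v \<asymp> act x w"
  by (induction x) (auto intro: shuffle_ins)

lemma reduced_act: "v \<in> words \<Longrightarrow> reduced w \<Longrightarrow> reduced (act v w)"
  by (induction v) (auto intro: reduced_ins)

text \<open>Rebuilding a reduced word syllable by syllable never merges or deletes anything. Thus
  the action on the empty word recovers a reduced word.\<close>

lemma act_reduced_Nil: "reduced w \<Longrightarrow> act w [] = w"
proof (induction w)
  case (Cons s w)
  then interpret group "\<G> (fst s)" by (auto intro: vertex_group)
  have "snd s \<otimes>\<^bsub>\<G> (fst s)\<^esub> \<one>\<^bsub>\<G> (fst s)\<^esub> = snd s"
    using Cons.prems by (intro r_one) simp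
  then show ?case using Cons by (simp add: ins_def drop_front_trivial push_def)
qed simp

text \<open>Normalising creates no new vertices, which later keeps reduced representatives of
  elements of \<open>parabolic\<close> inside the given vertex set.\<close>

lemma fst_act_subset: "fst ` set (act v w) \<subseteq> fst ` set v \<union> fst ` set w"
proof (induction v)
  case (Cons s v)
  have "fst ` set (drop_front u x) \<subseteq> fst ` set x" for u x
    by (induction x) auto
  then have "fst ` set (ins u g x) \<subseteq> insert u (fst ` set x)" for u g x
    by (simp add: ins_def push_def subset_insertI2)
  from this[of "fst s" "snd s" "act v w"] show ?case using Cons by auto
qed simp

section \<open>Reduced words seen from their right end\<close>

lemma front_append:
  "front v (w @ [s]) = (if (\<forall>t\<in>set w. adj v (fst t)) then if fst s = v then snd s else \<one>\<^bsub>\<G> v\<^esub> else front v w)"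
  by (induction w) (auto simp: adj_irrefl)

lemma front_append_blocked:
  "\<not> (\<forall>t\<in>set w. adj v (fst t)) \<Longrightarrow> front v (w @ x) = front v w"
  by (induction w) (auto simp: adj_irrefl)

lemma reduced_appendD: "reduced (v @ w) \<Longrightarrow> reduced v \<and> reduced w"
proof (induction v)
  case (Cons s v)
  then have *: "reduced v" "reduced w" "front (fst s) (v @ w) = \<one>\<^bsub>\<G> (fst s)\<^esub>" by auto
  have "front (fst s) v = \<one>\<^bsub>\<G> (fst s)\<^esub>"
  proof (cases "\<forall>t\<in>set v. adj (fst s) (fst t)")
    case True
    \<comment> \<open>All of \<open>v\<close> is adjacent to the vertex of \<open>s\<close>, so no
      syllable of \<open>v\<close> belongs to that vertex itself.\<close>
    then show ?thesis by (induction v) (auto simp: adj_irrefl)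
  next
    case False
    then show ?thesis using *(3) front_append_blocked by metis
  qed
  then show ?case using Cons * by auto
qed simp

text \<open>The new syllable can only be obstructed by one of the same vertex that can be shuffled
  to the end. Exposing it there reduces right multiplication to a change of the last entry.\<close>

lemma reduced_snoc_cases:
  assumes "reduced w" "fst s \<in> verts \<Gamma>" "snd s \<in> carrier (\<G> (fst s))" "snd s \<noteq> \<one>\<^bsub>\<G> (fst s)\<^esub>"
  shows "reduced (w @ [s]) \<or> (\<exists>x k. w \<asymp> x @ [(fst s, k)])"
  using assms(1)
proof (induction w)
  case Nil
  then show ?case using assms by simp
next
  case (Cons a w)
  show ?case
  proof (cases "\<exists>x k. w \<asymp> x @ [(fst s, k)]")
    case True
    then obtain x k where "w \<asymp> x @ [(fst s, k)]" by blast
    then have "a # w \<asymp> (a # x) @ [(fst s, k)]" by (auto intro: shuffle.cons)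
    then show ?thesis by blast
  next
    case False
    then have r: "reduced (w @ [s])" using Cons by auto
    show ?thesis
    proof (cases "front (fst a) (w @ [s]) = \<one>\<^bsub>\<G> (fst a)\<^esub>")
      case True
      then show ?thesis using r Cons.prems by simp
    next
      case nt: False
      \<comment> \<open>The only obstruction left is that \<open>a\<close> itself meets
        \<open>s\<close>, which requires \<open>a\<close> to commute past all of
        \<open>w\<close>.\<close>
      then have "\<forall>t\<in>set w. adj (fst a) (fst t)" "fst s = fst a"
        using Cons.prems unfolding front_append by (auto split: if_splits)
      then have "a # w \<asymp> w @ [(fst s, snd a)]" using shuffle_move[of w a] by simp
      then show ?thesis by blast
    qed
  qed
qed

lemma reduced_replace_last:
  assumes "reduced (w @ [(u, g)])" "h \<in> carrier (\<G> u)" "h \<noteq> \<one>\<^bsub>\<G> u\<^esub>"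
  shows "reduced (w @ [(u, h)])"
  using assms(1)
proof (induction w)
  case Nil
  then show ?case using assms by simp
next
  case (Cons a w)
  have "front (fst a) (w @ [(u, h)]) = \<one>\<^bsub>\<G> (fst a)\<^esub>"
  proof (cases "(\<forall>t\<in>set w. adj (fst a) (fst t)) \<and> u = fst a")
    case True
    then have "g = \<one>\<^bsub>\<G> u\<^esub>" using Cons.prems by (auto simp: front_append)
    moreover have "g \<noteq> \<one>\<^bsub>\<G> u\<^esub>" using reduced_appendD[OF Cons.prems] by simp
    ultimately show ?thesis by simp
  next
    case False
    then show ?thesis using Cons.prems by (auto simp: front_append split: if_splits)
  qed
  then show ?case using Cons by simp
qed

text \<open>Seen from the first \<open>v\<close>-syllable, the search passes over neighbours of
  \<open>v\<close> and stops, at the latest at the last syllable, at a nontrivial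
  \<open>v\<close>-syllable. Geometrically, a reduced word cannot cross a hyperplane twice.\<close>

lemma not_reduced_star:
  assumes "fst ` set w \<subseteq> star \<Gamma> v"
  shows "\<not> reduced ((v, g) # w @ [(v, h)])"
proof
  assume r: "reduced ((v, g) # w @ [(v, h)])"
  have "reduced (w @ [(v, h)]) \<Longrightarrow> front v (w @ [(v, h)]) \<noteq> \<one>\<^bsub>\<G> v\<^esub>"
    using assms
  proof (induction w)
    case (Cons a w)
    then show ?case by (auto simp: star_def)
  qed simp
  then show False using r by simp
qed

end

section \<open>The graph product and its normal form\<close>

lemma (in group) normal_closure_normal:
  assumes "R \<subseteq> carrier G"
  shows "normal_closure G R \<lhd> G"
proof -
  let ?A = "{N. N \<lhd> G \<and> R \<subseteq> N}"
  have "carrier G \<in> ?A"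
    using assms by (auto simp: normal_inv_iff subgroup_self)
  then have "subgroup (\<Inter>?A) G"
    by (intro subgroups_Inter) (auto dest: normal_imp_subgroup)
  moreover have "x \<otimes> h \<otimes> inv x \<in> \<Inter>?A" if "x \<in> carrier G" "h \<in> \<Inter>?A" for x h
    using that by (auto simp: normal_inv_iff)
  ultimately show ?thesis by (auto simp: normal_closure_def normal_inv_iff)
qed

context graph_of_groups
begin

abbreviation FP :: "('v \<times> 'a) list set monoid" where
  "FP \<equiv> free_product (verts \<Gamma>) \<G>"

abbreviation P :: "('v \<times> 'a) list set set monoid" where
  "P \<equiv> graph_product \<Gamma> \<G>"

section \<open>The free product as a group of classes of words\<close>

definition cls :: "('v \<times> 'a) list \<Rightarrow> ('v \<times> 'a) list set" where
  "cls w = fp_rel (verts \<Gamma>) \<G> `` {w}"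

definition word_inv :: "('v \<times> 'a) list \<Rightarrow> ('v \<times> 'a) list" where
  "word_inv w = rev (map (\<lambda>s. (fst s, inv\<^bsub>\<G> (fst s)\<^esub> (snd s))) w)"

lemma word_inv_words: "w \<in> words \<Longrightarrow> word_inv w \<in> words"
  by (induction w) (auto simp: word_inv_def intro: group.inv_closed vertex_group)

lemma fp_step_context:
  assumes "fp_step (verts \<Gamma>) \<G> v w" "x \<in> words" "y \<in> words"
  shows "fp_step (verts \<Gamma>) \<G> (x @ v @ y) (x @ w @ y)"
  using assms(1)
proof cases
  case (unit xs ys u)
  then show ?thesis
    using fp_step.unit[of "x @ xs" "verts \<Gamma>" \<G> "ys @ y" u] assms(2,3) by simp
next
  case (mult xs ys u g h)
  then show ?thesis
    using fp_step.mult[of "x @ xs" "verts \<Gamma>" \<G> "ys @ y" u g h] assms(2,3) by simp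
qed

lemma fp_step_words: "fp_step (verts \<Gamma>) \<G> v w \<Longrightarrow> v \<in> words \<and> w \<in> words"
  by (induction rule: fp_step.induct)
    (auto intro: group.is_monoid monoid.one_closed monoid.m_closed vertex_group)

lemma equivclp_context:
  assumes "equivclp (fp_step (verts \<Gamma>) \<G>) v w" "x \<in> words" "y \<in> words"
  shows "equivclp (fp_step (verts \<Gamma>) \<G>) (x @ v @ y) (x @ w @ y)"
  using assms(1)
proof (induction rule: equivclp_induct)
  case base
  then show ?case by (rule equivclp_refl)
next
  case (step a b)
  then have "equivclp (fp_step (verts \<Gamma>) \<G>) (x @ a @ y) (x @ b @ y)"
    using fp_step_context assms(2,3) equivclp_sym r_into_equivclp by metis
  with step.IH show ?case by (rule equivclp_trans)
qed

lemma equiv_fp_rel: "equiv words (fp_rel (verts \<Gamma>) \<G>)"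
  by (rule equivI)
    (auto simp: fp_rel_def refl_on_def sym_def trans_def intro: equivclp_refl equivclp_sym equivclp_trans)

lemma cls_eq_iff: "v \<in> words \<Longrightarrow> w \<in> words \<Longrightarrow> cls v = cls w \<longleftrightarrow> equivclp (fp_step (verts \<Gamma>) \<G>) v w"
  unfolding cls_def by (simp add: eq_equiv_class_iff[OF equiv_fp_rel]) (simp add: fp_rel_def)

lemma mem_cls: "v \<in> cls w \<Longrightarrow> v \<in> words \<and> w \<in> words \<and> cls v = cls w"
proof -
  assume "v \<in> cls w"
  then have *: "v \<in> words" "w \<in> words" "equivclp (fp_step (verts \<Gamma>) \<G>) w v"
    by (auto simp: cls_def fp_rel_def)
  with cls_eq_iff[of w v] show ?thesis by simp
qed

lemma self_cls: "w \<in> words \<Longrightarrow> w \<in> cls w"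
  by (auto simp: cls_def fp_rel_def intro: equivclp_refl)

lemma cls_append_cong:
  assumes "v \<in> words" "w \<in> words" "v' \<in> words" "w' \<in> words" "cls v = cls v'" "cls w = cls w'"
  shows "cls (v @ w) = cls (v' @ w')"
proof -
  have "equivclp (fp_step (verts \<Gamma>) \<G>) (v @ w) (v' @ w)"
    using equivclp_context[of v v' "[]" w] assms cls_eq_iff by simp
  moreover have "equivclp (fp_step (verts \<Gamma>) \<G>) (v' @ w) (v' @ w')"
    using equivclp_context[of w w' v' "[]"] assms cls_eq_iff by simp
  ultimately show ?thesis using assms by (simp add: cls_eq_iff) (rule equivclp_trans)
qed

lemma carrier_FP: "carrier FP = cls ` words"
  by (auto simp: free_product_def cls_def quotient_def)

lemma mult_FP:
  assumes "v \<in> words" "w \<in> words"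
  shows "cls v \<otimes>\<^bsub>FP\<^esub> cls w = cls (v @ w)"
proof -
  have "cls v \<otimes>\<^bsub>FP\<^esub> cls w = (\<Union>v'\<in>cls v. \<Union>w'\<in>cls w. cls (v' @ w'))"
    by (simp add: free_product_def cls_def)
  also have "\<dots> = (\<Union>v'\<in>cls v. \<Union>w'\<in>cls w. cls (v @ w))"
    using mem_cls by (intro SUP_cong HOL.refl cls_append_cong) blast+
  also have "\<dots> = cls (v @ w)" using self_cls assms by blast
  finally show ?thesis .
qed

lemma one_FP: "\<one>\<^bsub>FP\<^esub> = cls []"
  by (simp add: free_product_def cls_def)

lemma cls_step: "fp_step (verts \<Gamma>) \<G> v w \<Longrightarrow> cls v = cls w"
  using fp_step_words cls_eq_iff by (metis r_into_equivclp)

lemma cls_unit: "xs \<in> words \<Longrightarrow> ys \<in> words \<Longrightarrow> u \<in> verts \<Gamma> \<Longrightarrow> cls (xs @ (u, \<one>\<^bsub>\<G> u\<^esub>) # ys) = cls (xs @ ys)"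
  using cls_step[OF fp_step.unit] by force

lemma cls_mult:
  "\<lbrakk>xs \<in> words; ys \<in> words; u \<in> verts \<Gamma>; g \<in> carrier (\<G> u); h \<in> carrier (\<G> u)\<rbrakk>
    \<Longrightarrow> cls (xs @ (u, g) # (u, h) # ys) = cls (xs @ (u, g \<otimes>\<^bsub>\<G> u\<^esub> h) # ys)"
  using cls_step[OF fp_step.mult] by force

text \<open>The innermost pair of syllables is merged and deleted, and so on outwards.\<close>

lemma cls_word_inv: "w \<in> words \<Longrightarrow> cls (word_inv w @ w) = cls []"
proof (induction w)
  case (Cons s w)
  obtain u g where s: "s = (u, g)" by (cases s)
  have *: "u \<in> verts \<Gamma>" "g \<in> carrier (\<G> u)" "w \<in> words" "word_inv w \<in> words"
    using Cons.prems s word_inv_words by auto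
  interpret group "\<G> u" using * by (intro vertex_group)
  have "cls (word_inv (s # w) @ s # w) = cls (word_inv w @ (u, inv\<^bsub>\<G> u\<^esub> g) # (u, g) # w)"
    by (simp add: word_inv_def s)
  also have "\<dots> = cls (word_inv w @ (u, \<one>\<^bsub>\<G> u\<^esub>) # w)"
    using * s by (subst cls_mult) auto
  also have "\<dots> = cls (word_inv w @ w)" using * by (simp add: cls_unit)
  finally show ?case using Cons.IH * by simp
qed (simp add: word_inv_def)

lemma group_FP: "group FP"
proof (rule groupI)
  fix x assume "x \<in> carrier FP"
  then obtain w where w: "w \<in> words" "x = cls w" by (auto simp: carrier_FP)
  then show "\<exists>y\<in>carrier FP. y \<otimes>\<^bsub>FP\<^esub> x = \<one>\<^bsub>FP\<^esub>"
    using word_inv_words cls_word_inv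
    by (intro bexI[of _ "cls (word_inv w)"]) (auto simp: carrier_FP mult_FP one_FP)
qed (auto simp: carrier_FP mult_FP one_FP)

interpretation FP: group FP by (rule group_FP)

lemma inv_FP: "w \<in> words \<Longrightarrow> inv\<^bsub>FP\<^esub> (cls w) = cls (word_inv w)"
  using cls_word_inv word_inv_words
  by (intro FP.inv_equality) (auto simp: mult_FP one_FP carrier_FP)

lemma relators_subset: "gp_relators \<Gamma> \<G> \<subseteq> carrier FP"
proof
  fix r assume "r \<in> gp_relators \<Gamma> \<G>"
  then obtain u v g h where uv: "adj u v" "g \<in> carrier (\<G> u)" "h \<in> carrier (\<G> v)"
    and r: "r = commutator FP (cls [(u, g)]) (cls [(v, h)])"
    by (auto simp: gp_relators_def fp_emb_def simp flip: cls_def)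
  have "cls [(u, g)] \<in> carrier FP" "cls [(v, h)] \<in> carrier FP"
    using adj_verts[OF uv(1)] uv by (auto simp: carrier_FP)
  then show "r \<in> carrier FP" unfolding r commutator_def by simp
qed

lemma normal_kernel: "gp_kernel \<Gamma> \<G> \<lhd> FP"
  unfolding gp_kernel_def by (rule FP.normal_closure_normal[OF relators_subset])

section \<open>The action on reduced words and its kernel\<close>

lemma act_fp_step:
  assumes "fp_step (verts \<Gamma>) \<G> v w" "reduced x"
  shows "act v x \<asymp> act w x"
  using assms(1)
proof cases
  case (unit xs ys u)
  then show ?thesis using assms(2) by (auto simp: act_append intro!: shuffle_act ins_one reduced_act)
next
  case (mult xs ys u g h)
  then show ?thesis
    using assms(2) by (auto simp: act_append ins_ins reduced_act intro: shuffle.refl)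
qed

lemma act_cls:
  assumes "v \<in> words" "w \<in> words" "cls v = cls w" "reduced x"
  shows "act v x \<asymp> act w x"
proof -
  have "equivclp (fp_step (verts \<Gamma>) \<G>) v w" using assms cls_eq_iff by simp
  then show ?thesis
  proof (induction rule: equivclp_induct)
    case (step a b)
    then have "act a x \<asymp> act b x" using act_fp_step assms(4) shuffle_sym by metis
    with step.IH show ?case by (rule shuffle.trans)
  qed (rule shuffle.refl)
qed

text \<open>The kernel of the action on reduced words up to shuffling. Being normal and containing
  the relators, it contains \<open>gp_kernel\<close>, so the action descends to the graph
  product.\<close>

definition trivial_act :: "('v \<times> 'a) list set set" where
  "trivial_act = {cls w |w. w \<in> words \<and> (\<forall>x. reduced x \<longrightarrow> act w x \<asymp> x)}"

lemma trivial_actI: "w \<in> words \<Longrightarrow> (\<And>x. reduced x \<Longrightarrow> act w x \<asymp> x) \<Longrightarrow> cls w \<in> trivial_act"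
  unfolding trivial_act_def by blast

lemma trivial_actE:
  assumes "a \<in> trivial_act"
  obtains w where "a = cls w" "w \<in> words" "\<And>x. reduced x \<Longrightarrow> act w x \<asymp> x"
  using assms unfolding trivial_act_def by blast

lemma normal_trivial_act: "trivial_act \<lhd> FP"
proof -
  have "subgroup trivial_act FP"
  proof (rule FP.subgroupI)
    show "trivial_act \<subseteq> carrier FP" by (auto simp: trivial_act_def carrier_FP)
    have "cls [] \<in> trivial_act" by (rule trivial_actI) (simp_all add: shuffle.refl)
    then show "trivial_act \<noteq> {}" by blast
  next
    fix a assume "a \<in> trivial_act"
    then obtain w where w: "a = cls w" "w \<in> words" "\<And>x. reduced x \<Longrightarrow> act w x \<asymp> x"
      by (blast elim: trivial_actE)
    have "act (word_inv w) x \<asymp> x" if "reduced x" for x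
    proof -
      \<comment> \<open>\<open>w\<close> fixes the shuffle class of \<open>x\<close>, so it may be
        applied first, and then it cancels against its inverse.\<close>
      have "act (word_inv w) x \<asymp> act (word_inv w) (act w x)"
        by (rule shuffle_act[OF shuffle_sym[OF w(3)[OF that]]])
      also have "act (word_inv w) (act w x) \<asymp> act [] x"
        unfolding act_append[symmetric] using w that cls_word_inv word_inv_words by (intro act_cls) auto
      finally show ?thesis by simp
    qed
    then show "inv\<^bsub>FP\<^esub> a \<in> trivial_act"
      unfolding w(1) inv_FP[OF w(2)] using w(2) by (intro trivial_actI word_inv_words)
  next
    fix a b assume ab: "a \<in> trivial_act" "b \<in> trivial_act"
    obtain v where v: "a = cls v" "v \<in> words" "\<And>x. reduced x \<Longrightarrow> act v x \<asymp> x"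
      using ab(1) by (blast elim: trivial_actE)
    obtain w where w: "b = cls w" "w \<in> words" "\<And>x. reduced x \<Longrightarrow> act w x \<asymp> x"
      using ab(2) by (blast elim: trivial_actE)
    have "act (v @ w) x \<asymp> x" if "reduced x" for x
      using shuffle.trans[OF v(3)[OF reduced_act[OF w(2) that]] w(3)[OF that]] by (simp add: act_append)
    then show "a \<otimes>\<^bsub>FP\<^esub> b \<in> trivial_act"
      unfolding v(1) w(1) mult_FP[OF v(2) w(2)] using v(2) w(2) by (intro trivial_actI) auto
  qed
  moreover have "a \<otimes>\<^bsub>FP\<^esub> b \<otimes>\<^bsub>FP\<^esub> inv\<^bsub>FP\<^esub> a \<in> trivial_act"
    if "a \<in> carrier FP" "b \<in> trivial_act" for a b
  proof -
    obtain v where v: "a = cls v" "v \<in> words" using \<open>a \<in> carrier FP\<close> by (auto simp: carrier_FP)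
    obtain w where w: "b = cls w" "w \<in> words" "\<And>x. reduced x \<Longrightarrow> act w x \<asymp> x"
      using \<open>b \<in> trivial_act\<close> by (blast elim: trivial_actE)
    have i: "word_inv v \<in> words" using v by (simp add: word_inv_words)
    have c: "cls (v @ word_inv v) = cls []"
      using v i FP.r_inv[of a] by (simp add: carrier_FP inv_FP mult_FP one_FP)
    have "act (v @ w @ word_inv v) x \<asymp> x" if x: "reduced x" for x
    proof -
      have "act v (act w (act (word_inv v) x)) \<asymp> act v (act (word_inv v) x)"
        using i x by (intro shuffle_act w(3) reduced_act)
      also have "act v (act (word_inv v) x) \<asymp> act [] x"
        unfolding act_append[symmetric] using v i c x by (intro act_cls) auto
      finally show ?thesis by (simp add: act_append)
    qed
    then have "cls (v @ w @ word_inv v) \<in> trivial_act" using v w i by (intro trivial_actI) auto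
    then show ?thesis using v(1,2) w(1,2) i by (simp add: mult_FP inv_FP)
  qed
  ultimately show ?thesis by (simp add: FP.normal_inv_iff)
qed

lemma relators_trivial_act: "gp_relators \<Gamma> \<G> \<subseteq> trivial_act"
proof
  fix r assume "r \<in> gp_relators \<Gamma> \<G>"
  then obtain u v g h where uv: "adj u v" and g: "g \<in> carrier (\<G> u)" and h: "h \<in> carrier (\<G> v)"
    and r: "r = commutator FP (cls [(u, g)]) (cls [(v, h)])"
    by (auto simp: gp_relators_def fp_emb_def simp flip: cls_def)
  have V: "u \<in> verts \<Gamma>" "v \<in> verts \<Gamma>" using adj_verts[OF uv] by auto
  interpret Gu: group "\<G> u" using V by (intro vertex_group)
  interpret Gv: group "\<G> v" using V by (intro vertex_group)
  define w where "w = [(u, g), (v, h), (u, inv\<^bsub>\<G> u\<^esub> g), (v, inv\<^bsub>\<G> v\<^esub> h)]"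
  have "r = cls w"
    unfolding r commutator_def w_def using V g h by (simp add: inv_FP mult_FP word_inv_def)
  moreover have "w \<in> words" using V g h by (simp add: w_def)
  moreover have "act w x \<asymp> x" if x: "reduced x" for x
  proof -
    let ?g = "inv\<^bsub>\<G> u\<^esub> g" and ?h = "inv\<^bsub>\<G> v\<^esub> h"
    \<comment> \<open>The two middle syllables are exchanged, after which both pairs cancel; this
      exchange is where the adjacency of \<open>u\<close> and \<open>v\<close> enters.\<close>
    have "ins u g (ins v h (ins u ?g (ins v ?h x))) \<asymp> ins u g (ins u ?g (ins v h (ins v ?h x)))"
      using V g h x uv adj_sym by (intro shuffle_ins ins_commute reduced_ins) auto
    also have "\<dots> \<asymp> ins u \<one>\<^bsub>\<G> u\<^esub> (ins v \<one>\<^bsub>\<G> v\<^esub> x)"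
      using V g h x by (simp add: ins_ins reduced_ins shuffle.refl)
    also have "\<dots> \<asymp> ins v \<one>\<^bsub>\<G> v\<^esub> x" using V x by (intro ins_one reduced_ins) auto
    also have "\<dots> \<asymp> x" using V x by (intro ins_one) auto
    finally show ?thesis by (simp add: w_def)
  qed
  ultimately show "r \<in> trivial_act" using trivial_actI by blast
qed

lemma kernel_trivial_act: "gp_kernel \<Gamma> \<G> \<subseteq> trivial_act"
  unfolding gp_kernel_def normal_closure_def using normal_trivial_act relators_trivial_act by blast

section \<open>Words as elements of the graph product\<close>

definition gp :: "('v \<times> 'a) list \<Rightarrow> ('v \<times> 'a) list set set" where
  "gp w = gp_kernel \<Gamma> \<G> #>\<^bsub>FP\<^esub> cls w"

lemma group_P: "group P"
  unfolding graph_product_def by (rule normal.factorgroup_is_group[OF normal_kernel])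

lemma carrier_P: "carrier P = gp ` words"
  by (auto simp: graph_product_def FactGroup_def RCOSETS_def gp_def carrier_FP)

lemma gp_closed [intro, simp]: "w \<in> words \<Longrightarrow> gp w \<in> carrier P"
  by (simp add: carrier_P)

lemma gp_append: "v \<in> words \<Longrightarrow> w \<in> words \<Longrightarrow> gp (v @ w) = gp v \<otimes>\<^bsub>P\<^esub> gp w"
  by (simp add: graph_product_def FactGroup_def gp_def normal.rcos_sum[OF normal_kernel] carrier_FP mult_FP)

lemma gp_Nil [simp]: "gp [] = \<one>\<^bsub>P\<^esub>"
proof -
  have "gp_kernel \<Gamma> \<G> \<subseteq> carrier FP"
    using normal_imp_subgroup[OF normal_kernel] by (rule subgroup.subset)
  then show ?thesis
    by (simp add: graph_product_def FactGroup_def gp_def FP.coset_mult_one flip: one_FP)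
qed

lemma gp_emb_eq: "gp_emb \<Gamma> \<G> u g = gp [(u, g)]"
  by (simp add: gp_emb_def gp_def fp_emb_def cls_def)

lemma gp_cls_cong: "cls v = cls w \<Longrightarrow> gp v = gp w"
  by (simp add: gp_def)

lemma gp_unit: "u \<in> verts \<Gamma> \<Longrightarrow> gp [(u, \<one>\<^bsub>\<G> u\<^esub>)] = \<one>\<^bsub>P\<^esub>"
  using gp_cls_cong[OF cls_unit[of "[]" "[]" u]] by simp

lemma gp_mult:
  "\<lbrakk>u \<in> verts \<Gamma>; g \<in> carrier (\<G> u); h \<in> carrier (\<G> u)\<rbrakk>
    \<Longrightarrow> gp [(u, g)] \<otimes>\<^bsub>P\<^esub> gp [(u, h)] = gp [(u, g \<otimes>\<^bsub>\<G> u\<^esub> h)]"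
  using gp_cls_cong[OF cls_mult[of "[]" "[]" u g h]] gp_append[of "[(u, g)]" "[(u, h)]"] by simp

lemma gp_commute:
  assumes "adj u v" "g \<in> carrier (\<G> u)" "h \<in> carrier (\<G> v)"
  shows "gp [(u, g), (v, h)] = gp [(v, h), (u, g)]"
proof -
  have V: "u \<in> verts \<Gamma>" "v \<in> verts \<Gamma>" using adj_verts[OF assms(1)] by auto
  let ?K = "gp_kernel \<Gamma> \<G>"
  let ?a = "cls [(u, g)]" and ?b = "cls [(v, h)]"
  have ab: "?a \<in> carrier FP" "?b \<in> carrier FP" using V assms by (auto simp: carrier_FP)
  have sub: "subgroup ?K FP" by (rule normal_imp_subgroup[OF normal_kernel])
  have "commutator FP ?a ?b \<in> gp_relators \<Gamma> \<G>"
    using assms by (auto simp: gp_relators_def fp_emb_def cls_def)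
  then have K: "commutator FP ?a ?b \<in> ?K" by (auto simp: gp_kernel_def normal_closure_def)
  have "?a \<otimes>\<^bsub>FP\<^esub> ?b = commutator FP ?a ?b \<otimes>\<^bsub>FP\<^esub> (?b \<otimes>\<^bsub>FP\<^esub> ?a)"
    unfolding commutator_def using ab by (simp add: FP.m_assoc FP.inv_solve_left')
  then have "?a \<otimes>\<^bsub>FP\<^esub> ?b \<in> ?K #>\<^bsub>FP\<^esub> (?b \<otimes>\<^bsub>FP\<^esub> ?a)" using K by (auto simp: r_coset_def)
  then have "?K #>\<^bsub>FP\<^esub> (?b \<otimes>\<^bsub>FP\<^esub> ?a) = ?K #>\<^bsub>FP\<^esub> (?a \<otimes>\<^bsub>FP\<^esub> ?b)"
    using FP.repr_independence ab sub by blast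
  then show ?thesis using V assms by (simp add: gp_def mult_FP)
qed

text \<open>In the free product the two classes differ by an element of the kernel, and kernel
  elements act trivially.\<close>

theorem gp_eq_act:
  assumes "v \<in> words" "w \<in> words" "gp v = gp w" "reduced x"
  shows "act v x \<asymp> act w x"
proof -
  have sub: "subgroup (gp_kernel \<Gamma> \<G>) FP" by (rule normal_imp_subgroup[OF normal_kernel])
  have "cls v \<in> gp_kernel \<Gamma> \<G> #>\<^bsub>FP\<^esub> cls w"
    using FP.rcos_self[OF _ sub, of "cls v"] assms by (simp add: gp_def carrier_FP)
  then obtain c where "c \<in> gp_kernel \<Gamma> \<G>" "cls v = c \<otimes>\<^bsub>FP\<^esub> cls w" by (auto simp: r_coset_def)
  then obtain k where k: "k \<in> words" "\<And>x. reduced x \<Longrightarrow> act k x \<asymp> x" "cls v = cls (k @ w)"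
  proof -
    have "c \<in> trivial_act" using kernel_trivial_act \<open>c \<in> gp_kernel \<Gamma> \<G>\<close> by blast
    then show thesis using that \<open>cls v = _\<close> assms(2) by (elim trivial_actE) (simp add: mult_FP)
  qed
  have "act v x \<asymp> act (k @ w) x" using k assms by (intro act_cls) auto
  also have "act (k @ w) x \<asymp> act w x"
    using k reduced_act[OF assms(2,4)] by (simp add: act_append)
  finally show ?thesis .
qed

end

section \<open>Sectors of hyperplanes\<close>

context graph_of_groups
begin

interpretation P: group P by (rule group_P)

lemma gp_Cons: "s # w \<in> words \<Longrightarrow> gp (s # w) = gp [s] \<otimes>\<^bsub>P\<^esub> gp w"
  using gp_append[of "[s]" w] by simp

lemma gp_inv:
  assumes "u \<in> verts \<Gamma>" "g \<in> carrier (\<G> u)"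
  shows "inv\<^bsub>P\<^esub> (gp [(u, g)]) = gp [(u, inv\<^bsub>\<G> u\<^esub> g)]"
proof -
  interpret group "\<G> u" using assms by (intro vertex_group)
  show ?thesis using assms by (intro P.inv_equality) (simp_all add: gp_mult gp_unit)
qed

lemma gp_shuffle: "v \<asymp> w \<Longrightarrow> v \<in> words \<Longrightarrow> gp v = gp w"
proof (induction rule: shuffle.induct)
  case (swap s t w)
  have "gp (s # t # w) = gp [s, t] \<otimes>\<^bsub>P\<^esub> gp w" "gp (t # s # w) = gp [t, s] \<otimes>\<^bsub>P\<^esub> gp w"
    using swap.prems gp_append[of "[s, t]" w] gp_append[of "[t, s]" w] by auto
  then show ?case using gp_commute[OF swap.hyps, of "snd s" "snd t"] swap.prems by simp
next
  case (cons v w s)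
  have "s # w \<in> words" using cons.prems shuffle_words[OF cons.hyps] by simp
  then show ?case using cons gp_Cons[of s v] gp_Cons[of s w] by simp
next
  case (trans u v w)
  then show ?case using shuffle_words[OF trans.hyps(1)] by simp
qed simp

lemma gp_push:
  "\<lbrakk>u \<in> verts \<Gamma>; g \<in> carrier (\<G> u); w \<in> words\<rbrakk> \<Longrightarrow> gp (push u g w) = gp [(u, g)] \<otimes>\<^bsub>P\<^esub> gp w"
  using gp_Cons[of "(u, g)" w] by (simp add: push_def gp_unit)

lemma gp_ins:
  assumes "u \<in> verts \<Gamma>" "g \<in> carrier (\<G> u)" "reduced w"
  shows "gp (ins u g w) = gp [(u, g)] \<otimes>\<^bsub>P\<^esub> gp w"
proof -
  interpret group "\<G> u" using assms by (intro vertex_group)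
  have f: "front u w \<in> carrier (\<G> u)" using assms by (intro front_reduced_closed)
  have d: "drop_front u w \<in> words" using assms by (intro reduced_words reduced_drop_front)
  have "push u (front u w) (drop_front u w) \<in> words" using assms f d by (auto simp: push_def)
  then have "gp w = gp (push u (front u w) (drop_front u w))"
    using gp_shuffle[OF push_front[OF assms(3)]] by simp
  then show ?thesis
    unfolding ins_def using assms f d by (simp add: gp_push flip: gp_mult P.m_assoc)
qed

lemma gp_act: "v \<in> words \<Longrightarrow> reduced w \<Longrightarrow> gp (act v w) = gp v \<otimes>\<^bsub>P\<^esub> gp w"
proof (induction v)
  case (Cons s v)
  then show ?case
    using gp_Cons[of s v] by (simp add: gp_ins reduced_act P.m_assoc reduced_words)
qed (simp add: reduced_words)

lemma reduced_rep:
  assumes "y \<in> carrier P"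
  obtains w where "reduced w" "y = gp w"
proof -
  obtain v where "v \<in> words" "y = gp v" using assms by (auto simp: carrier_P)
  then show thesis using that[of "act v []"] by (simp add: gp_act reduced_act)
qed

text \<open>Both words act alike on the empty word, from which a reduced word reproduces
  itself.\<close>

theorem reduced_unique:
  assumes "reduced v" "reduced w" "gp v = gp w"
  shows "v \<asymp> w"
  using gp_eq_act[of v w "[]"] assms by (simp add: reduced_words act_reduced_Nil)

text \<open>The projection of \<open>y\<close> to the clique of \<open>v\<close> through the
  identity. The chosen reduced word does not matter, since two of them differ by shuffling.\<close>

definition Front :: "'v \<Rightarrow> ('v \<times> 'a) list set set \<Rightarrow> 'a" where
  "Front v y = front v (SOME w. reduced w \<and> y = gp w)"

lemma Front_gp: "reduced w \<Longrightarrow> Front v (gp w) = front v w"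
proof -
  assume "reduced w"
  then have "\<exists>w'. reduced w' \<and> gp w = gp w'" by blast
  from someI_ex[OF this] have "(SOME w'. reduced w' \<and> gp w = gp w') \<asymp> w"
    using \<open>reduced w\<close> by (intro reduced_unique) auto
  then show ?thesis unfolding Front_def by (rule shuffle_front)
qed

lemma Front_closed: "v \<in> verts \<Gamma> \<Longrightarrow> y \<in> carrier P \<Longrightarrow> Front v y \<in> carrier (\<G> v)"
  by (erule reduced_rep) (simp add: Front_gp front_reduced_closed)

lemma Front_one: "Front v \<one>\<^bsub>P\<^esub> = \<one>\<^bsub>\<G> v\<^esub>"
  using Front_gp[of "[]"] by simp

lemma Front_mult_same:
  assumes "v \<in> verts \<Gamma>" "g \<in> carrier (\<G> v)" "y \<in> carrier P"
  shows "Front v (gp [(v, g)] \<otimes>\<^bsub>P\<^esub> y) = g \<otimes>\<^bsub>\<G> v\<^esub> Front v y"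
proof -
  obtain w where "reduced w" "y = gp w" using assms(3) by (rule reduced_rep)
  then show ?thesis using assms(1,2) by (simp add: Front_gp front_ins reduced_ins flip: gp_ins)
qed

lemma Front_mult_adj:
  assumes "adj v u" "g \<in> carrier (\<G> u)" "y \<in> carrier P"
  shows "Front v (gp [(u, g)] \<otimes>\<^bsub>P\<^esub> y) = Front v y"
proof -
  have "u \<in> verts \<Gamma>" using adj_verts[OF assms(1)] by simp
  moreover obtain w where "reduced w" "y = gp w" using assms(3) by (rule reduced_rep)
  ultimately show ?thesis
    using assms(1,2) by (simp add: Front_gp front_ins_adj reduced_ins flip: gp_ins)
qed

section \<open>Subgroups generated by stars, and the sectors of their cosets\<close>

abbreviation star_group :: "'v \<Rightarrow> ('v \<times> 'a) list set set set" where
  "star_group v \<equiv> parabolic \<Gamma> \<G> (star \<Gamma> v)"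

lemma star_verts: "star \<Gamma> v \<subseteq> verts \<Gamma>"
  by (auto simp: star_def)

lemma parabolic_eq:
  assumes "U \<subseteq> verts \<Gamma>"
  shows "parabolic \<Gamma> \<G> U = gp ` {w \<in> words. fst ` set w \<subseteq> U}"
proof (intro equalityI subsetI)
  fix y assume "y \<in> parabolic \<Gamma> \<G> U"
  then show "y \<in> gp ` {w \<in> words. fst ` set w \<subseteq> U}"
    unfolding parabolic_def
  proof (induction rule: generate.induct)
    case one
    then show ?case by (intro image_eqI[of _ _ "[]"]) auto
  next
    case (incl h)
    then obtain u g where "u \<in> U" "g \<in> carrier (\<G> u)" "h = gp [(u, g)]" by (auto simp: gp_emb_eq)
    then show ?case using assms by (intro image_eqI[of _ _ "[(u, g)]"]) auto
  next
    case (inv h)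
    then obtain u g where h: "u \<in> U" "g \<in> carrier (\<G> u)" "h = gp [(u, g)]" by (auto simp: gp_emb_eq)
    then have "inv\<^bsub>\<G> u\<^esub> g \<in> carrier (\<G> u)" using assms by (intro group.inv_closed vertex_group) auto
    then show ?case using assms h
      by (intro image_eqI[of _ _ "[(u, inv\<^bsub>\<G> u\<^esub> g)]"]) (auto simp: gp_inv subset_iff)
  next
    case (eng h1 h2)
    then obtain w1 w2 where "h1 = gp w1" "h2 = gp w2" "w1 \<in> words" "w2 \<in> words"
      "fst ` set w1 \<subseteq> U" "fst ` set w2 \<subseteq> U" by auto
    then show ?case by (intro image_eqI[of _ _ "w1 @ w2"]) (auto simp: gp_append)
  qed
next
  fix y assume "y \<in> gp ` {w \<in> words. fst ` set w \<subseteq> U}"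
  then obtain w where w: "y = gp w" "w \<in> words" "fst ` set w \<subseteq> U" by blast
  from w(2,3) have "gp w \<in> parabolic \<Gamma> \<G> U"
  proof (induction w)
    case Nil
    then show ?case by (simp add: parabolic_def generate.one)
  next
    case (Cons s w)
    have "gp [s] \<in> (\<Union>v\<in>U. gp_emb \<Gamma> \<G> v ` carrier (\<G> v))"
      using Cons.prems by (cases s) (auto simp: gp_emb_eq)
    then have "gp [s] \<in> parabolic \<Gamma> \<G> U" unfolding parabolic_def by (rule generate.incl)
    moreover have "gp w \<in> parabolic \<Gamma> \<G> U" using Cons by simp
    ultimately show ?case
      unfolding gp_Cons[OF Cons.prems(1)] unfolding parabolic_def by (rule generate.eng)
  qed
  then show "y \<in> parabolic \<Gamma> \<G> U" by (simp add: w)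
qed

lemma subgroup_star_group: "subgroup (star_group v) P"
  unfolding parabolic_def
proof (rule P.generate_is_subgroup)
  show "(\<Union>u\<in>star \<Gamma> v. gp_emb \<Gamma> \<G> u ` carrier (\<G> u)) \<subseteq> carrier P"
    using star_verts[of v] by (auto simp: gp_emb_eq subset_iff)
qed

lemma star_group_word: "w \<in> words \<Longrightarrow> fst ` set w \<subseteq> star \<Gamma> v \<Longrightarrow> gp w \<in> star_group v"
  by (auto simp: parabolic_eq[OF star_verts])

lemma star_group_adj_word:
  assumes "w \<in> words" "\<forall>t\<in>set w. adj v (fst t)"
  shows "gp w \<in> star_group v"
  using assms adj_verts by (intro star_group_word) (auto simp: star_def)

text \<open>Normalising a word over the star gives a reduced word over the star, and by uniqueness
  every other reduced word is a shuffle of it.\<close>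

lemma reduced_star_group:
  assumes "reduced w" "gp w \<in> star_group v"
  shows "fst ` set w \<subseteq> star \<Gamma> v"
proof -
  obtain x where x: "gp w = gp x" "x \<in> words" "fst ` set x \<subseteq> star \<Gamma> v"
    using assms(2) by (auto simp: parabolic_eq[OF star_verts])
  have "w \<asymp> act x []"
    using assms(1) x by (intro reduced_unique) (auto simp: reduced_act gp_act)
  then have "set w = set (act x [])" by (rule shuffle_set)
  then show ?thesis using fst_act_subset[of x "[]"] x(3) by auto
qed

text \<open>The star acts on the sectors of its own hyperplane through \<open>\<G> v\<close>:
  syllables of neighbours of \<open>v\<close> act trivially, those of \<open>v\<close> by left
  multiplication. The same \<open>c\<close> serves all \<open>y\<close>, which makes distances
  between sectors well defined.\<close>

lemma Front_mult_star_group: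
  assumes "v \<in> verts \<Gamma>" "b \<in> star_group v"
  shows "\<exists>c\<in>carrier (\<G> v). \<forall>y\<in>carrier P. Front v (b \<otimes>\<^bsub>P\<^esub> y) = c \<otimes>\<^bsub>\<G> v\<^esub> Front v y"
proof -
  interpret group "\<G> v" using assms(1) by (rule vertex_group)
  obtain w where w: "b = gp w" "w \<in> words" "fst ` set w \<subseteq> star \<Gamma> v"
    using assms(2) by (auto simp: parabolic_eq[OF star_verts])
  from w(2,3) show ?thesis unfolding w(1)
  proof (induction w)
    case Nil
    then show ?case using assms(1) by (intro bexI[of _ "\<one>\<^bsub>\<G> v\<^esub>"]) (auto simp: Front_closed)
  next
    case (Cons s w)
    then obtain c where c: "c \<in> carrier (\<G> v)"
      "\<And>y. y \<in> carrier P \<Longrightarrow> Front v (gp w \<otimes>\<^bsub>P\<^esub> y) = c \<otimes>\<^bsub>\<G> v\<^esub> Front v y" by auto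
    obtain u g where s: "s = (u, g)" by (cases s)
    have *: "gp (s # w) \<otimes>\<^bsub>P\<^esub> y = gp [s] \<otimes>\<^bsub>P\<^esub> (gp w \<otimes>\<^bsub>P\<^esub> y)" if "y \<in> carrier P" for y
      using Cons.prems that gp_Cons[of s w] by (simp add: P.m_assoc)
    show ?case
    proof (cases "u = v")
      case True
      have "Front v (gp (s # w) \<otimes>\<^bsub>P\<^esub> y) = g \<otimes>\<^bsub>\<G> v\<^esub> c \<otimes>\<^bsub>\<G> v\<^esub> Front v y" if "y \<in> carrier P" for y
        using *[OF that] Cons.prems s True c assms(1) that
        by (simp add: Front_mult_same Front_closed m_assoc)
      then show ?thesis using Cons.prems c s True by (intro bexI[of _ "g \<otimes>\<^bsub>\<G> v\<^esub> c"]) auto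
    next
      case False
      then have "adj v u" using Cons.prems s by (auto simp: star_def)
      then have "Front v (gp (s # w) \<otimes>\<^bsub>P\<^esub> y) = c \<otimes>\<^bsub>\<G> v\<^esub> Front v y" if "y \<in> carrier P" for y
        using *[OF that] Cons.prems s c that by (simp add: Front_mult_adj)
      then show ?thesis using c by blast
    qed
  qed
qed

text \<open>Right multiplication moves a point within the clique of its last syllable, so it can only
  cross the hyperplane of that clique.\<close>

lemma Front_right_syllable:
  assumes y: "y \<in> carrier P" and u: "u \<in> verts \<Gamma>" "h \<in> carrier (\<G> u)"
    and B: "\<not> (u = v \<and> y \<in> star_group v)"
  shows "Front v (y \<otimes>\<^bsub>P\<^esub> gp [(u, h)]) = Front v y"
proof (cases "h = \<one>\<^bsub>\<G> u\<^esub>")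
  case True
  then show ?thesis using y u by (simp add: gp_unit)
next
  case nontriv: False
  interpret group "\<G> u" using u by (intro vertex_group)
  obtain w where w: "reduced w" "y = gp w" using y by (rule reduced_rep)
  \<comment> \<open>The appended syllable is visible to \<open>v\<close> only if it belongs to
    \<open>v\<close> and all of \<open>x\<close> is adjacent to \<open>v\<close>; then
    \<open>x\<close> lies in the star-subgroup.\<close>
  have last: "front v (x @ [(u, k)]) = front v x"
    if "x \<in> words" "gp x \<in> star_group v \<longrightarrow> u \<noteq> v" for x k
    using that star_group_adj_word[of x v]
  proof (cases "\<forall>t\<in>set x. adj v (fst t)")
    case True
    then have "front v x = \<one>\<^bsub>\<G> v\<^esub>" by (induction x) (auto simp: adj_irrefl)
    then show ?thesis using True that star_group_adj_word[of x v] by (simp add: front_append)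
  qed (rule front_append_blocked)
  from reduced_snoc_cases[OF w(1), of "(u, h)"] u nontriv
  consider "reduced (w @ [(u, h)])" | x k where "w \<asymp> x @ [(u, k)]" by auto
  then show ?thesis
  proof cases
    case 1
    have "y \<otimes>\<^bsub>P\<^esub> gp [(u, h)] = gp (w @ [(u, h)])" using w u by (simp add: gp_append reduced_words)
    then show ?thesis using 1 w B last[of w h] by (auto simp: Front_gp reduced_words)
  next
    case 2
    then have r: "reduced (x @ [(u, k)])" using w shuffle_reduced by blast
    then have x: "reduced x" "k \<in> carrier (\<G> u)" using reduced_appendD[OF r] by auto
    have yx: "y = gp (x @ [(u, k)])" using gp_shuffle[OF 2] w reduced_words by auto
    then have yx': "y = gp x \<otimes>\<^bsub>P\<^esub> gp [(u, k)]" using x u by (simp add: gp_append reduced_words)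
    \<comment> \<open>If both held, \<open>y\<close> would lie in the star-subgroup as well, against
      the hypothesis.\<close>
    have "gp x \<in> star_group v \<longrightarrow> u \<noteq> v"
    proof
      assume *: "gp x \<in> star_group v"
      show "u \<noteq> v"
      proof
        assume "u = v"
        then have "gp [(u, k)] \<in> star_group v"
          using u x by (intro star_group_word) (auto simp: star_def)
        then have "y \<in> star_group v"
          using * yx' subgroup.m_closed[OF subgroup_star_group] by metis
        with B \<open>u = v\<close> show False by simp
      qed
    qed
    note last' = last[OF reduced_words[OF x(1)] this]
    have *: "y \<otimes>\<^bsub>P\<^esub> gp [(u, h)] = gp (x @ [(u, k \<otimes>\<^bsub>\<G> u\<^esub> h)])"
      using yx' x u by (simp add: P.m_assoc gp_mult gp_append reduced_words)
    show ?thesis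
    proof (cases "k \<otimes>\<^bsub>\<G> u\<^esub> h = \<one>\<^bsub>\<G> u\<^esub>")
      case True
      then have "y \<otimes>\<^bsub>P\<^esub> gp [(u, h)] = gp x"
        using * x u by (simp add: gp_append reduced_words gp_unit)
      then show ?thesis using x last'[of k] r yx by (simp add: Front_gp)
    next
      case False
      then have "reduced (x @ [(u, k \<otimes>\<^bsub>\<G> u\<^esub> h)])"
        using reduced_replace_last[OF r] x u by simp
      then show ?thesis using * last' r yx by (simp add: Front_gp)
    qed
  qed
qed

text \<open>Along the path from \<open>x\<close> spelled by \<open>w\<close>, the sector can only
  change at a \<open>v\<close>-syllable that starts on the hyperplane through 1.\<close>

lemma Front_right_cross:
  assumes "x \<in> carrier P" "w \<in> words" "Front v (x \<otimes>\<^bsub>P\<^esub> gp w) \<noteq> Front v x"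
  shows "\<exists>w1 h w2. w = w1 @ (v, h) # w2 \<and> x \<otimes>\<^bsub>P\<^esub> gp w1 \<in> star_group v"
  using assms(2,3)
proof (induction w rule: rev_induct)
  case Nil
  then show ?case using assms(1) by simp
next
  case (snoc s w)
  obtain u h where s: "s = (u, h)" by (cases s)
  have *: "w \<in> words" "u \<in> verts \<Gamma>" "h \<in> carrier (\<G> u)" using snoc.prems s by auto
  have e: "x \<otimes>\<^bsub>P\<^esub> gp (w @ [s]) = x \<otimes>\<^bsub>P\<^esub> gp w \<otimes>\<^bsub>P\<^esub> gp [(u, h)]"
    using * s assms(1) by (simp add: gp_append P.m_assoc)
  show ?case
  proof (cases "Front v (x \<otimes>\<^bsub>P\<^esub> gp w) = Front v x")
    case True
    then have "u = v" "x \<otimes>\<^bsub>P\<^esub> gp w \<in> star_group v"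
      using Front_right_syllable[of "x \<otimes>\<^bsub>P\<^esub> gp w" u h v] * snoc.prems e assms(1) by auto
    then show ?thesis using s by blast
  next
    case False
    then show ?thesis using snoc.IH * by force
  qed
qed

text \<open>The coset of \<open>y\<close> is disjoint from the star-subgroup, so a path inside it
  never meets the hyperplane through 1. This is why hyperplanes of one colour are not
  transverse.\<close>

lemma Front_right_star_group:
  assumes "y \<in> carrier P" "y \<notin> star_group v" "b \<in> star_group v"
  shows "Front v (y \<otimes>\<^bsub>P\<^esub> b) = Front v y"
proof (rule ccontr)
  assume ne: "\<not> ?thesis"
  obtain w where w: "b = gp w" "w \<in> words" "fst ` set w \<subseteq> star \<Gamma> v"
    using assms(3) by (auto simp: parabolic_eq[OF star_verts])
  obtain w1 h w2 where w1: "w = w1 @ (v, h) # w2" "y \<otimes>\<^bsub>P\<^esub> gp w1 \<in> star_group v"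
    using Front_right_cross[OF assms(1) w(2), of v] ne w(1) by blast
  then have "gp w1 \<in> star_group v" using w by (intro star_group_word) auto
  then have "y \<otimes>\<^bsub>P\<^esub> gp w1 \<otimes>\<^bsub>P\<^esub> inv\<^bsub>P\<^esub> (gp w1) \<in> star_group v"
    using w1 subgroup_star_group[of v] by (metis subgroup.m_closed subgroup.m_inv_closed)
  moreover have "gp w1 \<in> carrier P" using w w1 by auto
  ultimately show False using assms by (simp add: P.m_assoc)
qed

text \<open>\<open>Front v (inv g \<otimes> x)\<close> names the sector of \<open>x\<close> with respect to the hyperplane
  \<open>g \<langle>star v\<rangle>\<close>, so this separates the hyperplanes of \<open>1\<close> and \<open>m\<close>.\<close>

lemma Front_separation:
  assumes m: "m \<in> carrier P" "m \<notin> star_group v" and z: "z \<in> carrier P"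
  shows "Front v z = Front v m \<or> Front v (inv\<^bsub>P\<^esub> m \<otimes>\<^bsub>P\<^esub> z) = Front v (inv\<^bsub>P\<^esub> m)"
proof (rule disjCI)
  \<comment> \<open>As seen from \<open>m\<close>, the points 1 and \<open>z\<close> are then in
    different sectors, so a reduced path from 1 to \<open>z\<close> meets the hyperplane of
    \<open>m\<close>. Up to there it has already settled its sector with respect to the hyperplane
    of 1.\<close>
  assume ne: "Front v (inv\<^bsub>P\<^esub> m \<otimes>\<^bsub>P\<^esub> z) \<noteq> Front v (inv\<^bsub>P\<^esub> m)"
  obtain w where w: "reduced w" "z = gp w" using z by (rule reduced_rep)
  obtain w1 h w2 where w1: "w = w1 @ (v, h) # w2" and B: "inv\<^bsub>P\<^esub> m \<otimes>\<^bsub>P\<^esub> gp w1 \<in> star_group v"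
    using Front_right_cross[of "inv\<^bsub>P\<^esub> m" w v] ne w m reduced_words P.inv_closed by blast
  have r1: "reduced w1" using reduced_appendD w w1 by blast
  then have c1: "gp w1 \<in> carrier P" by (auto intro: reduced_words)
  have e: "m \<otimes>\<^bsub>P\<^esub> (inv\<^bsub>P\<^esub> m \<otimes>\<^bsub>P\<^esub> gp w1) = gp w1"
    using m c1 by (simp flip: P.m_assoc)
  have "gp w1 \<notin> star_group v"
  proof
    assume "gp w1 \<in> star_group v"
    moreover have "inv\<^bsub>P\<^esub> (inv\<^bsub>P\<^esub> m \<otimes>\<^bsub>P\<^esub> gp w1) \<in> star_group v"
      using B subgroup.m_inv_closed[OF subgroup_star_group] by blast
    ultimately have "gp w1 \<otimes>\<^bsub>P\<^esub> inv\<^bsub>P\<^esub> (inv\<^bsub>P\<^esub> m \<otimes>\<^bsub>P\<^esub> gp w1) \<in> star_group v"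
      using subgroup.m_closed[OF subgroup_star_group] by blast
    moreover have "gp w1 \<otimes>\<^bsub>P\<^esub> inv\<^bsub>P\<^esub> (inv\<^bsub>P\<^esub> m \<otimes>\<^bsub>P\<^esub> gp w1) = m"
      using m c1 by (simp add: P.inv_mult_group flip: P.m_assoc)
    ultimately show False using m by simp
  qed
  \<comment> \<open>The prefix \<open>w1\<close> contains a syllable at which the search for
    \<open>v\<close> stops, so it alone decides \<open>front\<close> of the whole word.\<close>
  then have "\<not> (\<forall>t\<in>set w1. adj v (fst t))"
    using star_group_adj_word reduced_words[OF r1] by blast
  then have "front v w = front v w1" unfolding w1 by (rule front_append_blocked)
  moreover have "Front v m = Front v (gp w1)"
    using Front_right_star_group[OF m B] e by simp
  ultimately show "Front v z = Front v m" using w r1 by (simp add: Front_gp)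
qed

end

section \<open>Tree-graded distances\<close>

text \<open>Summing over the support makes the sum finite; over an infinite set of hyperplanes
  \<open>sum\<close> would return 0.\<close>

definition hyperplane_dist :: "'j set \<Rightarrow> ('j \<Rightarrow> 'x \<Rightarrow> 'x \<Rightarrow> real) \<Rightarrow> 'x \<Rightarrow> 'x \<Rightarrow> real" where
  "hyperplane_dist H \<delta> x y = (\<Sum>J\<in>{J \<in> H. \<delta> J x y \<noteq> 0}. \<delta> J x y)"

text \<open>A hyperplane is represented by its carrier, a set of points; \<open>\<delta> J\<close> measures the distance
  between the projections to \<open>J\<close>, so \<open>\<delta> J x y = 0\<close> says that \<open>x\<close> and \<open>y\<close> lie in the same sector
  of \<open>J\<close>.\<close>

locale tree_graded =
  fixes X :: "'x set" and H :: "'x set set" and \<delta> :: "'x set \<Rightarrow> 'x \<Rightarrow> 'x \<Rightarrow> real"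
    and btw :: "'x \<Rightarrow> 'x \<Rightarrow> 'x \<Rightarrow> bool"
  assumes H_subset: "J \<in> H \<Longrightarrow> J \<subseteq> X"
    and \<delta>_nonneg: "\<lbrakk>J \<in> H; x \<in> X; y \<in> X\<rbrakk> \<Longrightarrow> 0 \<le> \<delta> J x y"
    and \<delta>_refl: "\<lbrakk>J \<in> H; x \<in> X\<rbrakk> \<Longrightarrow> \<delta> J x x = 0"
    and \<delta>_sym: "\<lbrakk>J \<in> H; x \<in> X; y \<in> X\<rbrakk> \<Longrightarrow> \<delta> J x y = \<delta> J y x"
    and \<delta>_triangle: "\<lbrakk>J \<in> H; x \<in> X; y \<in> X; z \<in> X\<rbrakk> \<Longrightarrow> \<delta> J x z \<le> \<delta> J x y + \<delta> J y z"
    and finite_support: "\<lbrakk>x \<in> X; y \<in> X\<rbrakk> \<Longrightarrow> finite {J \<in> H. \<delta> J x y \<noteq> 0}"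
    and gate: "\<lbrakk>J \<in> H; z \<in> X\<rbrakk> \<Longrightarrow> \<exists>b\<in>J. \<delta> J z b = 0"
    and separation: "\<lbrakk>J \<in> H; K \<in> H; J \<noteq> K; j \<in> J; k \<in> K; z \<in> X\<rbrakk> \<Longrightarrow> \<delta> J z k = 0 \<or> \<delta> K z j = 0"
    and thin: "\<lbrakk>J \<in> H; K \<in> H; J \<noteq> K; x \<in> J; y \<in> J\<rbrakk> \<Longrightarrow> \<delta> K x y = 0"
    and btw_mem: "\<lbrakk>btw x y z; x \<in> X; z \<in> X\<rbrakk> \<Longrightarrow> y \<in> X"
    and btw_left: "\<lbrakk>x \<in> X; z \<in> X\<rbrakk> \<Longrightarrow> btw x x z"
    and btw_\<delta>: "\<lbrakk>btw x y z; x \<in> X; z \<in> X; J \<in> H\<rbrakk> \<Longrightarrow> \<delta> J x y = 0 \<or> \<delta> J y z = 0"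
    and cross: "\<lbrakk>J \<in> H; p \<in> X; q \<in> X; \<delta> J p q \<noteq> 0\<rbrakk> \<Longrightarrow> \<exists>b\<in>J. btw p b q \<and> \<delta> J b q = 0"
    and path: "\<lbrakk>p \<in> X; q \<in> X; 0 < r; r \<le> hyperplane_dist H \<delta> p q\<rbrakk> \<Longrightarrow>
      \<exists>J\<in>H. \<exists>a\<in>J. \<exists>b\<in>J. btw p a b \<and> btw p a q \<and> btw p b q \<and> btw a b q \<and>
        hyperplane_dist H \<delta> p a < r \<and> r \<le> hyperplane_dist H \<delta> p b"
begin

abbreviation d :: "'x \<Rightarrow> 'x \<Rightarrow> real" where
  "d \<equiv> hyperplane_dist H \<delta>"

section \<open>The sum of the projection distances and its cut points\<close>

lemma H_mem: "J \<in> H \<Longrightarrow> x \<in> J \<Longrightarrow> x \<in> X"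
  using H_subset by blast

lemma \<delta>_zero_trans: "\<lbrakk>J \<in> H; x \<in> X; y \<in> X; z \<in> X; \<delta> J x y = 0\<rbrakk> \<Longrightarrow> \<delta> J x z = \<delta> J y z"
  using \<delta>_triangle[of J x y z] \<delta>_triangle[of J y x z] \<delta>_sym[of J x y] by linarith

lemma d_eq_sum: "\<lbrakk>finite A; A \<subseteq> H; {J \<in> H. \<delta> J x y \<noteq> 0} \<subseteq> A\<rbrakk> \<Longrightarrow> d x y = (\<Sum>J\<in>A. \<delta> J x y)"
  unfolding hyperplane_dist_def by (intro sum.mono_neutral_left) auto

lemma d_nonneg: "x \<in> X \<Longrightarrow> y \<in> X \<Longrightarrow> 0 \<le> d x y"
  unfolding hyperplane_dist_def by (intro sum_nonneg) (auto intro: \<delta>_nonneg)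

lemma d_sym: "x \<in> X \<Longrightarrow> y \<in> X \<Longrightarrow> d x y = d y x"
  unfolding hyperplane_dist_def by (intro sum.cong) (auto simp: \<delta>_sym)

text \<open>A common finite set of hyperplanes allows the three sums to be compared term by
  term.\<close>

lemma d_sums:
  assumes "x \<in> X" "y \<in> X" "z \<in> X"
  obtains A where "finite A" "A \<subseteq> H" "d x z = (\<Sum>J\<in>A. \<delta> J x z)"
    "d x y + d y z = (\<Sum>J\<in>A. \<delta> J x y + \<delta> J y z)"
proof
  let ?A = "{J \<in> H. \<delta> J x y \<noteq> 0} \<union> {J \<in> H. \<delta> J y z \<noteq> 0} \<union> {J \<in> H. \<delta> J x z \<noteq> 0}"
  show fin: "finite ?A" using finite_support assms by blast
  show "?A \<subseteq> H" by blast
  show "d x z = (\<Sum>J\<in>?A. \<delta> J x z)" using fin by (intro d_eq_sum) auto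
  have "d x y = (\<Sum>J\<in>?A. \<delta> J x y)" "d y z = (\<Sum>J\<in>?A. \<delta> J y z)"
    using fin by (auto intro!: d_eq_sum)
  then show "d x y + d y z = (\<Sum>J\<in>?A. \<delta> J x y + \<delta> J y z)" by (simp add: sum.distrib)
qed

lemma d_triangle:
  assumes "x \<in> X" "y \<in> X" "z \<in> X"
  shows "d x z \<le> d x y + d y z"
proof -
  obtain A where "finite A" "A \<subseteq> H" "d x z = (\<Sum>J\<in>A. \<delta> J x z)"
    "d x y + d y z = (\<Sum>J\<in>A. \<delta> J x y + \<delta> J y z)" using assms by (rule d_sums)
  then show ?thesis using \<delta>_triangle assms by (auto intro!: sum_mono)
qed

lemma d_add:
  assumes "x \<in> X" "y \<in> X" "z \<in> X" "\<And>J. J \<in> H \<Longrightarrow> \<delta> J x y = 0 \<or> \<delta> J y z = 0"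
  shows "d x z = d x y + d y z"
proof -
  obtain A where A: "finite A" "A \<subseteq> H" "d x z = (\<Sum>J\<in>A. \<delta> J x z)"
    "d x y + d y z = (\<Sum>J\<in>A. \<delta> J x y + \<delta> J y z)" using assms(1-3) by (rule d_sums)
  have "\<delta> J x z = \<delta> J x y + \<delta> J y z" if "J \<in> H" for J
    using assms(4)[OF that]
  proof
    assume "\<delta> J x y = 0"
    then show ?thesis using \<delta>_zero_trans[of J x y z] that assms by simp
  next
    assume "\<delta> J y z = 0"
    then show ?thesis
      using \<delta>_zero_trans[of J z y x] \<delta>_sym[of J y z] \<delta>_sym[of J x z] \<delta>_sym[of J x y] that assms by simp
  qed
  then show ?thesis using A by (auto intro!: sum.cong)
qed

lemma btw_d: "\<lbrakk>btw x y z; x \<in> X; z \<in> X\<rbrakk> \<Longrightarrow> d x z = d x y + d y z"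
  using btw_mem btw_\<delta> by (intro d_add) auto

text \<open>Otherwise some \<open>J\<close> separates \<open>x\<close> from both \<open>z\<close>
  and \<open>p\<close>, and some \<open>K\<close> separates \<open>x\<close> from both
  \<open>z\<close> and \<open>q\<close>; they differ because \<open>x\<close> is between
  \<open>p\<close> and \<open>q\<close>. If \<open>x\<close> is in the sector of \<open>J\<close>
  that contains \<open>K\<close>, then \<open>z\<close> and \<open>p\<close> lie behind
  \<open>J\<close>, so \<open>K\<close> does not separate them; yet it separates \<open>z\<close>
  from \<open>x\<close> and not \<open>x\<close> from \<open>p\<close>. The other case of
  \<open>separation\<close> is symmetric.\<close>

lemma cut:
  assumes "btw p x q" "p \<in> X" "q \<in> X" "z \<in> X"
  shows "d z p = d z x + d x p \<or> d z q = d z x + d x q"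
proof (rule ccontr)
  assume ne: "\<not> ?thesis"
  have x: "x \<in> X" using btw_mem assms by blast
  obtain J where J: "J \<in> H" "\<delta> J z x \<noteq> 0" "\<delta> J x p \<noteq> 0"
    using d_add[of z x p] ne x assms by blast
  obtain K where K: "K \<in> H" "\<delta> K z x \<noteq> 0" "\<delta> K x q \<noteq> 0"
    using d_add[of z x q] ne x assms by blast
  have Jq: "\<delta> J x q = 0" using btw_\<delta>[OF assms(1-3) J(1)] J(1,3) \<delta>_sym assms x by metis
  have Kp: "\<delta> K x p = 0" using btw_\<delta>[OF assms(1-3) K(1)] K(1,3) \<delta>_sym assms x by metis
  have JK: "J \<noteq> K" using Jq K by blast
  obtain j k where jk: "j \<in> J" "k \<in> K" using gate J(1) K(1) x by blast
  then have jkX: "j \<in> X" "k \<in> X" using H_mem J K by auto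
  have sep: "\<delta> J y k = 0 \<or> \<delta> K y j = 0" if "y \<in> X" for y
    using separation[OF J(1) K(1) JK jk that] .
  have moved: "\<delta> J y k \<noteq> 0" if "y \<in> X" "\<delta> J x k = 0" "\<delta> J x y \<noteq> 0" for y
    using \<delta>_zero_trans[of J x k y] \<delta>_sym[of J k y] that J jkX x by auto
  have moved': "\<delta> K y j \<noteq> 0" if "y \<in> X" "\<delta> K x j = 0" "\<delta> K x y \<noteq> 0" for y
    using \<delta>_zero_trans[of K x j y] \<delta>_sym[of K j y] that K jkX x by auto
  from sep[OF x] show False
  proof
    assume *: "\<delta> J x k = 0"
    have "\<delta> J x z \<noteq> 0" using J \<delta>_sym x assms by metis
    then have "\<delta> K z j = 0" "\<delta> K p j = 0" using sep moved * assms J by blast+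
    then have "\<delta> K z p = 0"
      using \<delta>_zero_trans[of K z j p] \<delta>_sym[of K j p] K jkX assms by auto
    then show False
      using \<delta>_zero_trans[of K z p x] \<delta>_sym[of K p x] Kp K x assms by auto
  next
    assume *: "\<delta> K x j = 0"
    have "\<delta> K x z \<noteq> 0" using K \<delta>_sym x assms by metis
    then have "\<delta> J z k = 0" "\<delta> J q k = 0" using sep moved' * assms K by blast+
    then have "\<delta> J z q = 0"
      using \<delta>_zero_trans[of J z k q] \<delta>_sym[of J k q] J jkX assms by auto
    then show False
      using \<delta>_zero_trans[of J z q x] \<delta>_sym[of J q x] Jq J x assms by auto
  qed
qed

section \<open>Gates and bridges of hyperplanes\<close>

lemma d_hyperplane:
  assumes "J \<in> H" "x \<in> J" "y \<in> J"
  shows "d x y = \<delta> J x y"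
  using d_eq_sum[of "{J}" x y] thin[of J _ x y] assms by auto

text \<open>Only \<open>J\<close> contributes to distances inside \<open>J\<close>, and it does not
  separate \<open>p\<close> from \<open>a\<close>; so no hyperplane contributes to both
  legs.\<close>

lemma d_gate:
  assumes "J \<in> H" "a \<in> J" "m \<in> J" "p \<in> X" "\<delta> J p a = 0"
  shows "d p m = d p a + \<delta> J a m"
proof -
  have "\<delta> K p a = 0 \<or> \<delta> K a m = 0" if "K \<in> H" for K
    using thin[of J K a m] assms that by (cases "K = J") auto
  then have "d p m = d p a + d a m" using assms H_mem by (intro d_add) auto
  then show ?thesis using d_hyperplane assms by simp
qed

text \<open>All of \<open>K\<close> lies in a single sector of \<open>J\<close>, so one gate serves
  every point of \<open>K\<close>.\<close>

lemma bridge: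
  assumes "J \<in> H" "K \<in> H" "J \<noteq> K" and k: "k \<in> K"
  obtains m where "m \<in> J" "\<And>y. y \<in> K \<Longrightarrow> \<delta> J m y = 0"
proof -
  have kX: "k \<in> X" using H_mem assms by blast
  obtain m where m: "m \<in> J" "\<delta> J k m = 0" using gate[OF assms(1) kX] by blast
  have "\<delta> J m y = 0" if y: "y \<in> K" for y
  proof -
    have X: "y \<in> X" "m \<in> X" using H_mem assms m y by auto
    have "\<delta> J k y = 0" using thin[of K J k y] assms k y by auto
    then show ?thesis using \<delta>_zero_trans[of J k m y] m X kX assms by auto
  qed
  then show thesis using that m by blast
qed

text \<open>The point \<open>y\<close> is not in the sector of \<open>J\<close> that faces
  \<open>K\<close>, and \<open>z\<close> is not in the sector of \<open>K\<close> that faces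
  \<open>J\<close>, so going from one to the other uses the bridge from \<open>m\<close> to
  \<open>n\<close>.\<close>

lemma d_bridge:
  assumes J: "J \<in> H" and K: "K \<in> H" and JK: "J \<noteq> K"
    and m: "m \<in> J" "\<And>y. y \<in> K \<Longrightarrow> \<delta> J m y = 0"
    and n: "n \<in> K" "\<And>y. y \<in> J \<Longrightarrow> \<delta> K n y = 0"
    and y: "y \<in> X" "\<delta> J y m \<noteq> 0" and z: "z \<in> X" "\<delta> K z n \<noteq> 0"
  shows "\<delta> J z m = 0" and "d y z = d y m + d m n + d n z"
proof -
  have mX: "m \<in> X" and nX: "n \<in> X" using m n J K H_mem by auto
  have "\<delta> K z m \<noteq> 0"
    using \<delta>_zero_trans[of K n m z] n(2)[OF m(1)] \<delta>_sym[of K z m] \<delta>_sym[of K z n] z K mX nX by auto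
  then have "\<delta> J z n = 0" using separation[OF J K JK m(1) n(1) z(1)] by auto
  then show Jz: "\<delta> J z m = 0"
    using \<delta>_zero_trans[of J z n m] \<delta>_sym[of J n m] m(2)[OF n(1)] z J mX nX by auto
  have "\<delta> J y n \<noteq> 0"
    using \<delta>_zero_trans[of J m n y] m(2)[OF n(1)] \<delta>_sym[of J y m] \<delta>_sym[of J y n] y J mX nX by auto
  then have "\<delta> K y m = 0" using separation[OF J K JK m(1) n(1) y(1)] by auto
  then have Ky: "\<delta> K y n = 0"
    using \<delta>_zero_trans[of K y m n] \<delta>_sym[of K n m] n(2)[OF m(1)] y K mX nX by auto
  have Jmn: "\<delta> J m n = 0" and Kmn: "\<delta> K m n = 0"
    using m(2)[OF n(1)] n(2)[OF m(1)] \<delta>_sym[of K m n] K mX nX by auto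
  have Jnz: "\<delta> J n z = 0"
    using \<delta>_zero_trans[of J m n z] Jmn Jz \<delta>_sym[of J m z] J mX nX z by auto
  have Kym: "\<delta> K y m = 0" by fact
  \<comment> \<open>A further hyperplane that separates \<open>y\<close> from \<open>m\<close> lies
    behind \<open>J\<close>, while \<open>n\<close> and \<open>z\<close> are on the side of
    \<open>m\<close>; hence it separates none of these.\<close>
  have ym: "\<delta> L m n = 0 \<and> \<delta> L n z = 0" if L: "L \<in> H" and ne: "\<delta> L y m \<noteq> 0" for L
  proof (cases "L = J \<or> L = K")
    case True
    then show ?thesis using Jmn Jnz Kym ne by auto
  next
    case False
    obtain l where l: "l \<in> L" using gate L mX by blast
    then have lX: "l \<in> X" using L H_mem by blast
    have sep: "\<delta> J x l = 0 \<or> \<delta> L x m = 0" if "x \<in> X" for x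
      using separation[OF J L _ m(1) l that] False by blast
    have "\<delta> J y l = 0" using sep[OF y(1)] ne by blast
    then have ml: "\<delta> J m l \<noteq> 0"
      using \<delta>_zero_trans[of J y l m] \<delta>_sym[of J l m] y J mX lX by auto
    then have "\<delta> J n l \<noteq> 0" "\<delta> J z l \<noteq> 0"
      using \<delta>_zero_trans[of J n m l] \<delta>_zero_trans[of J z m l] Jmn Jz \<delta>_sym[of J n m] J mX nX z lX
      by auto
    then have "\<delta> L n m = 0" "\<delta> L z m = 0" using sep nX z(1) by blast+
    then show ?thesis
      using \<delta>_sym[of L n m] \<delta>_zero_trans[of L n m z] \<delta>_sym[of L z m] L mX nX z by auto
  qed
  \<comment> \<open>The mirror image of the previous step, with \<open>K\<close> in the role of
    \<open>J\<close>.\<close>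
  have nz: "\<delta> L m n = 0" if L: "L \<in> H" and ne: "\<delta> L n z \<noteq> 0" for L
  proof (cases "L = J \<or> L = K")
    case True
    then show ?thesis using Jmn Kmn by auto
  next
    case False
    obtain l where l: "l \<in> L" using gate L mX by blast
    then have lX: "l \<in> X" using L H_mem by blast
    have sep: "\<delta> K x l = 0 \<or> \<delta> L x n = 0" if "x \<in> X" for x
      using separation[OF K L _ n(1) l that] False by blast
    have "\<delta> K z l = 0" using sep[OF z(1)] ne \<delta>_sym[of L z n] L z nX by auto
    then have nl: "\<delta> K n l \<noteq> 0"
      using \<delta>_zero_trans[of K z l n] \<delta>_sym[of K l n] z K nX lX by auto
    then have "\<delta> K m l \<noteq> 0"
      using \<delta>_zero_trans[of K m n l] Kmn K mX nX lX by auto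
    then show ?thesis using sep mX by blast
  qed
  have "d m z = d m n + d n z" using nz mX nX z by (intro d_add) auto
  moreover have "d y z = d y m + d m z"
  proof (rule d_add)
    fix L assume L: "L \<in> H"
    show "\<delta> L y m = 0 \<or> \<delta> L m z = 0"
    proof (cases "\<delta> L y m = 0")
      case False
      then show ?thesis using ym[OF L False] \<delta>_zero_trans[of L m n z] L mX nX z by auto
    qed simp
  qed (use y z mX in auto)
  ultimately show "d y z = d y m + d m n + d n z" by simp
qed

text \<open>Invariance of the distance is a clause of its own, because the others do not make the
  induced map on \<open>H\<close> a bijection.\<close>

definition symmetry :: "('x \<Rightarrow> 'x) \<Rightarrow> bool" where
  "symmetry t \<longleftrightarrow> (\<forall>x\<in>X. t x \<in> X) \<and> (\<forall>J\<in>H. t ` J \<in> H) \<and>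
     (\<forall>J\<in>H. \<forall>x\<in>X. \<forall>y\<in>X. \<delta> (t ` J) (t x) (t y) = \<delta> J x y) \<and>
     (\<forall>x\<in>X. \<forall>y\<in>X. d (t x) (t y) = d x y)"

text \<open>If the middle of the near-diametral pair \<open>p, q\<close> lies inside the hyperplane \<open>J\<close> and
  \<open>J\<close> is moved by \<open>t\<close>, then \<open>p, t p\<close> is also near-diametral, and its middle is a cut point.\<close>

lemma moved_hyperplane:
  assumes t: "symmetry t"
    and pq: "p \<in> X" "q \<in> X" and dpq: "L - e \<le> d p q" "d p q \<le> L + e" and e: "0 \<le> e"
    and J: "J \<in> H" "a \<in> J" "b \<in> J" and pa: "\<delta> J p a = 0" and qb: "\<delta> J q b = 0"
    and split: "d p q = d p a + \<delta> J a b + d q b"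
    and al: "d p a < L / 2 - 4 * e" and be: "d q b < L / 2 - 3 * e"
    and far: "\<And>y z. y \<in> {p, q} \<Longrightarrow> z \<in> {t p, t q} \<Longrightarrow> d y z \<le> L + e"
    and moved: "t ` J \<noteq> J"
  shows "\<exists>x\<in>X. btw p x (t p) \<and> \<bar>d p x - L / 2\<bar> \<le> 13/2 * e \<and> \<bar>d x (t p) - L / 2\<bar> \<le> 13/2 * e"
proof -
  let ?K = "t ` J"
  have K: "?K \<in> H" using t J by (auto simp: symmetry_def)
  have JX: "a \<in> X" "b \<in> X" using J H_mem by auto
  have tX: "t p \<in> X" "t q \<in> X" using t pq by (auto simp: symmetry_def)
  obtain m where m: "m \<in> J" "\<And>y. y \<in> ?K \<Longrightarrow> \<delta> J m y = 0"
    using bridge[OF J(1) K moved[symmetric] imageI[OF J(2)]] by blast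
  obtain n where n: "n \<in> ?K" "\<And>y. y \<in> J \<Longrightarrow> \<delta> ?K n y = 0"
    using bridge[OF K J(1) moved J(2)] by blast
  have mX: "m \<in> X" and nX: "n \<in> X" using m n J K H_mem by blast+
  define k where "k = d m n"
  have k: "0 \<le> k" unfolding k_def using mX nX by (rule d_nonneg)
  define w where "w = \<delta> J a b"
  have p: "d p m = d p a + \<delta> J a m" and q: "d q m = d q b + \<delta> J b m"
    using d_gate[OF J(1,2) m(1) pq(1) pa] d_gate[OF J(1,3) m(1) pq(2) qb] .
  have tpa: "\<delta> ?K (t p) (t a) = 0" "\<delta> ?K (t q) (t b) = 0" "\<delta> ?K (t a) (t b) = w"
    using t J JX pq pa qb by (auto simp: symmetry_def w_def)
  have tdp: "d (t p) (t a) = d p a" "d (t q) (t b) = d q b"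
    using t JX pq by (auto simp: symmetry_def)
  have p': "d (t p) n = d p a + \<delta> ?K (t a) n" and q': "d (t q) n = d q b + \<delta> ?K (t b) n"
    using d_gate[OF K imageI[OF J(2)] n(1) tX(1) tpa(1)] d_gate[OF K imageI[OF J(3)] n(1) tX(2) tpa(2)]
    unfolding tdp .
  have taX: "t a \<in> X" "t b \<in> X" using t JX by (auto simp: symmetry_def)
  have tri: "w \<le> \<delta> J a m + \<delta> J b m" "w \<le> \<delta> ?K (t a) n + \<delta> ?K (t b) n"
    using \<delta>_triangle[of J a m b] \<delta>_sym[of J m b] \<delta>_triangle[of ?K "t a" n "t b"] \<delta>_sym[of ?K n "t b"]
      J K JX taX mX nX tpa by (auto simp: w_def)
  have pm: "\<delta> J p m = \<delta> J a m" and qm: "\<delta> J q m = \<delta> J b m"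
    using \<delta>_zero_trans[OF J(1) pq(1) JX(1) mX pa] \<delta>_zero_trans[OF J(1) pq(2) JX(2) mX qb] .
  have pn: "\<delta> ?K (t p) n = \<delta> ?K (t a) n" and qn: "\<delta> ?K (t q) n = \<delta> ?K (t b) n"
    using \<delta>_zero_trans[OF K tX(1) taX(1) nX tpa(1)] \<delta>_zero_trans[OF K tX(2) taX(2) nX tpa(2)] .
  have nonneg: "0 \<le> \<delta> J a m" "0 \<le> \<delta> J b m" "0 \<le> \<delta> ?K (t a) n" "0 \<le> \<delta> ?K (t b) n"
    using \<delta>_nonneg[OF J(1) JX(1) mX] \<delta>_nonneg[OF J(1) JX(2) mX]
      \<delta>_nonneg[OF K taX(1) nX] \<delta>_nonneg[OF K taX(2) nX] .
  have near_a: "\<delta> J b m = w" if "\<delta> J a m = 0"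
    using \<delta>_zero_trans[of J a m b] \<delta>_sym[of J m b] that J JX mX by (simp add: w_def)
  have near_b: "\<delta> J a m = w" if "\<delta> J b m = 0"
    using \<delta>_zero_trans[of J b m a] \<delta>_sym[of J m a] \<delta>_sym[of J a b] that J JX mX by (simp add: w_def)
  have near_ta: "\<delta> ?K (t b) n = w" if "\<delta> ?K (t a) n = 0"
    using \<delta>_zero_trans[of ?K "t a" n "t b"] \<delta>_sym[of ?K n "t b"] that tpa K taX nX by simp
  have near_tb: "\<delta> ?K (t a) n = w" if "\<delta> ?K (t b) n = 0"
    using \<delta>_zero_trans[of ?K "t b" n "t a"] \<delta>_sym[of ?K n "t a"] \<delta>_sym[of ?K "t a" "t b"] that tpa K taX nX
    by simp
  \<comment> \<open>Unless \<open>y\<close> or \<open>z\<close> sits in the sector facing the other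
    hyperplane, the bound on the diameter applies to the two legs and the bridge together.\<close>
  have far': "d y m + k + d z n \<le> L + e"
    if "y \<in> {p, q}" "z \<in> {t p, t q}" "\<delta> J y m \<noteq> 0" "\<delta> ?K z n \<noteq> 0" for y z
  proof -
    have "y \<in> X" "z \<in> X" using that pq tX by auto
    then have "d y z = d y m + d m n + d n z" "d n z = d z n"
      using d_bridge(2)[OF J(1) K moved[symmetric] m n] that d_sym nX by auto
    then show ?thesis using far[OF that(1,2)] by (simp add: k_def)
  qed
  have ppa: "\<delta> J a m = 0 \<or> \<delta> ?K (t a) n = 0 \<or> d p m + k + d (t p) n \<le> L + e"
    and pqa: "\<delta> J a m = 0 \<or> \<delta> ?K (t b) n = 0 \<or> d p m + k + d (t q) n \<le> L + e"
    and qpa: "\<delta> J b m = 0 \<or> \<delta> ?K (t a) n = 0 \<or> d q m + k + d (t p) n \<le> L + e"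
    and qqa: "\<delta> J b m = 0 \<or> \<delta> ?K (t b) n = 0 \<or> d q m + k + d (t q) n \<le> L + e"
    using far'[of p "t p"] far'[of p "t q"] far'[of q "t p"] far'[of q "t q"] pm qm pn qn by auto
  have sp: "d p q = d p a + w + d q b" using split by (simp add: w_def)
  have w: "0 < w" using sp dpq al be e by linarith
  \<comment> \<open>With \<open>a\<close> at the bridge, \<open>q\<close> would be farther than L/2
    + 3 * e from it. On the other side either one image is visible at more than L/2 + 2 * e, or both
    are visible and their legs add up to at least L - e. Each case exceeds the diameter L +
    e.\<close>
  have 1: "\<delta> J a m \<noteq> 0"
  proof
    assume "\<delta> J a m = 0"
    note z = this near_a[OF this]
    have B: "d q m > L / 2 + 3 * e" using q z sp dpq al by linarith
    show False
    proof (cases "\<delta> ?K (t a) n = 0")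
      case True
      note z' = True near_ta[OF True]
      have "d (t q) n > L / 2 + 3 * e" using q' z' sp dpq al by linarith
      then show False using B qqa z z' w k e by linarith
    next
      case a: False
      show False
      proof (cases "\<delta> ?K (t b) n = 0")
        case True
        have "d (t p) n > L / 2 + 2 * e" using p' near_tb[OF True] sp dpq be by linarith
        then show False using B qpa z a w k e by linarith
      next
        case False
        then show False using B qpa qqa z a w k e p' q' tri sp dpq by linarith
      qed
    qed
  qed
  have 2: "\<delta> J b m \<noteq> 0"
  proof
    assume "\<delta> J b m = 0"
    note z = this near_b[OF this]
    have A: "d p m > L / 2 + 2 * e" using p z sp dpq be by linarith
    show False
    proof (cases "\<delta> ?K (t a) n = 0")
      case True
      note z' = True near_ta[OF True]
      have "d (t q) n > L / 2 + 3 * e" using q' z' sp dpq al by linarith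
      then show False using A pqa z z' w k e by linarith
    next
      case a: False
      show False
      proof (cases "\<delta> ?K (t b) n = 0")
        case True
        have "d (t p) n > L / 2 + 2 * e" using p' near_tb[OF True] sp dpq be by linarith
        then show False using A ppa z a w k e by linarith
      next
        case False
        then show False using A ppa pqa z a w k e p' q' tri sp dpq by linarith
      qed
    qed
  qed
  have B: "d q m > d q b" "d p m > d p a" using 1 2 p q nonneg by auto
  have 3: "\<delta> ?K (t a) n \<noteq> 0"
  proof
    assume "\<delta> ?K (t a) n = 0"
    note z = this near_ta[OF this]
    have "d (t q) n > L / 2 + 3 * e" using q' z sp dpq al by linarith
    then show False using pqa qqa 1 2 z w k e p q tri sp dpq by linarith
  qed
  have 4: "\<delta> ?K (t b) n \<noteq> 0"
  proof
    assume "\<delta> ?K (t b) n = 0"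
    note z = this near_tb[OF this]
    have "d (t p) n > L / 2 + 2 * e" using p' z sp dpq be by linarith
    then show False using ppa qpa 1 2 z w k e p q tri sp dpq by linarith
  qed
  \<comment> \<open>Now all four distances from \<open>p\<close>, \<open>q\<close> to their images
    use the bridge. Adding the bounds in pairs, with the legs on each side adding up to at least L -
    e, puts \<open>m\<close> in the middle; the stated errors are generous.\<close>
  note bounds = ppa pqa qpa qqa 1 2 3 4 k p q p' q' tri sp dpq e
  have mid: "\<bar>d p m - L / 2\<bar> \<le> 7/2 * e" using bounds by linarith
  have mid': "\<bar>k + d (t p) n - L / 2\<bar> \<le> 13/2 * e" using bounds by linarith
  have pJ: "\<delta> J p m \<noteq> 0" and tpK: "\<delta> ?K (t p) n \<noteq> 0" using 1 3 pm pn by auto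
  note br = d_bridge[OF J(1) K moved[symmetric] m n pq(1) pJ tX(1) tpK]
  \<comment> \<open>\<open>m\<close> has the right distances, but the conclusion asks for a point
    that is \<open>btw\<close>, the relation shared by all colours. A crossing point of
    \<open>J\<close> has distance 0 from \<open>m\<close> and replaces it.\<close>
  have "\<delta> J p (t p) \<noteq> 0"
    using \<delta>_zero_trans[of J "t p" m p] br(1) \<delta>_sym[of J p "t p"] \<delta>_sym[of J p m] pJ J pq tX mX by auto
  from cross[OF J(1) pq(1) tX(1) this]
  obtain x where x: "x \<in> J" "btw p x (t p)" "\<delta> J x (t p) = 0" by blast
  have xX: "x \<in> X" using x J H_mem by blast
  have "\<delta> J x m = 0"
    using \<delta>_zero_trans[of J x "t p" m] x br(1) J xX tX mX by auto
  then have dxm: "d x m = 0" using d_hyperplane J x m by simp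
  have "d p x = d p m"
    using d_triangle[of p x m] d_triangle[of p m x] d_sym[of x m] dxm pq xX mX by auto
  moreover have "d x (t p) = d m (t p)"
    using d_triangle[of x m "t p"] d_triangle[of m x "t p"] d_sym[of x m] dxm tX xX mX by auto
  moreover have "d m (t p) = k + d (t p) n"
    using br(2) btw_d[OF x(2) pq(1) tX(1)] \<open>d p x = d p m\<close> \<open>d x (t p) = d m (t p)\<close> d_sym[of n "t p"] nX tX
    by (simp add: k_def)
  ultimately show ?thesis using x xX mid mid' e by (intro bexI[of _ x]) auto
qed

text \<open>\<open>L\<close> is the diameter up to the error \<open>e\<close>. In the application
  \<open>O1\<close> and \<open>O2\<close> are finite pieces of an orbit: the first contains the pair
  and its images, the second also the preimages of the first. They stand in for an invariant orbit,
  whose diameter is not bounded uniformly at a fixed index.\<close>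

theorem almost_fixed_or_stabilised:
  assumes sym: "\<And>t. t \<in> T \<Longrightarrow> symmetry t"
    and O12: "O1 \<subseteq> O2" "O2 \<subseteq> X" and pq: "p \<in> O1" "q \<in> O1"
    and tpq: "\<And>t. t \<in> T \<Longrightarrow> t p \<in> O1 \<and> t q \<in> O1"
    and pre: "\<And>t y. t \<in> T \<Longrightarrow> y \<in> O1 \<Longrightarrow> \<exists>z\<in>O2. t z = y"
    and diam: "\<And>y z. y \<in> O2 \<Longrightarrow> z \<in> O2 \<Longrightarrow> d y z \<le> L + e"
    and large: "L - e \<le> d p q" and e: "0 \<le> e" and L: "0 \<le> L"
  shows "(\<exists>J\<in>H. \<forall>t\<in>T. t ` J = J) \<or>
    (\<exists>p'\<in>O1. \<exists>q'\<in>O1. \<exists>x\<in>X. btw p' x q' \<and> (\<forall>t\<in>T. d x (t x) \<le> 14 * e))"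
proof -
  \<comment> \<open>A middle of two points at nearly maximal distance is a centre: by
    \<open>cut\<close>, all of \<open>O2\<close> is within L/2 + 15/2 * e of \<open>x\<close>.
    Pulling back along \<open>t\<close> gives the same bound between \<open>t x\<close> and
    \<open>O1\<close>, and cutting at \<open>x\<close> once more leaves 15/2 + 13/2 = 14.\<close>
  have centre: "d x (t x) \<le> 14 * e"
    if t: "t \<in> T" and p': "p' \<in> O1" "q' \<in> O1" and x: "x \<in> X" "btw p' x q'"
      and mid: "\<bar>d p' x - L / 2\<bar> \<le> 13/2 * e" "\<bar>d x q' - L / 2\<bar> \<le> 13/2 * e" for t p' q' x
  proof -
    have p'2: "p' \<in> O2" "q' \<in> O2" using p' O12 by auto
    then have X: "p' \<in> X" "q' \<in> X" using O12 by auto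
    have tx: "t x \<in> X" using sym[OF t] x by (auto simp: symmetry_def)
    have near: "d y (t x) \<le> L / 2 + 15/2 * e" if "y \<in> O1" for y
    proof -
      obtain z where z: "z \<in> O2" "t z = y" using pre t \<open>y \<in> O1\<close> by blast
      then have zX: "z \<in> X" using O12 by auto
      have "d z x \<le> L / 2 + 15/2 * e"
        using cut[OF x(2) X zX] diam[OF z(1) p'2(1)] diam[OF z(1) p'2(2)] mid d_sym[OF x(1) X(1)]
        by linarith
      moreover have "d (t z) (t x) = d z x" using sym[OF t] zX x by (auto simp: symmetry_def)
      ultimately show ?thesis using z by simp
    qed
    have "d (t x) p' \<le> L / 2 + 15/2 * e" "d (t x) q' \<le> L / 2 + 15/2 * e"
      using near[OF p'(1)] near[OF p'(2)] d_sym[OF tx X(1)] d_sym[OF tx X(2)] by auto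
    then have "d (t x) x \<le> 14 * e"
      using cut[OF x(2) X tx] mid d_sym[OF x(1) X(1)] by linarith
    then show ?thesis using d_sym[OF tx x(1)] by simp
  qed
  have pX: "p \<in> X" "q \<in> X" using pq O12 by auto
  have dpq: "d p q \<le> L + e" using diam pq O12 by blast
  show ?thesis
  proof (cases "d p q \<le> 0")
    case True
    have "d p p = 0" using btw_d[OF btw_left[OF pX] pX] by simp
    then have "\<bar>d p p - L / 2\<bar> \<le> 13/2 * e" "\<bar>d p q - L / 2\<bar> \<le> 13/2 * e"
      using True large L e d_nonneg[OF pX] by linarith+
    then show ?thesis using centre[OF _ pq pX(1)] btw_left pX pq by blast
  next
    case False
    \<comment> \<open>The hyperplane in which a geodesic from \<open>p\<close> to \<open>q\<close>
      passes the midpoint. If \<open>a\<close> or \<open>b\<close> is near the middle, it is the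
      centre; otherwise the geodesic has a long piece inside \<open>J\<close>.\<close>
    then obtain J a b where J: "J \<in> H" "a \<in> J" "b \<in> J" and
      btw: "btw p a b" "btw p a q" "btw p b q" "btw a b q" and
      ab: "d p a < d p q / 2" "d p q / 2 \<le> d p b"
      using path[OF pX, of "d p q / 2"] by auto
    have X: "a \<in> X" "b \<in> X" using J H_mem by auto
    have da: "d p q = d p a + d a q" and db: "d p q = d p b + d b q" and dab: "d p b = d p a + d a b"
      using btw_d btw pX X by auto
    show ?thesis
    proof (cases "L / 2 - 4 * e \<le> d p a")
      case True
      then have "\<bar>d p a - L / 2\<bar> \<le> 13/2 * e" "\<bar>d a q - L / 2\<bar> \<le> 13/2 * e"
        using da ab large dpq e by linarith+
      then show ?thesis using centre[OF _ pq X(1) btw(2)] btw X pq by blast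
    next
      case a: False
      show ?thesis
      proof (cases "d p b \<le> L / 2 + 4 * e")
        case True
        then have "\<bar>d p b - L / 2\<bar> \<le> 13/2 * e" "\<bar>d b q - L / 2\<bar> \<le> 13/2 * e"
          using db ab large dpq e by linarith+
        then show ?thesis using centre[OF _ pq X(2) btw(3)] btw X pq by blast
      next
        case b: False
        \<comment> \<open>Since \<open>J\<close> separates \<open>a\<close> from \<open>b\<close>,
          betweenness forces these points to be the gates of \<open>p\<close> and
          \<open>q\<close>.\<close>
        have \<delta>ab: "d a b = \<delta> J a b" "\<delta> J a b \<noteq> 0" using d_hyperplane[OF J] a b dab e by linarith+
        then have pa: "\<delta> J p a = 0" and qb: "\<delta> J q b = 0"
          using btw_\<delta>[OF btw(1) pX(1) X(2) J(1)] btw_\<delta>[OF btw(4) X(1) pX(2) J(1)] \<delta>_sym[of J b q] J X pX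
          by auto
        have split: "d p q = d p a + \<delta> J a b + d q b"
          using db dab \<delta>ab d_sym[OF X(2) pX(2)] by linarith
        have be: "d q b < L / 2 - 3 * e" using db b dpq d_sym[OF X(2) pX(2)] by linarith
        show ?thesis
        proof (cases "\<forall>t\<in>T. t ` J = J")
          case True
          then show ?thesis using J by blast
        next
          case False
          then obtain t where t: "t \<in> T" "t ` J \<noteq> J" by blast
          have "d y z \<le> L + e" if "y \<in> {p, q}" "z \<in> {t p, t q}" for y z
            using diam[of y z] that tpq[OF t(1)] pq O12 by auto
          then obtain x where "x \<in> X" "btw p x (t p)" "\<bar>d p x - L / 2\<bar> \<le> 13/2 * e"
            "\<bar>d x (t p) - L / 2\<bar> \<le> 13/2 * e"
            using moved_hyperplane[OF sym[OF t(1)] pX large dpq e J pa qb split _ be _ t(2)] a by auto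
          then show ?thesis using centre[OF _ pq(1), of _ "t p" x] tpq[OF t(1)] pq by blast
        qed
      qed
    qed
  qed
qed

end

section \<open>Hyperplanes and the word metric\<close>

locale generated_group = group +
  fixes S
  assumes S_subset: "S \<subseteq> carrier G" and S_generates: "generate G S = carrier G"
begin

abbreviation wlen where "wlen \<equiv> word_length G S"
abbreviation wprod where "wprod ws \<equiv> foldr (\<lambda>x y. x \<otimes> y) ws \<one>"
abbreviation letters where "letters \<equiv> S \<union> (\<lambda>s. inv s) ` S"

lemma letters_subset: "letters \<subseteq> carrier G"
  using S_subset by auto

lemma wprod_closed: "set ws \<subseteq> carrier G \<Longrightarrow> wprod ws \<in> carrier G"
  by (induction ws) auto

lemma wprod_append:
  "\<lbrakk>set vs \<subseteq> carrier G; set ws \<subseteq> carrier G\<rbrakk> \<Longrightarrow> wprod (vs @ ws) = wprod vs \<otimes> wprod ws"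
  by (induction vs) (auto simp: wprod_closed m_assoc)

lemma wlen_le: "set ws \<subseteq> letters \<Longrightarrow> wlen (wprod ws) \<le> length ws"
  unfolding word_length_def by (rule Least_le) blast

lemma wlen_witness:
  assumes "x \<in> carrier G"
  obtains ws where "length ws = wlen x" "set ws \<subseteq> letters" "wprod ws = x"
proof -
  have "x \<in> generate G S" using assms S_generates by simp
  then have "\<exists>ws. set ws \<subseteq> letters \<and> wprod ws = x"
  proof (induction rule: generate.induct)
    case one
    then show ?case by (intro exI[of _ "[]"]) simp
  next
    case (incl h)
    then show ?case using S_subset by (intro exI[of _ "[h]"]) auto
  next
    case (inv h)
    then show ?case using S_subset by (intro exI[of _ "[inv h]"]) auto
  next
    case (eng g h)
    then obtain vs ws where "set vs \<subseteq> letters" "wprod vs = g" "set ws \<subseteq> letters" "wprod ws = h"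
      by blast
    moreover from this have "wprod (vs @ ws) = wprod vs \<otimes> wprod ws"
      using letters_subset by (intro wprod_append) auto
    ultimately show ?case by (intro exI[of _ "vs @ ws"]) (auto simp del: foldr_append)
  qed
  then have "\<exists>n ws. length ws = n \<and> set ws \<subseteq> letters \<and> wprod ws = x" by blast
  from LeastI_ex[OF this] show thesis using that unfolding word_length_def by blast
qed

lemma wlen_mult:
  assumes "x \<in> carrier G" "y \<in> carrier G"
  shows "wlen (x \<otimes> y) \<le> wlen x + wlen y"
proof -
  obtain vs where v: "length vs = wlen x" "set vs \<subseteq> letters" "wprod vs = x"
    using assms(1) by (rule wlen_witness)
  obtain ws where w: "length ws = wlen y" "set ws \<subseteq> letters" "wprod ws = y"
    using assms(2) by (rule wlen_witness)
  have "wprod (vs @ ws) = x \<otimes> y"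
    using wprod_append[of vs ws] v w letters_subset by blast
  then show ?thesis using wlen_le[of "vs @ ws"] v w by simp
qed

lemma wlen_one: "wlen \<one> = 0"
  using wlen_le[of "[]"] by simp

lemma wlen_zero: "x \<in> carrier G \<Longrightarrow> wlen x = 0 \<Longrightarrow> x = \<one>"
  by (erule wlen_witness) auto

lemma wlen_letter: "s \<in> letters \<Longrightarrow> wlen s \<le> 1"
  using wlen_le[of "[s]"] letters_subset by auto

lemma wlen_inv_le: "x \<in> carrier G \<Longrightarrow> wlen (inv x) \<le> wlen x"
proof -
  assume "x \<in> carrier G"
  then obtain ws where w: "length ws = wlen x" "set ws \<subseteq> letters" "wprod ws = x"
    by (rule wlen_witness)
  have sub: "set vs \<subseteq> letters \<Longrightarrow> set (rev (map (\<lambda>s. inv s) vs)) \<subseteq> letters" for vs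
  proof -
    have "inv s \<in> letters" if "s \<in> letters" for s
      using that S_subset by (auto simp: subset_iff)
    then show "set vs \<subseteq> letters \<Longrightarrow> set (rev (map (\<lambda>s. inv s) vs)) \<subseteq> letters"
      by (induction vs) simp_all
  qed
  have "set vs \<subseteq> letters \<Longrightarrow> wprod (rev (map (\<lambda>s. inv s) vs)) = inv (wprod vs)" for vs
  proof (induction vs)
    case (Cons a vs)
    have a: "a \<in> carrier G" "set vs \<subseteq> carrier G" using Cons.prems letters_subset by auto
    have "wprod (rev (map (\<lambda>s. inv s) vs) @ [inv a]) = wprod (rev (map (\<lambda>s. inv s) vs)) \<otimes> wprod [inv a]"
      using a by (intro wprod_append) auto
    then show ?case using Cons a by (simp add: inv_mult_group wprod_closed)
  qed simp
  from this[OF w(2)] show ?thesis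
    using wlen_le[OF sub[OF w(2)]] w by simp
qed

lemma wlen_inv: "x \<in> carrier G \<Longrightarrow> wlen (inv x) = wlen x"
  using wlen_inv_le[of x] wlen_inv_le[of "inv x"] by simp

abbreviation wdist where "wdist \<equiv> word_dist G S"

lemma wdist_nonneg: "0 \<le> wdist x y"
  by (simp add: word_dist_def)

lemma wdist_refl: "x \<in> carrier G \<Longrightarrow> wdist x x = 0"
  by (simp add: word_dist_def wlen_one)

lemma wdist_sym: "x \<in> carrier G \<Longrightarrow> y \<in> carrier G \<Longrightarrow> wdist x y = wdist y x"
  using wlen_inv[of "inv x \<otimes> y"] by (simp add: word_dist_def inv_mult_group)

lemma wdist_triangle:
  assumes "x \<in> carrier G" "y \<in> carrier G" "z \<in> carrier G"
  shows "wdist x z \<le> wdist x y + wdist y z"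
proof -
  have "(inv x \<otimes> y) \<otimes> (inv y \<otimes> z) = inv x \<otimes> (y \<otimes> (inv y \<otimes> z))"
    using assms by (simp add: m_assoc)
  also have "\<dots> = inv x \<otimes> z" using assms by (simp flip: m_assoc)
  finally show ?thesis
    using wlen_mult[of "inv x \<otimes> y" "inv y \<otimes> z"] assms by (simp add: word_dist_def)
qed

lemma wdist_zero:
  assumes "x \<in> carrier G" "y \<in> carrier G" "wdist x y = 0"
  shows "x = y"
proof -
  have "inv x \<otimes> y = \<one>" using wlen_zero[of "inv x \<otimes> y"] assms by (simp add: word_dist_def)
  then show ?thesis using assms by (metis inv_comm inv_equality inv_closed inv_inv)
qed

lemma inv_mult_cancel: "\<lbrakk>x \<in> carrier G; y \<in> carrier G\<rbrakk> \<Longrightarrow> inv x \<otimes> (x \<otimes> y) = y"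
  by (simp flip: m_assoc)

lemma cancel_left:
  "\<lbrakk>t \<in> carrier G; x \<in> carrier G; y \<in> carrier G\<rbrakk> \<Longrightarrow> inv (t \<otimes> x) \<otimes> (t \<otimes> y) = inv x \<otimes> y"
proof -
  assume *: "t \<in> carrier G" "x \<in> carrier G" "y \<in> carrier G"
  then have "inv (t \<otimes> x) \<otimes> (t \<otimes> y) = inv x \<otimes> (inv t \<otimes> (t \<otimes> y))"
    by (simp add: inv_mult_group m_assoc)
  then show ?thesis using * by (simp flip: m_assoc)
qed

lemma wdist_left_invariant:
  "\<lbrakk>t \<in> carrier G; x \<in> carrier G; y \<in> carrier G\<rbrakk> \<Longrightarrow> wdist (t \<otimes> x) (t \<otimes> y) = wdist x y"
  by (simp add: word_dist_def cancel_left)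

end

section \<open>Hyperplanes of a graph product\<close>

locale marked_graph_of_groups = graph_of_groups \<Gamma> \<G>
  for \<Gamma> :: "('v, 'e) pre_digraph" and \<G> :: "'v \<Rightarrow> 'a monoid" +
  fixes S :: "'v \<Rightarrow> 'a set"
  assumes generating: "\<And>u. u \<in> verts \<Gamma> \<Longrightarrow> S u \<subseteq> carrier (\<G> u) \<and> generate (\<G> u) (S u) = carrier (\<G> u)"
begin

lemma vertex_generated: "u \<in> verts \<Gamma> \<Longrightarrow> generated_group (\<G> u) (S u)"
  using generating vertex_group by (simp add: generated_group_def generated_group_axioms_def)

abbreviation gens where
  "gens \<equiv> (\<Union>u\<in>verts \<Gamma>. gp_emb \<Gamma> \<G> u ` S u)"

lemma gens_subset: "gens \<subseteq> carrier P"
  using generating by (auto simp: gp_emb_eq subset_iff)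

lemma generate_gens: "generate P gens = carrier P"
proof
  interpret P: group P by (rule group_P)
  show "generate P gens \<subseteq> carrier P" by (rule P.generate_incl[OF gens_subset])
  have syl: "gp [(u, g)] \<in> generate P gens" if u: "u \<in> verts \<Gamma>" and g: "g \<in> carrier (\<G> u)" for u g
  proof -
    have "g \<in> generate (\<G> u) (S u)" using generating u g by simp
    then show ?thesis
    proof (induction rule: generate.induct)
      case one
      then show ?case using u by (simp add: gp_unit generate.one)
    next
      case (incl h)
      then show ?case using u by (intro generate.incl) (auto simp: gp_emb_eq)
    next
      case (inv h)
      have "inv\<^bsub>P\<^esub> (gp [(u, h)]) \<in> generate P gens"
        using u inv by (intro generate.inv) (auto simp: gp_emb_eq)
      moreover have "h \<in> carrier (\<G> u)" using inv u generating by blast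
      ultimately show ?case using gp_inv[OF u] by simp
    next
      case (eng g h)
      then have "g \<in> carrier (\<G> u)" "h \<in> carrier (\<G> u)" using generating u by auto
      then show ?case using eng u by (simp add: generate.eng flip: gp_mult)
    qed
  qed
  have "w \<in> words \<Longrightarrow> gp w \<in> generate P gens" for w
  proof (induction w)
    case Nil
    then show ?case by (simp add: generate.one)
  next
    case (Cons s w)
    have "gp [s] \<in> generate P gens" using Cons.prems syl by (cases s) simp
    then show ?case using Cons unfolding gp_Cons[OF Cons.prems] by (intro generate.eng) auto
  qed
  then show "carrier P \<subseteq> generate P gens" by (auto simp: carrier_P)
qed

sublocale P: generated_group P gens
  using group_P gens_subset generate_gens
  by (simp add: generated_group_def generated_group_axioms_def)

lemma gp_dist_eq: "gp_dist \<Gamma> \<G> S = P.wdist"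
  by (simp add: gp_dist_def)

definition Hyper :: "'v \<Rightarrow> ('v \<times> 'a) list set set set set" where
  "Hyper v = {g <#\<^bsub>P\<^esub> star_group v |g. g \<in> carrier P}"

text \<open>The choice of \<open>g\<close> in the coset is immaterial: another one multiplies both
  sector names by the same element of \<open>\<G> v\<close>, and the word metric is left
  invariant.\<close>

definition delta :: "'v \<Rightarrow> ('v \<times> 'a) list set set set \<Rightarrow> ('v \<times> 'a) list set set \<Rightarrow> ('v \<times> 'a) list set set \<Rightarrow> real"
  where "delta v J x y = (let g = SOME g. g \<in> J in
     word_dist (\<G> v) (S v) (Front v (inv\<^bsub>P\<^esub> g \<otimes>\<^bsub>P\<^esub> x)) (Front v (inv\<^bsub>P\<^esub> g \<otimes>\<^bsub>P\<^esub> y)))"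

text \<open>No colour occurs here, so one and the same relation serves the tree-graded structures of
  all colours.\<close>

definition geodesic_between :: "('v \<times> 'a) list set set \<Rightarrow> ('v \<times> 'a) list set set \<Rightarrow> ('v \<times> 'a) list set set \<Rightarrow> bool"
  where "geodesic_between x y z \<longleftrightarrow>
    (\<exists>w1 w2. reduced (w1 @ w2) \<and> y = x \<otimes>\<^bsub>P\<^esub> gp w1 \<and> z = y \<otimes>\<^bsub>P\<^esub> gp w2)"

abbreviation hdist where
  "hdist v \<equiv> hyperplane_dist (Hyper v) (delta v)"

lemma mem_coset_iff:
  assumes "g \<in> carrier P"
  shows "x \<in> g <#\<^bsub>P\<^esub> star_group v \<longleftrightarrow> x \<in> carrier P \<and> inv\<^bsub>P\<^esub> g \<otimes>\<^bsub>P\<^esub> x \<in> star_group v"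
proof
  assume "x \<in> g <#\<^bsub>P\<^esub> star_group v"
  then obtain b where b: "b \<in> star_group v" "x = g \<otimes>\<^bsub>P\<^esub> b" by (auto simp: l_coset_def)
  then have "b \<in> carrier P" using subgroup.mem_carrier[OF subgroup_star_group] by blast
  then show "x \<in> carrier P \<and> inv\<^bsub>P\<^esub> g \<otimes>\<^bsub>P\<^esub> x \<in> star_group v"
    using b assms by (simp flip: P.m_assoc)
next
  assume *: "x \<in> carrier P \<and> inv\<^bsub>P\<^esub> g \<otimes>\<^bsub>P\<^esub> x \<in> star_group v"
  then have "x = g \<otimes>\<^bsub>P\<^esub> (inv\<^bsub>P\<^esub> g \<otimes>\<^bsub>P\<^esub> x)" using assms by (simp flip: P.m_assoc)
  then show "x \<in> g <#\<^bsub>P\<^esub> star_group v" using * by (auto simp: l_coset_def)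
qed

lemma Hyper_coset:
  assumes "J \<in> Hyper v" "g \<in> J"
  shows "g \<in> carrier P" and "J = g <#\<^bsub>P\<^esub> star_group v"
proof -
  obtain g0 where g0: "g0 \<in> carrier P" "J = g0 <#\<^bsub>P\<^esub> star_group v" using assms by (auto simp: Hyper_def)
  then show "g \<in> carrier P" using assms mem_coset_iff by blast
  show "J = g <#\<^bsub>P\<^esub> star_group v"
    using P.l_repr_independence[OF _ g0(1) subgroup_star_group] assms g0 by blast
qed

lemma Hyper_mem_iff:
  "\<lbrakk>J \<in> Hyper v; g \<in> J\<rbrakk> \<Longrightarrow> x \<in> J \<longleftrightarrow> x \<in> carrier P \<and> inv\<^bsub>P\<^esub> g \<otimes>\<^bsub>P\<^esub> x \<in> star_group v"
  using Hyper_coset mem_coset_iff by metis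

lemma coset_Hyper: "g \<in> carrier P \<Longrightarrow> g <#\<^bsub>P\<^esub> star_group v \<in> Hyper v \<and> g \<in> g <#\<^bsub>P\<^esub> star_group v"
  using subgroup.one_closed[OF subgroup_star_group] by (auto simp: Hyper_def mem_coset_iff)

lemma Hyper_nonempty: "J \<in> Hyper v \<Longrightarrow> \<exists>g. g \<in> J"
  using coset_Hyper by (auto simp: Hyper_def)

lemma Hyper_eqI: "\<lbrakk>J \<in> Hyper v; K \<in> Hyper v; x \<in> J; x \<in> K\<rbrakk> \<Longrightarrow> J = K"
  using Hyper_coset by metis

lemma delta_eq:
  assumes v: "v \<in> verts \<Gamma>" and J: "J \<in> Hyper v" "g \<in> J" and x: "x \<in> carrier P" and y: "y \<in> carrier P"
  shows "delta v J x y =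
    word_dist (\<G> v) (S v) (Front v (inv\<^bsub>P\<^esub> g \<otimes>\<^bsub>P\<^esub> x)) (Front v (inv\<^bsub>P\<^esub> g \<otimes>\<^bsub>P\<^esub> y))"
proof -
  interpret Gv: generated_group "\<G> v" "S v" using v by (rule vertex_generated)
  define k where "k = (SOME g. g \<in> J)"
  have k: "k \<in> J" unfolding k_def using J(2) by (rule someI)
  have c: "g \<in> carrier P" "k \<in> carrier P" using Hyper_coset J k by auto
  have "inv\<^bsub>P\<^esub> k \<otimes>\<^bsub>P\<^esub> g \<in> star_group v" using Hyper_mem_iff[OF J(1) k] J(2) by blast
  then obtain a where a: "a \<in> carrier (\<G> v)"
    "\<And>z. z \<in> carrier P \<Longrightarrow> Front v (inv\<^bsub>P\<^esub> k \<otimes>\<^bsub>P\<^esub> g \<otimes>\<^bsub>P\<^esub> z) = a \<otimes>\<^bsub>\<G> v\<^esub> Front v z"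
    using Front_mult_star_group[OF v] by blast
  have e: "Front v (inv\<^bsub>P\<^esub> k \<otimes>\<^bsub>P\<^esub> z) = a \<otimes>\<^bsub>\<G> v\<^esub> Front v (inv\<^bsub>P\<^esub> g \<otimes>\<^bsub>P\<^esub> z)" if "z \<in> carrier P" for z
  proof -
    have "inv\<^bsub>P\<^esub> k \<otimes>\<^bsub>P\<^esub> g \<otimes>\<^bsub>P\<^esub> (inv\<^bsub>P\<^esub> g \<otimes>\<^bsub>P\<^esub> z) = inv\<^bsub>P\<^esub> k \<otimes>\<^bsub>P\<^esub> (g \<otimes>\<^bsub>P\<^esub> (inv\<^bsub>P\<^esub> g \<otimes>\<^bsub>P\<^esub> z))"
      using c that by (simp add: P.m_assoc)
    also have "\<dots> = inv\<^bsub>P\<^esub> k \<otimes>\<^bsub>P\<^esub> z" using c that by (simp flip: P.m_assoc)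
    finally show ?thesis using a(2)[of "inv\<^bsub>P\<^esub> g \<otimes>\<^bsub>P\<^esub> z"] c that by simp
  qed
  show ?thesis
    unfolding delta_def Let_def k_def[symmetric] using e[OF x] e[OF y] a(1) v x y c
    by (simp add: Gv.wdist_left_invariant Front_closed)
qed

lemma delta_cross:
  assumes v: "v \<in> verts \<Gamma>" and J: "J \<in> Hyper v" and x: "x \<in> carrier P" and w: "w \<in> words"
    and ne: "delta v J x (x \<otimes>\<^bsub>P\<^esub> gp w) \<noteq> 0"
  shows "\<exists>w1 h w2. w = w1 @ (v, h) # w2 \<and> x \<otimes>\<^bsub>P\<^esub> gp w1 \<in> J"
proof -
  interpret Gv: generated_group "\<G> v" "S v" using v by (rule vertex_generated)
  obtain g where g: "g \<in> J" using Hyper_nonempty[OF J] by blast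
  have gP: "g \<in> carrier P" using Hyper_coset(1)[OF J g] .
  have "Front v (inv\<^bsub>P\<^esub> g \<otimes>\<^bsub>P\<^esub> x \<otimes>\<^bsub>P\<^esub> gp w) \<noteq> Front v (inv\<^bsub>P\<^esub> g \<otimes>\<^bsub>P\<^esub> x)"
    using ne delta_eq[OF v J g x, of "x \<otimes>\<^bsub>P\<^esub> gp w"] Gv.wdist_refl Front_closed v x w gP
    by (auto simp: P.m_assoc)
  then obtain w1 h w2 where *: "w = w1 @ (v, h) # w2" "inv\<^bsub>P\<^esub> g \<otimes>\<^bsub>P\<^esub> x \<otimes>\<^bsub>P\<^esub> gp w1 \<in> star_group v"
    using Front_right_cross[of "inv\<^bsub>P\<^esub> g \<otimes>\<^bsub>P\<^esub> x" w v] w x gP by blast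
  then have "x \<otimes>\<^bsub>P\<^esub> gp w1 \<in> J" using Hyper_mem_iff[OF J g] x w gP by (simp add: P.m_assoc)
  then show ?thesis using * by blast
qed

lemma delta_syllable:
  assumes v: "v \<in> verts \<Gamma>" and J: "J \<in> Hyper v" and x: "x \<in> carrier P"
    and u: "u \<in> verts \<Gamma>" "h \<in> carrier (\<G> u)"
  shows "delta v J x (x \<otimes>\<^bsub>P\<^esub> gp [(u, h)]) = (if u = v \<and> x \<in> J then real (word_length (\<G> v) (S v) h) else 0)"
proof (cases "u = v \<and> x \<in> J")
  case True
  interpret Gv: generated_group "\<G> v" "S v" using v by (rule vertex_generated)
  have "Front v (gp [(v, h)]) = h"
    using Front_mult_same[of v h "\<one>\<^bsub>P\<^esub>"] v u True by (simp add: Front_one)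
  moreover have "inv\<^bsub>P\<^esub> x \<otimes>\<^bsub>P\<^esub> (x \<otimes>\<^bsub>P\<^esub> gp [(v, h)]) = gp [(v, h)]"
    using x u True by (simp flip: P.m_assoc)
  ultimately show ?thesis
    using True delta_eq[OF v J _ x, of x "x \<otimes>\<^bsub>P\<^esub> gp [(v, h)]"] x u by (simp add: Front_one word_dist_def)
next
  case False
  have "delta v J x (x \<otimes>\<^bsub>P\<^esub> gp [(u, h)]) = 0"
  proof (rule ccontr)
    assume "delta v J x (x \<otimes>\<^bsub>P\<^esub> gp [(u, h)]) \<noteq> 0"
    from delta_cross[OF v J x _ this] u obtain w1 k w2
      where "[(u, h)] = w1 @ (v, k) # w2" "x \<otimes>\<^bsub>P\<^esub> gp w1 \<in> J" by auto
    then show False using False x by (cases w1) auto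
  qed
  then show ?thesis using False by (simp only: if_False)
qed

text \<open>Two crossings of \<open>J\<close> happen at two \<open>v\<close>-syllables, both
  starting in the coset \<open>J\<close>. The word between them then lies over the star of
  \<open>v\<close>, which a reduced word does not allow.\<close>

lemma delta_reduced:
  assumes v: "v \<in> verts \<Gamma>" and J: "J \<in> Hyper v" and x: "x \<in> carrier P" and r: "reduced (w1 @ w2)"
  shows "delta v J x (x \<otimes>\<^bsub>P\<^esub> gp w1) = 0 \<or> delta v J (x \<otimes>\<^bsub>P\<^esub> gp w1) (x \<otimes>\<^bsub>P\<^esub> gp w1 \<otimes>\<^bsub>P\<^esub> gp w2) = 0"
proof (rule ccontr)
  assume ne: "\<not> ?thesis"
  have w: "w1 \<in> words" "w2 \<in> words" using r reduced_words by fastforce+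
  obtain a s a' where a: "w1 = a @ (v, s) # a'" "x \<otimes>\<^bsub>P\<^esub> gp a \<in> J"
    using delta_cross[OF v J x w(1)] ne by blast
  have xw: "x \<otimes>\<^bsub>P\<^esub> gp w1 \<in> carrier P" using x w by simp
  obtain c t c' where c: "w2 = c @ (v, t) # c'" "x \<otimes>\<^bsub>P\<^esub> gp w1 \<otimes>\<^bsub>P\<^esub> gp c \<in> J"
    using delta_cross[OF v J xw w(2)] ne by blast
  let ?l = "a' @ c"
  have l: "(v, s) # ?l \<in> words" "a \<in> words" "c \<in> words" using w a c by auto
  have "reduced (a @ ((v, s) # ?l @ [(v, t)]) @ c')" using r a c by simp
  then have red: "reduced ((v, s) # ?l @ [(v, t)])" using reduced_appendD by blast
  then have redl: "reduced ((v, s) # ?l)" using reduced_appendD[of "(v, s) # ?l" "[(v, t)]"] by simp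
  have "gp w1 \<otimes>\<^bsub>P\<^esub> gp c = gp (w1 @ c)" using w l by (simp add: gp_append)
  also have "w1 @ c = a @ ((v, s) # ?l)" using a by simp
  also have "gp \<dots> = gp a \<otimes>\<^bsub>P\<^esub> gp ((v, s) # ?l)" using l by (intro gp_append)
  finally have "x \<otimes>\<^bsub>P\<^esub> gp w1 \<otimes>\<^bsub>P\<^esub> gp c = x \<otimes>\<^bsub>P\<^esub> gp a \<otimes>\<^bsub>P\<^esub> gp ((v, s) # ?l)"
    using x w l by (simp add: P.m_assoc)
  moreover have "inv\<^bsub>P\<^esub> (x \<otimes>\<^bsub>P\<^esub> gp a) \<otimes>\<^bsub>P\<^esub> (x \<otimes>\<^bsub>P\<^esub> gp w1 \<otimes>\<^bsub>P\<^esub> gp c) \<in> star_group v"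
    using Hyper_mem_iff[OF J a(2)] c(2) by blast
  moreover have "inv\<^bsub>P\<^esub> (x \<otimes>\<^bsub>P\<^esub> gp a) \<otimes>\<^bsub>P\<^esub> (x \<otimes>\<^bsub>P\<^esub> gp a \<otimes>\<^bsub>P\<^esub> gp ((v, s) # ?l)) = gp ((v, s) # ?l)"
    using x l gp_closed[OF l(1)] by (intro P.inv_mult_cancel) simp_all
  ultimately have "gp ((v, s) # ?l) \<in> star_group v" by simp
  from reduced_star_group[OF redl this] have "fst ` set ?l \<subseteq> star \<Gamma> v" by auto
  from not_reduced_star[OF this] red show False by blast
qed

lemma difference_word:
  assumes "x \<in> carrier P" "y \<in> carrier P"
  obtains w where "reduced w" "w \<in> words" "y = x \<otimes>\<^bsub>P\<^esub> gp w"
proof -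
  obtain w where w: "reduced w" "inv\<^bsub>P\<^esub> x \<otimes>\<^bsub>P\<^esub> y = gp w"
    using reduced_rep[of "inv\<^bsub>P\<^esub> x \<otimes>\<^bsub>P\<^esub> y"] assms by auto
  have "x \<otimes>\<^bsub>P\<^esub> (inv\<^bsub>P\<^esub> x \<otimes>\<^bsub>P\<^esub> y) = y" using assms by (simp flip: P.m_assoc)
  then show thesis using that w reduced_words by metis
qed

lemma coset_mult_star_syllable:
  assumes "J \<in> Hyper v" "a \<in> J" "v \<in> verts \<Gamma>" "h \<in> carrier (\<G> v)"
  shows "a \<otimes>\<^bsub>P\<^esub> gp [(v, h)] \<in> J"
proof -
  have "gp [(v, h)] \<in> star_group v" using assms by (intro star_group_word) (auto simp: star_def)
  moreover have a: "a \<in> carrier P" using Hyper_coset assms by blast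
  then have "inv\<^bsub>P\<^esub> a \<otimes>\<^bsub>P\<^esub> (a \<otimes>\<^bsub>P\<^esub> gp [(v, h)]) = gp [(v, h)]" using assms by (simp flip: P.m_assoc)
  ultimately show ?thesis using Hyper_mem_iff[OF assms(1,2)] a assms by simp
qed

text \<open>A gate is found by moving a point of \<open>J\<close> within its clique to the right
  sector; \<open>separation\<close> and \<open>thin\<close> are translates of facts about the
  hyperplane through 1; \<open>cross\<close> and \<open>path\<close> follow a reduced word.\<close>

theorem tree_graded_hyperplanes:
  assumes v: "v \<in> verts \<Gamma>"
  shows "tree_graded (carrier P) (Hyper v) (delta v) geodesic_between"
proof -
  interpret Gv: generated_group "\<G> v" "S v" using v by (rule vertex_generated)
  note closed = Front_closed[OF v]
  have delta_zero: "delta v J x z = delta v J y z"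
    if "delta v J x y = 0" "J \<in> Hyper v" "x \<in> carrier P" "y \<in> carrier P" "z \<in> carrier P" for J x y z
  proof -
    obtain g where g: "g \<in> J" using Hyper_nonempty \<open>J \<in> Hyper v\<close> by blast
    have "g \<in> carrier P" using Hyper_coset g \<open>J \<in> Hyper v\<close> by blast
    then have "Front v (inv\<^bsub>P\<^esub> g \<otimes>\<^bsub>P\<^esub> x) = Front v (inv\<^bsub>P\<^esub> g \<otimes>\<^bsub>P\<^esub> y)"
      using that delta_eq[OF v _ g, of x y] by (intro Gv.wdist_zero closed) auto
    then show ?thesis using that delta_eq[OF v _ g, of x z] delta_eq[OF v _ g, of y z] by simp
  qed
  show ?thesis
  proof
    fix J assume J: "J \<in> Hyper v"
    obtain g where g: "g \<in> J" using Hyper_nonempty J by blast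
    have gP: "g \<in> carrier P" using Hyper_coset J g by blast
    note eq = delta_eq[OF v J g]
    show "J \<subseteq> carrier P" using Hyper_coset J by blast
    fix x assume x: "x \<in> carrier P"
    show "delta v J x x = 0" using x gP by (simp add: eq Gv.wdist_refl closed)
    show "\<exists>b\<in>J. delta v J x b = 0"
    proof
      let ?f = "Front v (inv\<^bsub>P\<^esub> g \<otimes>\<^bsub>P\<^esub> x)"
      have f: "?f \<in> carrier (\<G> v)" using x gP by (intro closed) auto
      show b: "g \<otimes>\<^bsub>P\<^esub> gp [(v, ?f)] \<in> J" using coset_mult_star_syllable[OF J g v f] .
      have "inv\<^bsub>P\<^esub> g \<otimes>\<^bsub>P\<^esub> (g \<otimes>\<^bsub>P\<^esub> gp [(v, ?f)]) = gp [(v, ?f)]" using f gP v by (simp flip: P.m_assoc)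
      moreover have "Front v (gp [(v, ?f)]) = ?f"
        using Front_mult_same[OF v f, of "\<one>\<^bsub>P\<^esub>"] v f by (simp add: Front_one)
      ultimately show "delta v J x (g \<otimes>\<^bsub>P\<^esub> gp [(v, ?f)]) = 0"
        using eq[OF x, of "g \<otimes>\<^bsub>P\<^esub> gp [(v, ?f)]"] f v gP by (simp add: Gv.wdist_refl)
    qed
    fix y assume y: "y \<in> carrier P"
    show "0 \<le> delta v J x y" using x y by (simp add: eq Gv.wdist_nonneg)
    show "delta v J x y = delta v J y x" using x y gP by (simp add: eq Gv.wdist_sym[OF closed closed])
    show "\<exists>b\<in>J. geodesic_between x b y \<and> delta v J b y = 0" if ne: "delta v J x y \<noteq> 0"
    proof -
      obtain w where w: "reduced w" "w \<in> words" "y = x \<otimes>\<^bsub>P\<^esub> gp w" using difference_word x y by blast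
      obtain w1 h w2 where w1: "w = w1 @ (v, h) # w2" "x \<otimes>\<^bsub>P\<^esub> gp w1 \<in> J"
        using delta_cross[OF v J x w(2)] ne w by blast
      let ?a = "x \<otimes>\<^bsub>P\<^esub> gp w1"
      have c: "w1 \<in> words" "w2 \<in> words" "h \<in> carrier (\<G> v)" using w w1 by auto
      have r: "reduced ([(v, h)] @ w2)" using reduced_appendD[of w1 "(v, h) # w2"] w w1 by simp
      then have h: "h \<noteq> \<one>\<^bsub>\<G> v\<^esub>" by simp
      have a: "?a \<in> carrier P" using x c by simp
      \<comment> \<open>The point after the crossing syllable, not before it: from here on a reduced
        word does not cross \<open>J\<close> again.\<close>
      let ?b = "?a \<otimes>\<^bsub>P\<^esub> gp [(v, h)]"
      have "delta v J ?a ?b \<noteq> 0"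
        using delta_syllable[OF v J a v c(3)] w1(2) h c(3) Gv.wlen_zero by auto
      then have z: "delta v J ?b (?b \<otimes>\<^bsub>P\<^esub> gp w2) = 0" using delta_reduced[OF v J a r] by blast
      have b': "?b = x \<otimes>\<^bsub>P\<^esub> gp (w1 @ [(v, h)])" using x c v by (simp add: gp_append P.m_assoc)
      have "gp w = gp (w1 @ [(v, h)]) \<otimes>\<^bsub>P\<^esub> gp w2"
        using gp_append[of "w1 @ [(v, h)]" w2] w1 c v by simp
      then have y': "y = ?b \<otimes>\<^bsub>P\<^esub> gp w2" using w b' c x v by (simp add: P.m_assoc)
      have "geodesic_between x ?b y"
        unfolding geodesic_between_def using b' y' w w1 by (intro exI[of _ "w1 @ [(v, h)]"] exI[of _ w2]) simp
      then show ?thesis using z y' coset_mult_star_syllable[OF J w1(2) v c(3)] by auto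
    qed
    show "delta v J x z \<le> delta v J x y + delta v J y z" if "z \<in> carrier P" for z
      using x y that gP by (simp add: eq Gv.wdist_triangle[OF closed closed closed])
  next
    fix x y assume xy: "x \<in> carrier P" "y \<in> carrier P"
    obtain w where w: "reduced w" "w \<in> words" "y = x \<otimes>\<^bsub>P\<^esub> gp w" using difference_word xy by blast
    \<comment> \<open>Every hyperplane that separates \<open>x\<close> from \<open>y\<close> passes
      through the end of a prefix of one fixed word.\<close>
    have "{J \<in> Hyper v. delta v J x y \<noteq> 0} \<subseteq> (\<lambda>i. (x \<otimes>\<^bsub>P\<^esub> gp (take i w)) <#\<^bsub>P\<^esub> star_group v) ` {..length w}"
    proof
      fix J assume "J \<in> {J \<in> Hyper v. delta v J x y \<noteq> 0}"
      then have J: "J \<in> Hyper v" "delta v J x y \<noteq> 0" by auto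
      then obtain w1 h w2 where w1: "w = w1 @ (v, h) # w2" "x \<otimes>\<^bsub>P\<^esub> gp w1 \<in> J"
        using delta_cross[OF v J(1) xy(1) w(2)] w by blast
      then have e: "J = (x \<otimes>\<^bsub>P\<^esub> gp (take (length w1) w)) <#\<^bsub>P\<^esub> star_group v"
        using Hyper_coset(2)[OF J(1) w1(2)] by simp
      show "J \<in> (\<lambda>i. (x \<otimes>\<^bsub>P\<^esub> gp (take i w)) <#\<^bsub>P\<^esub> star_group v) ` {..length w}"
        by (rule image_eqI[where x = "length w1"], rule e) (simp add: w1)
    qed
    then show "finite {J \<in> Hyper v. delta v J x y \<noteq> 0}" by (rule finite_subset) simp
    show "geodesic_between x x y"
      unfolding geodesic_between_def using w xy by (intro exI[of _ "[]"] exI[of _ w]) auto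
  next
    fix J K j k z
    assume J: "J \<in> Hyper v" "K \<in> Hyper v" "J \<noteq> K" "j \<in> J" "k \<in> K" "z \<in> carrier P"
    have c: "j \<in> carrier P" "k \<in> carrier P" using Hyper_coset J by blast+
    have "k \<notin> J" using Hyper_eqI J by blast
    \<comment> \<open>Translating by the inverse of \<open>j\<close> makes \<open>J\<close> the
      hyperplane through 1.\<close>
    then have m: "inv\<^bsub>P\<^esub> j \<otimes>\<^bsub>P\<^esub> k \<notin> star_group v" using Hyper_mem_iff[OF J(1,4)] c by blast
    have i: "inv\<^bsub>P\<^esub> (inv\<^bsub>P\<^esub> j \<otimes>\<^bsub>P\<^esub> k) = inv\<^bsub>P\<^esub> k \<otimes>\<^bsub>P\<^esub> j" using c by (simp add: P.inv_mult_group)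
    have "inv\<^bsub>P\<^esub> k \<otimes>\<^bsub>P\<^esub> j \<otimes>\<^bsub>P\<^esub> (inv\<^bsub>P\<^esub> j \<otimes>\<^bsub>P\<^esub> z) = inv\<^bsub>P\<^esub> k \<otimes>\<^bsub>P\<^esub> (j \<otimes>\<^bsub>P\<^esub> (inv\<^bsub>P\<^esub> j \<otimes>\<^bsub>P\<^esub> z))"
      using c J by (simp add: P.m_assoc)
    also have "\<dots> = inv\<^bsub>P\<^esub> k \<otimes>\<^bsub>P\<^esub> z" using c J by (simp flip: P.m_assoc)
    finally have "Front v (inv\<^bsub>P\<^esub> j \<otimes>\<^bsub>P\<^esub> z) = Front v (inv\<^bsub>P\<^esub> j \<otimes>\<^bsub>P\<^esub> k) \<or>
        Front v (inv\<^bsub>P\<^esub> k \<otimes>\<^bsub>P\<^esub> z) = Front v (inv\<^bsub>P\<^esub> k \<otimes>\<^bsub>P\<^esub> j)"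
      using Front_separation[OF _ m, of "inv\<^bsub>P\<^esub> j \<otimes>\<^bsub>P\<^esub> z"] c J i by auto
    then show "delta v J z k = 0 \<or> delta v K z j = 0"
      using delta_eq[OF v J(1,4) J(6) c(2)] delta_eq[OF v J(2,5) J(6) c(1)] c
      by (auto simp: Gv.wdist_refl closed)
  next
    fix J K x y
    assume J: "J \<in> Hyper v" "K \<in> Hyper v" "J \<noteq> K" "x \<in> J" "y \<in> J"
    obtain k where k: "k \<in> K" using Hyper_nonempty J by blast
    have c: "x \<in> carrier P" "y \<in> carrier P" "k \<in> carrier P" using Hyper_coset J k by blast+
    have "x \<notin> K" using Hyper_eqI J by blast
    then have m: "inv\<^bsub>P\<^esub> k \<otimes>\<^bsub>P\<^esub> x \<notin> star_group v" using Hyper_mem_iff[OF J(2) k] c by blast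
    have b: "inv\<^bsub>P\<^esub> x \<otimes>\<^bsub>P\<^esub> y \<in> star_group v" using Hyper_mem_iff[OF J(1,4)] J by blast
    have "inv\<^bsub>P\<^esub> k \<otimes>\<^bsub>P\<^esub> x \<otimes>\<^bsub>P\<^esub> (inv\<^bsub>P\<^esub> x \<otimes>\<^bsub>P\<^esub> y) = inv\<^bsub>P\<^esub> k \<otimes>\<^bsub>P\<^esub> (x \<otimes>\<^bsub>P\<^esub> (inv\<^bsub>P\<^esub> x \<otimes>\<^bsub>P\<^esub> y))"
      using c by (simp add: P.m_assoc)
    also have "\<dots> = inv\<^bsub>P\<^esub> k \<otimes>\<^bsub>P\<^esub> y" using c by (simp flip: P.m_assoc)
    finally have "Front v (inv\<^bsub>P\<^esub> k \<otimes>\<^bsub>P\<^esub> y) = Front v (inv\<^bsub>P\<^esub> k \<otimes>\<^bsub>P\<^esub> x)"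
      using Front_right_star_group[OF _ m b] c by auto
    then show "delta v K x y = 0"
      using delta_eq[OF v J(2) k c(1,2)] c by (simp add: Gv.wdist_refl closed)
  next
    fix x y z assume b: "geodesic_between x y z" and x: "x \<in> carrier P" "z \<in> carrier P"
    obtain w1 w2 where w: "reduced (w1 @ w2)" "y = x \<otimes>\<^bsub>P\<^esub> gp w1" "z = y \<otimes>\<^bsub>P\<^esub> gp w2"
      using b unfolding geodesic_between_def by blast
    then show "y \<in> carrier P" using reduced_words[OF w(1)] x by simp
    show "delta v J x y = 0 \<or> delta v J y z = 0" if "J \<in> Hyper v" for J
      using delta_reduced[OF v that x(1) w(1)] w by simp
  next
    fix p q r assume p: "p \<in> carrier P" and q: "q \<in> carrier P" and r: "0 < r" "r \<le> hdist v p q"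
    obtain w where w: "reduced w" "w \<in> words" "q = p \<otimes>\<^bsub>P\<^esub> gp w" using difference_word p q by blast
    define f where "f i = hdist v p (p \<otimes>\<^bsub>P\<^esub> gp (take i w))" for i
    have ex: "r \<le> f (length w)" using r w by (simp add: f_def)
    \<comment> \<open>The first prefix whose end is at distance at least \<open>r\<close> from
      \<open>p\<close>; as \<open>r\<close> is positive, it is not the empty one.\<close>
    define n where "n = (LEAST i. r \<le> f i)"
    have n: "r \<le> f n" unfolding n_def using ex by (rule LeastI)
    have "delta v J p p = 0" if "J \<in> Hyper v" for J
    proof -
      obtain g where "g \<in> J" using Hyper_nonempty \<open>J \<in> Hyper v\<close> by blast
      then show ?thesis
        using that p delta_eq[OF v that _ p p, of g] Hyper_coset(1)[OF that, of g]
        by (simp add: Gv.wdist_refl closed)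
    qed
    then have "f 0 = 0" using p by (simp add: f_def hyperplane_dist_def)
    then have "n \<noteq> 0" using n r by (cases n) auto
    then obtain i where i: "n = Suc i" by (cases n) auto
    have fi: "f i < r" using not_less_Least[of i "\<lambda>i. r \<le> f i"] i n_def by auto
    have len: "i < length w"
    proof (rule ccontr)
      assume "\<not> i < length w"
      then have "f n = f i" using i by (simp add: f_def)
      then show False using n fi by simp
    qed
    obtain u h where uh: "w ! i = (u, h)" by (cases "w ! i")
    have split: "w = take i w @ (u, h) # drop (Suc i) w" using id_take_nth_drop[OF len] uh by simp
    then have cw: "take i w \<in> words" "drop (Suc i) w \<in> words" "u \<in> verts \<Gamma>" "h \<in> carrier (\<G> u)"
      using w(2) by (metis words_append words_Cons fst_conv snd_conv)+
    let ?a = "p \<otimes>\<^bsub>P\<^esub> gp (take i w)" and ?b = "p \<otimes>\<^bsub>P\<^esub> gp (take (Suc i) w)"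
    have tk: "take (Suc i) w = take i w @ [(u, h)]" using uh len by (simp add: take_Suc_conv_app_nth)
    have ac: "?a \<in> carrier P" using p cw by simp
    have b: "?b = ?a \<otimes>\<^bsub>P\<^esub> gp [(u, h)]" using tk p cw by (simp add: gp_append P.m_assoc)
    then have bc: "?b \<in> carrier P" using ac cw by simp
    \<comment> \<open>The distance jumps at this syllable, so it crosses a hyperplane. Hence it has
      colour \<open>v\<close>, and both its ends lie in that hyperplane.\<close>
    have "\<exists>J\<in>Hyper v. delta v J ?a ?b \<noteq> 0"
    proof (rule ccontr)
      assume "\<not> ?thesis"
      then have z: "delta v J ?a p = delta v J ?b p" if "J \<in> Hyper v" for J
        using delta_zero[of J ?a ?b p] that ac bc p by blast
      have sy: "delta v J p y = delta v J y p" if "J \<in> Hyper v" "y \<in> carrier P" for J y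
      proof -
        obtain g where "g \<in> J" using Hyper_nonempty \<open>J \<in> Hyper v\<close> by blast
        then show ?thesis
          using delta_eq[OF v that(1) _ p that(2), of g] delta_eq[OF v that(1) _ that(2) p, of g]
            Hyper_coset(1)[OF that(1), of g] that p Gv.wdist_sym[OF closed closed] by simp
      qed
      have "delta v J p ?a = delta v J p ?b" if "J \<in> Hyper v" for J
        using z[OF that] sy[OF that ac] sy[OF that bc] by simp
      then have "f i = f (Suc i)" unfolding f_def hyperplane_dist_def by (intro sum.cong) auto
      then show False using n fi i by simp
    qed
    then obtain J where J: "J \<in> Hyper v" "delta v J ?a ?b \<noteq> 0" by blast
    then have uv: "u = v" "?a \<in> J" using delta_syllable[OF v J(1) ac cw(3,4)] b by (auto split: if_splits)
    then have bJ: "?b \<in> J" using b coset_mult_star_syllable[OF J(1) uv(2) v] cw by simp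
    let ?w2 = "drop (Suc i) w"
    have r2: "reduced ((u, h) # ?w2)" using w(1) split reduced_appendD by metis
    have r3: "reduced (take i w @ [(u, h)])"
      using w(1) split reduced_appendD[of "take i w @ [(u, h)]" ?w2] by simp
    have q1: "q = ?a \<otimes>\<^bsub>P\<^esub> gp ((u, h) # ?w2)"
      using w(3) split gp_append[of "take i w" "(u, h) # ?w2"] cw p by (simp add: P.m_assoc)
    have q2: "q = ?b \<otimes>\<^bsub>P\<^esub> gp ?w2"
      using q1 b gp_Cons[of "(u, h)" ?w2] cw ac by (simp add: P.m_assoc)
    have "geodesic_between p ?a ?b" unfolding geodesic_between_def using r3 b by blast
    moreover have "geodesic_between p ?a q"
      unfolding geodesic_between_def using q1 w(1) split by metis
    moreover have "geodesic_between p ?b q"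
      unfolding geodesic_between_def using q2 w(1) by (metis append_take_drop_id)
    moreover have "geodesic_between ?a ?b q"
      unfolding geodesic_between_def using q2 b r2 by (intro exI[of _ "[(u, h)]"] exI[of _ ?w2]) auto
    ultimately show "\<exists>J\<in>Hyper v. \<exists>a\<in>J. \<exists>b\<in>J. geodesic_between p a b \<and> geodesic_between p a q \<and>
        geodesic_between p b q \<and> geodesic_between a b q \<and> hdist v p a < r \<and> r \<le> hdist v p b"
      using J uv bJ fi n i unfolding f_def by blast
  qed
qed

section \<open>Left translations\<close>

lemma translate_Hyper:
  assumes t: "t \<in> carrier P" and J: "J \<in> Hyper v"
  shows "(\<lambda>x. t \<otimes>\<^bsub>P\<^esub> x) ` J \<in> Hyper v"
proof -
  obtain g where g: "g \<in> J" using Hyper_nonempty J by blast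
  have c: "g \<in> carrier P" using Hyper_coset J g by blast
  have sub: "star_group v \<subseteq> carrier P" by (rule subgroup.subset[OF subgroup_star_group])
  have "(\<lambda>x. t \<otimes>\<^bsub>P\<^esub> x) ` J = t <#\<^bsub>P\<^esub> J" by (auto simp: l_coset_def)
  also have "\<dots> = (t \<otimes>\<^bsub>P\<^esub> g) <#\<^bsub>P\<^esub> star_group v"
    using Hyper_coset(2)[OF J g] P.lcos_m_assoc[OF sub t c] by simp
  finally show ?thesis using coset_Hyper t c by simp
qed

lemma delta_translate:
  assumes v: "v \<in> verts \<Gamma>" and t: "t \<in> carrier P" and J: "J \<in> Hyper v"
    and x: "x \<in> carrier P" and y: "y \<in> carrier P"
  shows "delta v ((\<lambda>x. t \<otimes>\<^bsub>P\<^esub> x) ` J) (t \<otimes>\<^bsub>P\<^esub> x) (t \<otimes>\<^bsub>P\<^esub> y) = delta v J x y"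
proof -
  obtain g where g: "g \<in> J" using Hyper_nonempty J by blast
  have c: "g \<in> carrier P" using Hyper_coset J g by blast
  show ?thesis
    using delta_eq[OF v translate_Hyper[OF t J] imageI[OF g], of "t \<otimes>\<^bsub>P\<^esub> x" "t \<otimes>\<^bsub>P\<^esub> y"]
      delta_eq[OF v J g x y] t x y c by (simp add: P.cancel_left)
qed

text \<open>\<open>t\<close> permutes the hyperplanes, the inverse translation undoing it, so the
  sum is only reindexed.\<close>

lemma hdist_translate:
  assumes v: "v \<in> verts \<Gamma>" and t: "t \<in> carrier P" and x: "x \<in> carrier P" and y: "y \<in> carrier P"
  shows "hdist v (t \<otimes>\<^bsub>P\<^esub> x) (t \<otimes>\<^bsub>P\<^esub> y) = hdist v x y"
proof -
  let ?f = "\<lambda>s. (`) (\<lambda>x. s \<otimes>\<^bsub>P\<^esub> x)"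
  let ?A = "{J \<in> Hyper v. delta v J x y \<noteq> 0}"
  let ?B = "{J \<in> Hyper v. delta v J (t \<otimes>\<^bsub>P\<^esub> x) (t \<otimes>\<^bsub>P\<^esub> y) \<noteq> 0}"
  have inv: "?f s (?f s' J) = J" if "s \<in> carrier P" "s' \<in> carrier P" "s \<otimes>\<^bsub>P\<^esub> s' = \<one>\<^bsub>P\<^esub>" "J \<in> Hyper v" for s s' J
  proof -
    have "s \<otimes>\<^bsub>P\<^esub> (s' \<otimes>\<^bsub>P\<^esub> z) = z" if z: "z \<in> J" for z
    proof -
      have "z \<in> carrier P" using Hyper_coset \<open>J \<in> Hyper v\<close> z by blast
      then show ?thesis using \<open>s \<in> carrier P\<close> \<open>s' \<in> carrier P\<close> \<open>s \<otimes>\<^bsub>P\<^esub> s' = \<one>\<^bsub>P\<^esub>\<close> by (simp flip: P.m_assoc)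
    qed
    then show ?thesis by (simp add: image_image)
  qed
  have "bij_betw (?f t) ?A ?B"
  proof (rule bij_betw_byWitness[where f' = "?f (inv\<^bsub>P\<^esub> t)"])
    show "\<forall>J\<in>?A. ?f (inv\<^bsub>P\<^esub> t) (?f t J) = J" using inv t by auto
    show "\<forall>J\<in>?B. ?f t (?f (inv\<^bsub>P\<^esub> t) J) = J" using inv t by auto
    show "?f t ` ?A \<subseteq> ?B" using delta_translate[OF v t _ x y] translate_Hyper[OF t] by auto
    show "?f (inv\<^bsub>P\<^esub> t) ` ?B \<subseteq> ?A"
    proof clarify
      fix J assume J: "J \<in> Hyper v" "delta v J (t \<otimes>\<^bsub>P\<^esub> x) (t \<otimes>\<^bsub>P\<^esub> y) \<noteq> 0"
      have J': "?f (inv\<^bsub>P\<^esub> t) J \<in> Hyper v" using translate_Hyper[OF P.inv_closed[OF t] J(1)] .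
      then show "?f (inv\<^bsub>P\<^esub> t) J \<in> Hyper v \<and> delta v (?f (inv\<^bsub>P\<^esub> t) J) x y \<noteq> 0"
        using delta_translate[OF v t J' x y] inv[of t "inv\<^bsub>P\<^esub> t" J] J t by simp
    qed
  qed
  then have "(\<Sum>J\<in>?B. delta v J (t \<otimes>\<^bsub>P\<^esub> x) (t \<otimes>\<^bsub>P\<^esub> y)) = (\<Sum>J\<in>?A. delta v (?f t J) (t \<otimes>\<^bsub>P\<^esub> x) (t \<otimes>\<^bsub>P\<^esub> y))"
    by (rule sum.reindex_bij_betw[symmetric])
  also have "\<dots> = (\<Sum>J\<in>?A. delta v J x y)"
    using delta_translate[OF v t _ x y] by (intro sum.cong) auto
  finally show ?thesis by (simp add: hyperplane_dist_def)
qed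

lemma translation_symmetry:
  assumes v: "v \<in> verts \<Gamma>" and t: "t \<in> carrier P"
  shows "tree_graded.symmetry (carrier P) (Hyper v) (delta v) (\<lambda>x. t \<otimes>\<^bsub>P\<^esub> x)"
  unfolding tree_graded.symmetry_def[OF tree_graded_hyperplanes[OF v]]
  using translate_Hyper[OF t] delta_translate[OF v t] hdist_translate[OF v t] t by auto

section \<open>Comparison of the hyperplane distances with the word metric\<close>

lemma hdist_syllable:
  assumes v: "v \<in> verts \<Gamma>" and x: "x \<in> carrier P" and u: "u \<in> verts \<Gamma>" "h \<in> carrier (\<G> u)"
  shows "hdist v x (x \<otimes>\<^bsub>P\<^esub> gp [(u, h)]) = (if u = v then real (word_length (\<G> v) (S v) h) else 0)"
proof -
  interpret tree_graded "carrier P" "Hyper v" "delta v" geodesic_between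
    using v by (rule tree_graded_hyperplanes)
  let ?J = "x <#\<^bsub>P\<^esub> star_group v"
  have J: "?J \<in> Hyper v" "x \<in> ?J" using coset_Hyper[OF x] by auto
  have "{K \<in> Hyper v. delta v K x (x \<otimes>\<^bsub>P\<^esub> gp [(u, h)]) \<noteq> 0} \<subseteq> {?J}"
    using delta_syllable[OF v _ x u] Hyper_eqI[OF _ J(1) _ J(2)] by (auto split: if_splits)
  then have "hdist v x (x \<otimes>\<^bsub>P\<^esub> gp [(u, h)]) = delta v ?J x (x \<otimes>\<^bsub>P\<^esub> gp [(u, h)])"
    using d_eq_sum[of "{?J}"] J by simp
  then show ?thesis using delta_syllable[OF v J(1) x u] J(2) by simp
qed

lemma wlen_syllable_le:
  assumes u: "u \<in> verts \<Gamma>" and h: "h \<in> carrier (\<G> u)"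
  shows "P.wlen (gp [(u, h)]) \<le> word_length (\<G> u) (S u) h"
proof -
  interpret Gu: generated_group "\<G> u" "S u" using u by (rule vertex_generated)
  obtain ws where ws: "length ws = Gu.wlen h" "set ws \<subseteq> Gu.letters" "Gu.wprod ws = h"
    using h by (rule Gu.wlen_witness)
  let ?f = "\<lambda>s. gp [(u, s)]"
  have "set vs \<subseteq> Gu.letters \<Longrightarrow> set (map ?f vs) \<subseteq> P.letters \<and> P.wprod (map ?f vs) = ?f (Gu.wprod vs)" for vs
  proof (induction vs)
    case Nil
    then show ?case using u by (simp add: gp_unit)
  next
    case (Cons a vs)
    have c: "a \<in> carrier (\<G> u)" "Gu.wprod vs \<in> carrier (\<G> u)"
      using Cons.prems Gu.letters_subset by (auto intro!: Gu.wprod_closed)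
    have "?f a \<in> P.letters"
    proof (cases "a \<in> S u")
      case True
      then show ?thesis using u by (auto simp: gp_emb_eq)
    next
      case False
      then obtain s where s: "s \<in> S u" "a = inv\<^bsub>\<G> u\<^esub> s" using Cons.prems by auto
      have "?f a = inv\<^bsub>P\<^esub> (?f s)" using s u Gu.S_subset by (auto simp: gp_inv)
      moreover have "?f s \<in> gens" using s u by (auto simp: gp_emb_eq)
      ultimately show ?thesis by blast
    qed
    then show ?case using Cons c u by (simp add: gp_mult)
  qed
  from this[OF ws(2)] show ?thesis using P.wlen_le[of "map ?f ws"] ws by simp
qed

text \<open>A letter is a syllable of length at most 1, so it moves a point by at most 1 for each
  colour.\<close>

lemma hdist_le_wdist:
  assumes v: "v \<in> verts \<Gamma>" and x: "x \<in> carrier P" and y: "y \<in> carrier P"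
  shows "hdist v x y \<le> P.wdist x y"
proof -
  interpret tree_graded "carrier P" "Hyper v" "delta v" geodesic_between
    using v by (rule tree_graded_hyperplanes)
  have letter: "hdist v x (x \<otimes>\<^bsub>P\<^esub> a) \<le> 1" if x: "x \<in> carrier P" and a: "a \<in> P.letters" for x a
  proof -
    obtain u s where u: "u \<in> verts \<Gamma>" "s \<in> S u" "a = gp [(u, s)] \<or> a = inv\<^bsub>P\<^esub> (gp [(u, s)])"
      using a by (auto simp: gp_emb_eq)
    interpret Gu: generated_group "\<G> u" "S u" using u by (intro vertex_generated)
    obtain h where h: "h \<in> Gu.letters" "a = gp [(u, h)]" using u Gu.S_subset gp_inv by blast
    then have "h \<in> carrier (\<G> u)" using Gu.letters_subset by blast
    then show ?thesis using hdist_syllable[OF v x u(1), of h] h Gu.wlen_letter[OF h(1)] by auto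
  qed
  have *: "set ws \<subseteq> P.letters \<Longrightarrow> x \<in> carrier P \<Longrightarrow> hdist v x (x \<otimes>\<^bsub>P\<^esub> P.wprod ws) \<le> length ws" for ws x
  proof (induction ws arbitrary: x)
    case Nil
    then show ?case using \<delta>_refl by (simp add: hyperplane_dist_def)
  next
    case (Cons a ws)
    have l: "a \<in> P.letters" "set ws \<subseteq> P.letters" using Cons.prems(1) unfolding list.set by blast+
    then have c: "a \<in> carrier P" "P.wprod ws \<in> carrier P"
      using P.letters_subset P.wprod_closed[OF subset_trans[OF l(2) P.letters_subset]]
      by (auto simp only: subset_iff)
    have xa: "x \<otimes>\<^bsub>P\<^esub> a \<in> carrier P" using c Cons.prems(2) by simp
    have e: "x \<otimes>\<^bsub>P\<^esub> P.wprod (a # ws) = x \<otimes>\<^bsub>P\<^esub> a \<otimes>\<^bsub>P\<^esub> P.wprod ws"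
      using c Cons.prems(2) by (simp add: P.m_assoc)
    have "hdist v x (x \<otimes>\<^bsub>P\<^esub> a \<otimes>\<^bsub>P\<^esub> P.wprod ws) \<le>
        hdist v x (x \<otimes>\<^bsub>P\<^esub> a) + hdist v (x \<otimes>\<^bsub>P\<^esub> a) (x \<otimes>\<^bsub>P\<^esub> a \<otimes>\<^bsub>P\<^esub> P.wprod ws)"
      using c xa Cons.prems(2) by (intro d_triangle P.m_closed)
    also have "\<dots> \<le> 1 + real (length ws)"
      by (rule add_mono[OF letter[OF Cons.prems(2) l(1)] Cons.IH[OF l(2) xa]])
    finally show ?case unfolding e by simp
  qed
  obtain ws where ws: "length ws = P.wlen (inv\<^bsub>P\<^esub> x \<otimes>\<^bsub>P\<^esub> y)" "set ws \<subseteq> P.letters" "P.wprod ws = inv\<^bsub>P\<^esub> x \<otimes>\<^bsub>P\<^esub> y"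
    by (rule P.wlen_witness[OF P.m_closed[OF P.inv_closed[OF x] y]])
  have "x \<otimes>\<^bsub>P\<^esub> (inv\<^bsub>P\<^esub> x \<otimes>\<^bsub>P\<^esub> y) = y" using x y by (simp flip: P.m_assoc)
  then show ?thesis using *[OF ws(2) x] ws(1,3) by (simp add: word_dist_def)
qed

text \<open>Along a reduced word the distances of all colours are additive, and each syllable is
  charged with its full length to its own colour.\<close>

lemma wdist_le_sum_hdist:
  assumes x: "x \<in> carrier P" and y: "y \<in> carrier P"
  shows "P.wdist x y \<le> (\<Sum>v\<in>verts \<Gamma>. hdist v x y)"
proof -
  have "reduced w \<Longrightarrow> P.wdist x (x \<otimes>\<^bsub>P\<^esub> gp w) \<le> (\<Sum>v\<in>verts \<Gamma>. hdist v x (x \<otimes>\<^bsub>P\<^esub> gp w))" for w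
  proof (induction w rule: rev_induct)
    case Nil
    have "0 \<le> (\<Sum>v\<in>verts \<Gamma>. hdist v x x)"
      using x by (intro sum_nonneg tree_graded.d_nonneg[OF tree_graded_hyperplanes])
    then show ?case using x by (simp add: P.wdist_refl)
  next
    case (snoc s w)
    obtain u h where s: "s = (u, h)" by (cases s)
    have c: "w \<in> words" "u \<in> verts \<Gamma>" "h \<in> carrier (\<G> u)" "reduced w"
      using reduced_words[OF snoc.prems] reduced_appendD[OF snoc.prems] s by auto
    let ?y = "x \<otimes>\<^bsub>P\<^esub> gp w"
    let ?z = "?y \<otimes>\<^bsub>P\<^esub> gp [(u, h)]"
    have z: "x \<otimes>\<^bsub>P\<^esub> gp (w @ [s]) = ?z" using c s x by (simp add: gp_append P.m_assoc)
    have yc: "?y \<in> carrier P" "?z \<in> carrier P" using x c by auto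
    have "geodesic_between x ?y ?z" unfolding geodesic_between_def using snoc.prems s by blast
    then have add: "hdist v x ?z = hdist v x ?y + (if u = v then real (word_length (\<G> v) (S v) h) else 0)"
      if "v \<in> verts \<Gamma>" for v
      using tree_graded.btw_d[OF tree_graded_hyperplanes[OF that], of x ?y ?z]
        hdist_syllable[OF that yc(1) c(2,3)] x yc by simp
    have "P.wdist x ?z \<le> P.wdist x ?y + P.wdist ?y ?z" using x yc by (intro P.wdist_triangle)
    also have "inv\<^bsub>P\<^esub> ?y \<otimes>\<^bsub>P\<^esub> ?z = gp [(u, h)]" using yc(1) c by (intro P.inv_mult_cancel) simp_all
    then have "P.wdist ?y ?z \<le> word_length (\<G> u) (S u) h"
      using wlen_syllable_le[OF c(2,3)] by (simp add: word_dist_def)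
    also have "P.wdist x ?y \<le> (\<Sum>v\<in>verts \<Gamma>. hdist v x ?y)" using snoc.IH c by simp
    finally show ?case
      unfolding z using c(2) by (simp add: add sum.distrib finite_verts)
  qed
  moreover obtain w where "reduced w" "y = x \<otimes>\<^bsub>P\<^esub> gp w" using difference_word x y by blast
  ultimately show ?thesis by blast
qed

end

section \<open>Asymptotic cones\<close>

lemma ultrafilter_cases:
  "nonprincipal_ultrafilter \<omega> \<Longrightarrow> \<not> eventually P \<omega> \<Longrightarrow> eventually (\<lambda>n. \<not> P n) \<omega>"
  by (auto simp: nonprincipal_ultrafilter_def)

lemma ultrafilter_nontrivial: "nonprincipal_ultrafilter \<omega> \<Longrightarrow> \<omega> \<noteq> bot"
  by (simp add: nonprincipal_ultrafilter_def)

lemma nonprincipal_eventually_ge: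
  assumes "nonprincipal_ultrafilter \<omega>"
  shows "eventually (\<lambda>n. k \<le> n) \<omega>"
proof -
  have "eventually (\<lambda>n. n \<noteq> i) \<omega>" for i
  proof (rule ccontr)
    assume "\<not> ?thesis"
    then have ev: "eventually (\<lambda>n. n = i) \<omega>" using ultrafilter_cases[OF assms] by force
    \<comment> \<open>A proper filter that contains the singleton of \<open>i\<close> is the
      principal one.\<close>
    have "\<omega> = principal {i}"
    proof (rule filter_eqI)
      fix P
      have "P i" if "eventually P \<omega>"
      proof -
        have "eventually (\<lambda>_. P i) \<omega>" using eventually_conj[OF that ev] by (rule eventually_mono) auto
        then show ?thesis using ultrafilter_nontrivial[OF assms] by (simp add: eventually_const_iff)
      qed
      moreover have "eventually P \<omega>" if "P i" using ev by (rule eventually_mono) (use that in auto)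
      ultimately show "eventually P \<omega> = eventually P (principal {i})" by (auto simp: eventually_principal)
    qed
    then show False using assms by (auto simp: nonprincipal_ultrafilter_def)
  qed
  then have "eventually (\<lambda>n. \<forall>i\<in>{..<k}. n \<noteq> i) \<omega>" by (intro eventually_ball_finite) auto
  then show ?thesis by (rule eventually_mono) (use leI in auto)
qed

text \<open>The limit is the supremum of the eventual lower bounds. A number above it is not such a
  bound, and the ultrafilter turns this failure into an eventual upper bound.\<close>

lemma omega_bounded_tendsto:
  assumes ultra: "nonprincipal_ultrafilter \<omega>" and bd: "omega_bounded \<omega> r"
  shows "(r \<longlongrightarrow> Lim \<omega> r) \<omega>"
proof -
  obtain B where B: "eventually (\<lambda>n. \<bar>r n\<bar> \<le> B) \<omega>" using bd by (auto simp: omega_bounded_def)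
  define A where "A = {c. eventually (\<lambda>n. c \<le> r n) \<omega>}"
  have "- B \<in> A" unfolding A_def using B by (auto elim!: eventually_mono)
  have le: "c \<le> B" if "c \<in> A" for c
  proof -
    have "eventually (\<lambda>n. c \<le> B) \<omega>"
      using eventually_conj[OF B that[unfolded A_def mem_Collect_eq]] by (rule eventually_mono) auto
    then show ?thesis using ultrafilter_nontrivial[OF ultra] by (simp add: eventually_const_iff)
  qed
  then have bdd: "bdd_above A" by (auto simp: bdd_above_def)
  have "(r \<longlongrightarrow> Sup A) \<omega>"
  proof (rule order_tendstoI)
    fix a assume "a < Sup A"
    then obtain c where "c \<in> A" "a < c" using \<open>- B \<in> A\<close> less_cSup_iff[OF _ bdd] by blast
    then show "eventually (\<lambda>n. a < r n) \<omega>" by (auto simp: A_def elim!: eventually_mono)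
  next
    fix a assume "Sup A < a"
    then have "a \<notin> A" using cSup_upper[OF _ bdd] by force
    then show "eventually (\<lambda>n. r n < a) \<omega>"
      using ultrafilter_cases[OF ultra, of "\<lambda>n. a \<le> r n"] by (simp add: A_def not_le)
  qed
  then show ?thesis using tendsto_Lim[OF ultrafilter_nontrivial[OF ultra]] by metis
qed

section \<open>The asymptotic cone as a metric space\<close>

locale cone =
  fixes \<omega> :: "nat filter" and M :: "'x set" and d :: "'x \<Rightarrow> 'x \<Rightarrow> real"
    and r :: "nat \<Rightarrow> real" and b :: "nat \<Rightarrow> 'x"
  assumes ultra: "nonprincipal_ultrafilter \<omega>" and r_pos: "\<And>n. 0 < r n"
    and d_nonneg: "\<And>x y. 0 \<le> d x y"
    and d_refl: "\<And>x. x \<in> M \<Longrightarrow> d x x = 0"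
    and d_sym: "\<And>x y. x \<in> M \<Longrightarrow> y \<in> M \<Longrightarrow> d x y = d y x"
    and d_triangle: "\<And>x y z. x \<in> M \<Longrightarrow> y \<in> M \<Longrightarrow> z \<in> M \<Longrightarrow> d x z \<le> d x y + d y z"
    and base: "\<And>n. b n \<in> M"
begin

abbreviation seqs where "seqs \<equiv> cone_seqs \<omega> M d r b"
abbreviation rel where "rel \<equiv> cone_rel \<omega> M d r b"
abbreviation points where "points \<equiv> asymptotic_cone \<omega> M d r b"
abbreviation pdist where "pdist \<equiv> cone_pseudodist \<omega> d r"
abbreviation cdist where "cdist \<equiv> cone_dist \<omega> M d r b"

text \<open>The boundedness condition of the cone, cleared of the quotient and stated for two
  arbitrary sequences, so that it becomes transitive.\<close>

definition at_scale :: "(nat \<Rightarrow> 'x) \<Rightarrow> (nat \<Rightarrow> 'x) \<Rightarrow> bool" where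
  "at_scale x y \<longleftrightarrow> (\<exists>B. eventually (\<lambda>n. d (x n) (y n) \<le> B * r n) \<omega>)"

lemma nontrivial: "\<omega> \<noteq> bot"
  using ultra by (rule ultrafilter_nontrivial)

lemma omega_bounded_iff: "omega_bounded \<omega> (\<lambda>n. d (x n) (y n) / r n) \<longleftrightarrow> at_scale x y"
  using r_pos d_nonneg by (simp add: omega_bounded_def at_scale_def divide_le_eq less_imp_le)

lemma seqs_iff: "x \<in> seqs \<longleftrightarrow> (\<forall>n. x n \<in> M) \<and> at_scale b x"
  by (simp add: cone_seqs_def omega_bounded_iff)

lemma seqs_mem: "x \<in> seqs \<Longrightarrow> x n \<in> M"
  by (simp add: cone_seqs_def)

lemma at_scale_trans:
  assumes "\<And>n. x n \<in> M" "\<And>n. y n \<in> M" "\<And>n. z n \<in> M" "at_scale x y" "at_scale y z"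
  shows "at_scale x z"
proof -
  obtain B C where "eventually (\<lambda>n. d (x n) (y n) \<le> B * r n) \<omega>" "eventually (\<lambda>n. d (y n) (z n) \<le> C * r n) \<omega>"
    using assms(4,5) by (auto simp: at_scale_def)
  then have "eventually (\<lambda>n. d (x n) (z n) \<le> (B + C) * r n) \<omega>"
  proof eventually_elim
    case (elim n)
    then show ?case using d_triangle[of "x n" "y n" "z n"] assms(1-3) by (simp add: algebra_simps)
  qed
  then show ?thesis by (auto simp: at_scale_def)
qed

lemma at_scale_sym:
  assumes "\<And>n. x n \<in> M" "\<And>n. y n \<in> M" "at_scale x y"
  shows "at_scale y x"
  using assms d_sym[of "x _" "y _"] by (simp add: at_scale_def)

lemma at_scale_seqs: "x \<in> seqs \<Longrightarrow> y \<in> seqs \<Longrightarrow> at_scale x y"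
  using at_scale_trans[of x b y] at_scale_sym[of b x] base by (simp add: seqs_iff)

lemma seqs_at_scale: "x \<in> seqs \<Longrightarrow> (\<And>n. y n \<in> M) \<Longrightarrow> at_scale x y \<Longrightarrow> y \<in> seqs"
  using at_scale_trans[of b x y] base by (simp add: seqs_iff)

lemma base_seqs: "b \<in> seqs"
  using base d_refl by (auto simp: seqs_iff at_scale_def intro: exI[of _ 0])

lemma pdist_tendsto: "x \<in> seqs \<Longrightarrow> y \<in> seqs \<Longrightarrow> ((\<lambda>n. d (x n) (y n) / r n) \<longlongrightarrow> pdist x y) \<omega>"
  unfolding cone_pseudodist_def
  by (intro omega_bounded_tendsto ultra) (simp add: omega_bounded_iff at_scale_seqs)

lemma pdist_nonneg: "x \<in> seqs \<Longrightarrow> y \<in> seqs \<Longrightarrow> 0 \<le> pdist x y"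
  using nontrivial d_nonneg r_pos
  by (intro tendsto_lowerbound[OF pdist_tendsto]) (auto simp: less_imp_le)

lemma pdist_refl: "x \<in> seqs \<Longrightarrow> pdist x x = 0"
  using tendsto_unique[OF nontrivial pdist_tendsto[of x x], of 0] d_refl seqs_mem by simp

lemma pdist_sym: "x \<in> seqs \<Longrightarrow> y \<in> seqs \<Longrightarrow> pdist x y = pdist y x"
  using d_sym seqs_mem by (simp add: cone_pseudodist_def)

lemma pdist_triangle:
  assumes "x \<in> seqs" "y \<in> seqs" "z \<in> seqs"
  shows "pdist x z \<le> pdist x y + pdist y z"
proof (rule tendsto_le[OF nontrivial])
  show "((\<lambda>n. d (x n) (y n) / r n + d (y n) (z n) / r n) \<longlongrightarrow> pdist x y + pdist y z) \<omega>"
    using assms by (intro tendsto_add pdist_tendsto)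
  show "((\<lambda>n. d (x n) (z n) / r n) \<longlongrightarrow> pdist x z) \<omega>" using assms by (intro pdist_tendsto)
  show "eventually (\<lambda>n. d (x n) (z n) / r n \<le> d (x n) (y n) / r n + d (y n) (z n) / r n) \<omega>"
    using assms seqs_mem d_triangle r_pos
    by (intro always_eventually allI) (simp add: divide_right_mono less_imp_le flip: add_divide_distrib)
qed

lemma pdist_less:
  assumes "x \<in> seqs" "y \<in> seqs" "pdist x y < B"
  shows "eventually (\<lambda>n. d (x n) (y n) \<le> B * r n) \<omega>"
  using order_tendstoD(2)[OF pdist_tendsto[OF assms(1,2)] assms(3)]
  by (rule eventually_mono) (use r_pos in \<open>simp add: divide_less_eq less_imp_le\<close>)

lemma pdist_zeroI:
  assumes "x \<in> seqs" "y \<in> seqs" "\<And>e. 0 < e \<Longrightarrow> eventually (\<lambda>n. d (x n) (y n) \<le> e * r n) \<omega>"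
  shows "pdist x y = 0"
proof (rule antisym)
  show "pdist x y \<le> 0"
  proof (rule field_le_epsilon)
    fix e :: real assume "0 < e"
    have "eventually (\<lambda>n. d (x n) (y n) / r n \<le> e) \<omega>"
      using assms(3)[OF \<open>0 < e\<close>] by (rule eventually_mono) (use r_pos in \<open>simp add: divide_le_eq\<close>)
    then show "pdist x y \<le> 0 + e"
      using tendsto_upperbound[OF pdist_tendsto[OF assms(1,2)] _ nontrivial] by simp
  qed
qed (rule pdist_nonneg[OF assms(1,2)])

lemma rel_iff: "(x, y) \<in> rel \<longleftrightarrow> x \<in> seqs \<and> y \<in> seqs \<and> pdist x y = 0"
  by (simp add: cone_rel_def)

lemma equiv_rel: "equiv seqs rel"
proof (rule equivI)
  show "rel \<subseteq> seqs \<times> seqs" by (auto simp: rel_iff)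
  show "refl_on seqs rel" by (auto simp: refl_on_def rel_iff pdist_refl)
  show "sym rel" by (auto simp: sym_def rel_iff pdist_sym)
  show "trans rel"
  proof (rule transI)
    fix x y z assume "(x, y) \<in> rel" "(y, z) \<in> rel"
    then show "(x, z) \<in> rel"
      using pdist_triangle[of x y z] pdist_nonneg[of x z] by (auto simp: rel_iff)
  qed
qed

definition pt :: "(nat \<Rightarrow> 'x) \<Rightarrow> (nat \<Rightarrow> 'x) set" where
  "pt x = rel `` {x}"

lemma points_eq: "points = pt ` seqs"
  by (auto simp: asymptotic_cone_def quotient_def pt_def)

lemma pt_eq_iff: "x \<in> seqs \<Longrightarrow> y \<in> seqs \<Longrightarrow> pt x = pt y \<longleftrightarrow> pdist x y = 0"
  unfolding pt_def by (simp add: eq_equiv_class_iff[OF equiv_rel]) (simp add: rel_iff)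

lemma mem_pt: "y \<in> pt x \<longleftrightarrow> x \<in> seqs \<and> y \<in> seqs \<and> pdist x y = 0"
  by (simp add: pt_def rel_iff)

text \<open>By the triangle inequality, moving either representative by distance 0 changes nothing,
  whatever the choice returns.\<close>

lemma cdist_pt:
  assumes "x \<in> seqs" "y \<in> seqs"
  shows "cdist (pt x) (pt y) = pdist x y"
proof -
  define x' where "x' = (SOME x'. x' \<in> pt x)"
  define y' where "y' = (SOME y'. y' \<in> pt y)"
  have "x' \<in> pt x" unfolding x'_def by (rule someI[of _ x]) (simp add: mem_pt pdist_refl assms)
  moreover have "y' \<in> pt y" unfolding y'_def by (rule someI[of _ y]) (simp add: mem_pt pdist_refl assms)
  ultimately have *: "x' \<in> seqs" "pdist x x' = 0" "y' \<in> seqs" "pdist y y' = 0" by (auto simp: mem_pt)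
  have "pdist x' y' = pdist x y"
    using pdist_triangle[of x' x y'] pdist_triangle[of x y y'] pdist_triangle[of x x' y]
      pdist_triangle[of x' y' y] pdist_sym[of x x'] pdist_sym[of y y'] assms * by linarith
  then show ?thesis using assms unfolding cone_dist_def by (simp add: points_eq flip: x'_def y'_def)
qed

lemma Metric_space_cone: "Metric_space points cdist"
proof
  show "0 \<le> cdist p q" for p q
  proof (cases "p \<in> points \<and> q \<in> points")
    case True
    then show ?thesis by (auto simp: points_eq cdist_pt pdist_nonneg)
  qed (auto simp: cone_dist_def)
  show "cdist p q = cdist q p" for p q
  proof (cases "p \<in> points \<and> q \<in> points")
    case True
    then show ?thesis by (auto simp: points_eq cdist_pt pdist_sym)
  qed (auto simp: cone_dist_def)
  show "cdist p q = 0 \<longleftrightarrow> p = q" if "p \<in> points" "q \<in> points" for p q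
    using that by (auto simp: points_eq cdist_pt simp flip: pt_eq_iff)
  show "cdist p s \<le> cdist p q + cdist q s" if "p \<in> points" "q \<in> points" "s \<in> points" for p q s
    using that by (auto simp: points_eq cdist_pt pdist_triangle)
qed

end

section \<open>Limits of left translations\<close>

locale group_cone = group P + cone \<omega> "carrier P" d r b
  for P (structure) and \<omega> :: "nat filter" and d r b +
  assumes d_left_invariant:
    "\<And>t x y. \<lbrakk>t \<in> carrier P; x \<in> carrier P; y \<in> carrier P\<rbrakk> \<Longrightarrow> d (t \<otimes> x) (t \<otimes> y) = d x y"
begin

lemma limit_action_pt:
  assumes \<phi>: "\<And>n. \<phi> n h \<in> carrier P" and x: "x \<in> seqs" and hx: "(\<lambda>n. \<phi> n h \<otimes> x n) \<in> seqs"
  shows "limit_action \<omega> P d r b \<phi> h (pt x) = pt (\<lambda>n. \<phi> n h \<otimes> x n)"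
proof -
  have "rel `` {\<lambda>n. \<phi> n h \<otimes> y n} = pt (\<lambda>n. \<phi> n h \<otimes> x n)" if "y \<in> pt x" for y
  proof -
    have y: "y \<in> seqs" "pdist x y = 0" using that by (auto simp: mem_pt)
    have "at_scale (\<lambda>n. \<phi> n h \<otimes> x n) (\<lambda>n. \<phi> n h \<otimes> y n)"
      using at_scale_seqs[OF x y(1)] \<phi> seqs_mem[OF x] seqs_mem[OF y(1)]
      by (simp add: at_scale_def d_left_invariant)
    then have "(\<lambda>n. \<phi> n h \<otimes> y n) \<in> seqs"
      using \<phi> seqs_mem[OF y(1)] by (intro seqs_at_scale[OF hx]) auto
    moreover have "pdist (\<lambda>n. \<phi> n h \<otimes> x n) (\<lambda>n. \<phi> n h \<otimes> y n) = pdist x y"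
      using \<phi> seqs_mem[OF x] seqs_mem[OF y(1)] by (simp add: cone_pseudodist_def d_left_invariant)
    ultimately show ?thesis
      using pt_eq_iff[OF hx, of "\<lambda>n. \<phi> n h \<otimes> y n"] y(2) by (metis pt_def)
  qed
  moreover have "x \<in> pt x" using x by (simp add: mem_pt pdist_refl)
  ultimately have "(\<Union>y\<in>pt x. rel `` {\<lambda>n. \<phi> n h \<otimes> y n}) = pt (\<lambda>n. \<phi> n h \<otimes> x n)" by blast
  then show ?thesis using x by (simp add: limit_action_def points_eq)
qed

text \<open>If the value is a point of the cone, some representative is translated into the cone,
  and left invariance carries this over to all of them. In this way the existence of the action
  yields bounds on displacements.\<close>

lemma limit_action_seqs:
  assumes \<phi>: "\<And>n. \<phi> n h \<in> carrier P" and x: "x \<in> seqs"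
    and mem: "limit_action \<omega> P d r b \<phi> h (pt x) \<in> points"
  shows "(\<lambda>n. \<phi> n h \<otimes> x n) \<in> seqs"
proof -
  obtain z where z: "z \<in> seqs" "limit_action \<omega> P d r b \<phi> h (pt x) = pt z" using mem by (auto simp: points_eq)
  then have "z \<in> limit_action \<omega> P d r b \<phi> h (pt x)" by (simp add: mem_pt pdist_refl)
  then obtain y where "y \<in> pt x" "z \<in> rel `` {\<lambda>n. \<phi> n h \<otimes> y n}"
    using x by (auto simp: limit_action_def points_eq)
  then have y: "y \<in> seqs" "(\<lambda>n. \<phi> n h \<otimes> y n) \<in> seqs" by (auto simp: mem_pt rel_iff)
  have "at_scale (\<lambda>n. \<phi> n h \<otimes> y n) (\<lambda>n. \<phi> n h \<otimes> x n)"
    using at_scale_seqs[OF y(1) x] \<phi> seqs_mem[OF x] seqs_mem[OF y(1)]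
    by (simp add: at_scale_def d_left_invariant)
  then show ?thesis using \<phi> seqs_mem[OF x] by (intro seqs_at_scale[OF y(2)]) auto
qed

end

context marked_graph_of_groups
begin

text \<open>Conjugation by a point \<open>g\<close> of \<open>J\<close> carries the stabiliser of
  \<open>J\<close> into \<open>star_group v\<close>. Being a homomorphism, it needs to be tested on
  generators only.\<close>

lemma stabiliser_in_star_subgroup:
  assumes G: "group G" "generate G T = carrier G" "T \<subseteq> carrier G" and f: "f \<in> hom G P"
    and v: "v \<in> verts \<Gamma>" and J: "J \<in> Hyper v" and stab: "\<And>t. t \<in> T \<Longrightarrow> (\<lambda>x. f t \<otimes>\<^bsub>P\<^esub> x) ` J = J"
  shows "\<exists>H\<in>star_subgroups \<Gamma> \<G>. f ` carrier G \<subseteq> H"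
proof -
  interpret G: group G by (rule G)
  interpret f: group_hom G P f using f by unfold_locales
  obtain g where g: "g \<in> J" using Hyper_nonempty[OF J] by blast
  have c: "g \<in> carrier P" using Hyper_coset J g by blast
  note sub = subgroup_star_group[of v]
  define c_g where "c_g x = inv\<^bsub>P\<^esub> g \<otimes>\<^bsub>P\<^esub> x \<otimes>\<^bsub>P\<^esub> g" for x
  have c_mult: "c_g (x \<otimes>\<^bsub>P\<^esub> y) = c_g x \<otimes>\<^bsub>P\<^esub> c_g y" if "x \<in> carrier P" "y \<in> carrier P" for x y
  proof -
    have "g \<otimes>\<^bsub>P\<^esub> (inv\<^bsub>P\<^esub> g \<otimes>\<^bsub>P\<^esub> (y \<otimes>\<^bsub>P\<^esub> g)) = y \<otimes>\<^bsub>P\<^esub> g"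
      using that c by (simp flip: P.m_assoc)
    then show ?thesis using that c by (simp add: c_g_def P.m_assoc)
  qed
  have c_one: "c_g \<one>\<^bsub>P\<^esub> = \<one>\<^bsub>P\<^esub>" using c by (simp add: c_g_def)
  have c_closed: "c_g x \<in> carrier P" if "x \<in> carrier P" for x using that c by (simp add: c_g_def)
  have T: "c_g (f t) \<in> star_group v" if "t \<in> T" for t
  proof -
    have "f t \<otimes>\<^bsub>P\<^esub> g \<in> J" using stab[OF that] g by blast
    then have "inv\<^bsub>P\<^esub> g \<otimes>\<^bsub>P\<^esub> (f t \<otimes>\<^bsub>P\<^esub> g) \<in> star_group v" using Hyper_mem_iff[OF J g] by blast
    then show ?thesis using that c G(3) by (simp add: c_g_def P.m_assoc subset_iff)
  qed
  have "c_g (f h) \<in> star_group v \<and> h \<in> carrier G" if "h \<in> generate G T" for h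
    using that
  proof (induction rule: generate.induct)
    case one
    then show ?case using c_one subgroup.one_closed[OF sub] by simp
  next
    case (incl h)
    then show ?case using T G(3) by blast
  next
    case (inv t)
    then have t: "t \<in> carrier G" using G(3) by blast
    have "c_g (f (inv\<^bsub>G\<^esub> t)) \<otimes>\<^bsub>P\<^esub> c_g (f t) = \<one>\<^bsub>P\<^esub>"
      using t c_one by (simp flip: c_mult f.hom_mult)
    then have "c_g (f (inv\<^bsub>G\<^esub> t)) = inv\<^bsub>P\<^esub> (c_g (f t))"
      using P.inv_equality[of "c_g (f (inv\<^bsub>G\<^esub> t))" "c_g (f t)"] t c_closed by simp
    then show ?case using subgroup.m_inv_closed[OF sub T[OF inv]] t by simp
  next
    case (eng h k)
    then show ?case using subgroup.m_closed[OF sub, of "c_g (f h)" "c_g (f k)"] by (simp add: c_mult)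
  qed
  then have "c_g (f h) \<in> star_group v" if "h \<in> carrier G" for h using that G(2) by blast
  moreover have "f h = g \<otimes>\<^bsub>P\<^esub> c_g (f h) \<otimes>\<^bsub>P\<^esub> inv\<^bsub>P\<^esub> g" if "h \<in> carrier G" for h
  proof -
    have "g \<otimes>\<^bsub>P\<^esub> c_g (f h) \<otimes>\<^bsub>P\<^esub> inv\<^bsub>P\<^esub> g = inv\<^bsub>P\<^esub> (inv\<^bsub>P\<^esub> g) \<otimes>\<^bsub>P\<^esub> (inv\<^bsub>P\<^esub> g \<otimes>\<^bsub>P\<^esub> f h)"
      using that c by (simp add: c_g_def P.m_assoc)
    also have "\<dots> = f h" using that c by (intro P.inv_mult_cancel) auto
    finally show ?thesis by simp
  qed
  ultimately have "f ` carrier G \<subseteq> g <#\<^bsub>P\<^esub> star_group v #>\<^bsub>P\<^esub> inv\<^bsub>P\<^esub> g"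
    by (fastforce simp: l_coset_def r_coset_def)
  moreover have "g <#\<^bsub>P\<^esub> star_group v #>\<^bsub>P\<^esub> inv\<^bsub>P\<^esub> g \<in> star_subgroups \<Gamma> \<G>"
    unfolding star_subgroups_def using c v by blast
  ultimately show ?thesis by blast
qed

end

section \<open>The limit of the twisted actions\<close>

locale twisted_actions = marked_graph_of_groups \<Gamma> \<G> S + G: group G
  for \<Gamma> :: "('v, 'e) pre_digraph" and \<G> :: "'v \<Rightarrow> 'a monoid" and S :: "'v \<Rightarrow> 'a set" and G :: "'g monoid" +
  fixes \<phi> :: "nat \<Rightarrow> 'g \<Rightarrow> ('v \<times> 'a) list set set" and \<omega> :: "nat filter"
    and lam :: "nat \<Rightarrow> real" and b :: "nat \<Rightarrow> ('v \<times> 'a) list set set"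
  assumes hom: "\<And>n. \<phi> n \<in> hom G P"
    and nonprincipal: "nonprincipal_ultrafilter \<omega>"
    and lam_pos: "\<And>n. 0 < lam n"
    and basepoint: "\<And>n. b n \<in> carrier P"
    and action: "group_action G (asymptotic_cone \<omega> (carrier P) P.wdist lam b)
      (limit_action \<omega> P P.wdist lam b \<phi>)"
    and bounded_orbits: "\<And>p. p \<in> asymptotic_cone \<omega> (carrier P) P.wdist lam b \<Longrightarrow>
      Metric_space.mbounded (asymptotic_cone \<omega> (carrier P) P.wdist lam b)
        (cone_dist \<omega> (carrier P) P.wdist lam b)
        (Group_Action.orbit G (limit_action \<omega> P P.wdist lam b \<phi>) p)"
begin

sublocale C: group_cone P \<omega> P.wdist lam b
  using nonprincipal lam_pos basepoint
  by unfold_locales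
    (auto simp: P.wdist_nonneg P.wdist_refl P.wdist_sym P.wdist_left_invariant intro: P.wdist_triangle)

section \<open>Orbits at a fixed index and their bounds\<close>

lemma \<phi>_closed: "h \<in> carrier G \<Longrightarrow> \<phi> n h \<in> carrier P"
  using hom[of n] by (auto simp: hom_def)

lemma \<phi>_mult: "g \<in> carrier G \<Longrightarrow> h \<in> carrier G \<Longrightarrow> \<phi> n (g \<otimes>\<^bsub>G\<^esub> h) = \<phi> n g \<otimes>\<^bsub>P\<^esub> \<phi> n h"
  using hom[of n] by (auto simp: hom_def)

lemma \<phi>_one: "\<phi> n \<one>\<^bsub>G\<^esub> = \<one>\<^bsub>P\<^esub>"
  by (rule hom_one[OF hom G.is_group P.is_group])

lemma \<phi>_mult_act:
  "\<lbrakk>g \<in> carrier G; h \<in> carrier G; x \<in> carrier P\<rbrakk> \<Longrightarrow> \<phi> n g \<otimes>\<^bsub>P\<^esub> (\<phi> n h \<otimes>\<^bsub>P\<^esub> x) = \<phi> n (g \<otimes>\<^bsub>G\<^esub> h) \<otimes>\<^bsub>P\<^esub> x"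
  by (simp add: \<phi>_mult \<phi>_closed P.m_assoc)

lemma \<phi>_difference:
  assumes "f \<in> carrier G" "k \<in> carrier G" "x \<in> carrier P"
  shows "\<phi> n k \<otimes>\<^bsub>P\<^esub> x = \<phi> n f \<otimes>\<^bsub>P\<^esub> (\<phi> n (inv\<^bsub>G\<^esub> f \<otimes>\<^bsub>G\<^esub> k) \<otimes>\<^bsub>P\<^esub> x)"
proof -
  have "f \<otimes>\<^bsub>G\<^esub> (inv\<^bsub>G\<^esub> f \<otimes>\<^bsub>G\<^esub> k) = k" using assms by (simp flip: G.m_assoc)
  then show ?thesis using assms by (simp add: \<phi>_mult_act)
qed

text \<open>Distances between orbit points are displacements of one point by single group elements,
  so finitely many displacement bounds control a finite piece of the orbit.\<close>

lemma hdist_orbit: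
  "\<lbrakk>v \<in> verts \<Gamma>; f \<in> carrier G; k \<in> carrier G; x \<in> carrier P\<rbrakk> \<Longrightarrow>
    hdist v (\<phi> n f \<otimes>\<^bsub>P\<^esub> x) (\<phi> n k \<otimes>\<^bsub>P\<^esub> x) = hdist v x (\<phi> n (inv\<^bsub>G\<^esub> f \<otimes>\<^bsub>G\<^esub> k) \<otimes>\<^bsub>P\<^esub> x)"
  using \<phi>_difference[of f k x n] hdist_translate[of v "\<phi> n f" x] \<phi>_closed by simp

lemma wdist_orbit:
  "\<lbrakk>f \<in> carrier G; k \<in> carrier G; x \<in> carrier P\<rbrakk> \<Longrightarrow>
    P.wdist (\<phi> n f \<otimes>\<^bsub>P\<^esub> x) (\<phi> n k \<otimes>\<^bsub>P\<^esub> x) = P.wdist x (\<phi> n (inv\<^bsub>G\<^esub> f \<otimes>\<^bsub>G\<^esub> k) \<otimes>\<^bsub>P\<^esub> x)"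
  using \<phi>_difference[of f k x n] P.wdist_left_invariant[of "\<phi> n f" x] \<phi>_closed by simp

lemma
  assumes x: "x \<in> C.seqs" and h: "h \<in> carrier G"
  shows translate_seqs: "(\<lambda>n. \<phi> n h \<otimes>\<^bsub>P\<^esub> x n) \<in> C.seqs"
    and translate_pt: "limit_action \<omega> P P.wdist lam b \<phi> h (C.pt x) = C.pt (\<lambda>n. \<phi> n h \<otimes>\<^bsub>P\<^esub> x n)"
proof -
  interpret group_action G C.points "limit_action \<omega> P P.wdist lam b \<phi>" by (rule action)
  have "C.pt x \<in> C.points" using x by (simp add: C.points_eq)
  then have "limit_action \<omega> P P.wdist lam b \<phi> h (C.pt x) \<in> C.points"
    by (rule element_image[OF h _ HOL.refl])
  then show *: "(\<lambda>n. \<phi> n h \<otimes>\<^bsub>P\<^esub> x n) \<in> C.seqs"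
    by (intro C.limit_action_seqs[where \<phi> = \<phi>] \<phi>_closed[OF h] x)
  show "limit_action \<omega> P P.wdist lam b \<phi> h (C.pt x) = C.pt (\<lambda>n. \<phi> n h \<otimes>\<^bsub>P\<^esub> x n)"
    by (intro C.limit_action_pt[where \<phi> = \<phi>] \<phi>_closed[OF h] x *)
qed

text \<open>One constant serves all \<open>h\<close>, while the set of good indices still depends on
  \<open>h\<close>.\<close>

lemma orbit_bound:
  assumes x: "x \<in> C.seqs"
  obtains B where "\<And>h. h \<in> carrier G \<Longrightarrow>
    eventually (\<lambda>n. P.wdist (x n) (\<phi> n h \<otimes>\<^bsub>P\<^esub> x n) \<le> B * lam n) \<omega>"
proof -
  let ?act = "limit_action \<omega> P P.wdist lam b \<phi>"
  have "C.pt x \<in> C.points" using x by (simp add: C.points_eq)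
  then obtain B where B: "\<And>p q. p \<in> Group_Action.orbit G ?act (C.pt x) \<Longrightarrow>
      q \<in> Group_Action.orbit G ?act (C.pt x) \<Longrightarrow> C.cdist p q \<le> B"
    using bounded_orbits unfolding Metric_space.mbounded_alt[OF C.Metric_space_cone] by blast
  have "(\<lambda>n. \<phi> n \<one>\<^bsub>G\<^esub> \<otimes>\<^bsub>P\<^esub> x n) = x" using C.seqs_mem[OF x] by (simp add: \<phi>_one)
  then have one: "C.pt x = ?act \<one>\<^bsub>G\<^esub> (C.pt x)" using translate_pt[OF x G.one_closed] by simp
  show thesis
  proof (rule that)
    fix h assume h: "h \<in> carrier G"
    have "C.cdist (C.pt x) (?act h (C.pt x)) \<le> B"
      using h one G.one_closed by (intro B) (unfold Group_Action.orbit_def, blast+)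
    \<comment> \<open>The slack 1 turns a bound on the limit into a bound at \<omega>-almost every
      index.\<close>
    then have "C.pdist x (\<lambda>n. \<phi> n h \<otimes>\<^bsub>P\<^esub> x n) < B + 1"
      using translate_pt[OF x h] C.cdist_pt[OF x translate_seqs[OF x h]] by simp
    then show "eventually (\<lambda>n. P.wdist (x n) (\<phi> n h \<otimes>\<^bsub>P\<^esub> x n) \<le> (B + 1) * lam n) \<omega>"
      using C.pdist_less[OF x translate_seqs[OF x h]] by blast
  qed
qed

text \<open>The limit orbit is collapsed for colour \<open>v\<close>: each element displaces
  \<open>x n\<close> by o(\<open>lam n\<close>) along \<omega>, without uniformity over the
  group.\<close>

definition small :: "'v \<Rightarrow> (nat \<Rightarrow> ('v \<times> 'a) list set set) \<Rightarrow> bool" where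
  "small v x \<longleftrightarrow> (\<forall>h\<in>carrier G. \<forall>e>0. eventually (\<lambda>n. hdist v (x n) (\<phi> n h \<otimes>\<^bsub>P\<^esub> x n) \<le> e * lam n) \<omega>)"

text \<open>Displacements are subadditive, so the negligible ones are closed under products and
  inverses.\<close>

lemma small_generators:
  assumes v: "v \<in> verts \<Gamma>" and x: "\<And>n. x n \<in> carrier P" and T: "T \<subseteq> carrier G" "generate G T = carrier G"
    and small: "\<And>t e. t \<in> T \<Longrightarrow> 0 < e \<Longrightarrow>
      eventually (\<lambda>n. hdist v (x n) (\<phi> n t \<otimes>\<^bsub>P\<^esub> x n) \<le> e * lam n) \<omega>"
  shows "small v x"
proof -
  interpret tree_graded "carrier P" "Hyper v" "delta v" geodesic_between
    using v by (rule tree_graded_hyperplanes)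
  have "h \<in> carrier G \<and> (\<forall>e>0. eventually (\<lambda>n. hdist v (x n) (\<phi> n h \<otimes>\<^bsub>P\<^esub> x n) \<le> e * lam n) \<omega>)"
    if "h \<in> generate G T" for h
    using that
  proof (induction rule: generate.induct)
    case one
    have "hdist v y y = 0" if "y \<in> carrier P" for y
      using that \<delta>_refl by (simp add: hyperplane_dist_def)
    then show ?case using x lam_pos by (simp add: \<phi>_one less_imp_le)
  next
    case (incl t)
    then show ?case using small T by blast
  next
    case (inv t)
    have t: "t \<in> carrier G" using inv T by blast
    have "hdist v (x n) (\<phi> n (inv\<^bsub>G\<^esub> t) \<otimes>\<^bsub>P\<^esub> x n) = hdist v (x n) (\<phi> n t \<otimes>\<^bsub>P\<^esub> x n)" for n
    proof -
      have "hdist v (\<phi> n t \<otimes>\<^bsub>P\<^esub> x n) (\<phi> n \<one>\<^bsub>G\<^esub> \<otimes>\<^bsub>P\<^esub> x n) = hdist v (x n) (\<phi> n (inv\<^bsub>G\<^esub> t) \<otimes>\<^bsub>P\<^esub> x n)"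
        using hdist_orbit[OF v t G.one_closed x[of n]] t by simp
      then show ?thesis using d_sym[of "x n" "\<phi> n t \<otimes>\<^bsub>P\<^esub> x n"] t x \<phi>_closed by (simp add: \<phi>_one)
    qed
    then show ?case using small[OF inv] t by simp
  next
    case (eng g h)
    show ?case
    proof (intro conjI allI impI)
      show "g \<otimes>\<^bsub>G\<^esub> h \<in> carrier G" using eng by simp
      fix e :: real assume "0 < e"
      then have "eventually (\<lambda>n. hdist v (x n) (\<phi> n g \<otimes>\<^bsub>P\<^esub> x n) \<le> e / 2 * lam n) \<omega>"
        "eventually (\<lambda>n. hdist v (x n) (\<phi> n h \<otimes>\<^bsub>P\<^esub> x n) \<le> e / 2 * lam n) \<omega>"
        using eng.IH half_gt_zero by blast+
      then show "eventually (\<lambda>n. hdist v (x n) (\<phi> n (g \<otimes>\<^bsub>G\<^esub> h) \<otimes>\<^bsub>P\<^esub> x n) \<le> e * lam n) \<omega>"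
      proof eventually_elim
        case (elim n)
        have c: "\<phi> n g \<in> carrier P" "\<phi> n h \<in> carrier P" using eng.IH \<phi>_closed by auto
        have "hdist v (\<phi> n g \<otimes>\<^bsub>P\<^esub> x n) (\<phi> n g \<otimes>\<^bsub>P\<^esub> (\<phi> n h \<otimes>\<^bsub>P\<^esub> x n)) = hdist v (x n) (\<phi> n h \<otimes>\<^bsub>P\<^esub> x n)"
          using hdist_translate[OF v c(1) x[of n] P.m_closed[OF c(2) x[of n]]] .
        then show ?case
          using elim d_triangle[of "x n" "\<phi> n g \<otimes>\<^bsub>P\<^esub> x n" "\<phi> n (g \<otimes>\<^bsub>G\<^esub> h) \<otimes>\<^bsub>P\<^esub> x n"] c x eng.IH \<phi>_closed
          by (simp add: \<phi>_mult_act)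
      qed
    qed
  qed
  then show ?thesis using T(2) by (auto simp: small_def)
qed

text \<open>The near-centre of the orbit of \<open>x\<close> with
  respect to colour \<open>v\<close> lies on a geodesic between two orbit points, so it is still almost fixed
  with respect to the colours in \<open>U\<close>.\<close>

lemma almost_fixed_points:
  assumes T: "finite T" "T \<subseteq> carrier G" "generate G T = carrier G"
    and no_star: "\<not> (\<exists>i. \<exists>H\<in>star_subgroups \<Gamma> \<G>. \<phi> i ` carrier G \<subseteq> H)"
    and x: "x \<in> C.seqs" and U: "U \<subseteq> verts \<Gamma>" "\<And>u. u \<in> U \<Longrightarrow> small u x" and v: "v \<in> verts \<Gamma>"
  shows "\<exists>K. \<forall>e>0. eventually (\<lambda>n. \<exists>y\<in>carrier P. P.wdist (x n) y \<le> K * lam n \<and>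
    (\<forall>u\<in>insert v U. \<forall>t\<in>T. hdist u y (\<phi> n t \<otimes>\<^bsub>P\<^esub> y) \<le> 14 * e * lam n)) \<omega>"
proof -
  interpret tree_graded "carrier P" "Hyper v" "delta v" geodesic_between
    using v by (rule tree_graded_hyperplanes)
  have xP: "x n \<in> carrier P" for n using C.seqs_mem[OF x] .
  obtain B where B: "\<And>h. h \<in> carrier G \<Longrightarrow>
    eventually (\<lambda>n. P.wdist (x n) (\<phi> n h \<otimes>\<^bsub>P\<^esub> x n) \<le> B * lam n) \<omega>" using orbit_bound[OF x] by blast
  \<comment> \<open>The infimum \<open>L\<close> of \<open>A\<close> is the diameter of the limit
    orbit for colour \<open>v\<close>. It need not be attained, hence the pair within
    \<open>e\<close> of it below.\<close>
  define A where "A = {c. \<forall>h\<in>carrier G. eventually (\<lambda>n. hdist v (x n) (\<phi> n h \<otimes>\<^bsub>P\<^esub> x n) \<le> c * lam n) \<omega>}"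
  have "B \<in> A" unfolding A_def
  proof (clarify)
    fix h assume h: "h \<in> carrier G"
    show "eventually (\<lambda>n. hdist v (x n) (\<phi> n h \<otimes>\<^bsub>P\<^esub> x n) \<le> B * lam n) \<omega>"
      using B[OF h]
    proof eventually_elim
      case (elim n)
      then show ?case
        using hdist_le_wdist[OF v xP[of n] P.m_closed[OF \<phi>_closed[OF h, of n] xP[of n]]] by linarith
    qed
  qed
  have A0: "0 \<le> c" if "c \<in> A" for c
  proof -
    have "eventually (\<lambda>n. hdist v (x n) (\<phi> n \<one>\<^bsub>G\<^esub> \<otimes>\<^bsub>P\<^esub> x n) \<le> c * lam n) \<omega>" using that by (auto simp: A_def)
    then have "eventually (\<lambda>n. 0 \<le> c) \<omega>"
    proof eventually_elim
      case (elim n)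
      have "0 \<le> hdist v (x n) (\<phi> n \<one>\<^bsub>G\<^esub> \<otimes>\<^bsub>P\<^esub> x n)" using xP \<phi>_closed by (intro d_nonneg) auto
      then have "0 \<le> c * lam n" using elim by linarith
      then show ?case using lam_pos[of n] by (simp add: zero_le_mult_iff)
    qed
    then show ?thesis using C.nontrivial by (simp add: eventually_const_iff)
  qed
  then have bdd: "bdd_below A" by (auto simp: bdd_below_def)
  define L where "L = Inf A"
  have L0: "0 \<le> L" unfolding L_def using \<open>B \<in> A\<close> A0 by (intro cInf_greatest) auto
  have upper: "eventually (\<lambda>n. hdist v (x n) (\<phi> n h \<otimes>\<^bsub>P\<^esub> x n) \<le> (L + e) * lam n) \<omega>"
    if h: "h \<in> carrier G" and e: "0 < e" for h e
  proof -
    obtain c where c: "c \<in> A" "c < L + e" using cInf_lessD[of A "L + e"] \<open>B \<in> A\<close> e by (auto simp: L_def)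
    then have "eventually (\<lambda>n. hdist v (x n) (\<phi> n h \<otimes>\<^bsub>P\<^esub> x n) \<le> c * lam n) \<omega>" using h by (auto simp: A_def)
    then show ?thesis
    proof eventually_elim
      case (elim n)
      have "c * lam n \<le> (L + e) * lam n" using c lam_pos[of n] by (intro mult_right_mono) auto
      then show ?case using elim by linarith
    qed
  qed
  have B0: "0 \<le> B" using A0 \<open>B \<in> A\<close> by blast
  show ?thesis
  proof (intro exI allI impI)
    fix e :: real assume e: "0 < e"
    have "L - e \<notin> A" using cInf_lower[OF _ bdd, of "L - e"] e by (auto simp: L_def)
    then obtain h where h: "h \<in> carrier G"
      "\<not> eventually (\<lambda>n. hdist v (x n) (\<phi> n h \<otimes>\<^bsub>P\<^esub> x n) \<le> (L - e) * lam n) \<omega>" by (auto simp: A_def)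
    have lower: "eventually (\<lambda>n. (L - e) * lam n \<le> hdist v (x n) (\<phi> n h \<otimes>\<^bsub>P\<^esub> x n)) \<omega>"
      using ultrafilter_cases[OF nonprincipal h(2)] by (rule eventually_mono) auto
    \<comment> \<open>\<open>F0\<close> names the pair at nearly maximal distance and
      \<open>F1\<close> adds its images under generators. \<open>F2\<close> adds the preimages of
      \<open>F1\<close>, for recentring, and its images, for bounding displacements in the colours
      of \<open>U\<close>.\<close>
    define F0 where "F0 = {\<one>\<^bsub>G\<^esub>, h}"
    define F1 where "F1 = F0 \<union> (\<Union>t\<in>T. (\<lambda>f. t \<otimes>\<^bsub>G\<^esub> f) ` F0)"
    define F2 where "F2 = F1 \<union> (\<Union>t\<in>T. (\<lambda>f. inv\<^bsub>G\<^esub> t \<otimes>\<^bsub>G\<^esub> f) ` F1) \<union> (\<Union>t\<in>T. (\<lambda>f. t \<otimes>\<^bsub>G\<^esub> f) ` F1)"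
    have F0: "F0 \<subseteq> carrier G" "finite F0" using h by (auto simp: F0_def)
    have F1: "F1 \<subseteq> carrier G" "finite F1" using F0 T by (auto simp: F1_def subset_iff)
    have F2: "F2 \<subseteq> carrier G" "finite F2" using F1 T by (auto simp: F2_def subset_iff)
    have pairs: "eventually (\<lambda>n. \<forall>f\<in>F2. \<forall>k\<in>F2. R n (inv\<^bsub>G\<^esub> f \<otimes>\<^bsub>G\<^esub> k)) \<omega>"
      if "\<And>h. h \<in> carrier G \<Longrightarrow> eventually (\<lambda>n. R n h) \<omega>" for R
      using F2 that by (intro eventually_ball_finite ballI) (auto simp: subset_iff)
    have e1: "eventually (\<lambda>n. \<forall>f\<in>F2. \<forall>k\<in>F2. hdist v (x n) (\<phi> n (inv\<^bsub>G\<^esub> f \<otimes>\<^bsub>G\<^esub> k) \<otimes>\<^bsub>P\<^esub> x n) \<le> (L + e) * lam n) \<omega>"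
      by (rule pairs) (rule upper[OF _ e])
    have e2: "eventually (\<lambda>n. \<forall>f\<in>F2. \<forall>k\<in>F2. P.wdist (x n) (\<phi> n (inv\<^bsub>G\<^esub> f \<otimes>\<^bsub>G\<^esub> k) \<otimes>\<^bsub>P\<^esub> x n) \<le> B * lam n) \<omega>"
      by (rule pairs) (rule B)
    have finU: "finite U" using U(1) finite_verts by (rule finite_subset)
    have e3: "eventually (\<lambda>n. \<forall>u\<in>U. \<forall>f\<in>F2. \<forall>k\<in>F2.
        hdist u (x n) (\<phi> n (inv\<^bsub>G\<^esub> f \<otimes>\<^bsub>G\<^esub> k) \<otimes>\<^bsub>P\<^esub> x n) \<le> e * lam n) \<omega>"
      using U(2) e by (intro eventually_ball_finite[OF finU] ballI pairs) (auto simp: small_def)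
    \<comment> \<open>The constant is free of \<open>e\<close>: at most \<open>B\<close> from
      \<open>x n\<close> to an orbit point, and from there to the centre at most \<open>B\<close>
      for each colour.\<close>
    show "eventually (\<lambda>n. \<exists>y\<in>carrier P. P.wdist (x n) y \<le> (B + card (verts \<Gamma>) * B) * lam n \<and>
      (\<forall>u\<in>insert v U. \<forall>t\<in>T. hdist u y (\<phi> n t \<otimes>\<^bsub>P\<^esub> y) \<le> 14 * e * lam n)) \<omega>"
      using lower e1 e2 e3
    proof eventually_elim
      case (elim n)
      define p where "p f = \<phi> n f \<otimes>\<^bsub>P\<^esub> x n" for f
      have pc: "p f \<in> carrier P" if "f \<in> carrier G" for f using that xP \<phi>_closed by (simp add: p_def)
      have tp: "\<phi> n t \<otimes>\<^bsub>P\<^esub> p f = p (t \<otimes>\<^bsub>G\<^esub> f)" if "t \<in> carrier G" "f \<in> carrier G" for t f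
        using that xP by (simp add: p_def \<phi>_mult_act)
      have p1: "p \<one>\<^bsub>G\<^esub> = x n" using xP by (simp add: p_def \<phi>_one)
      have hp: "hdist u (p f) (p k) = hdist u (x n) (\<phi> n (inv\<^bsub>G\<^esub> f \<otimes>\<^bsub>G\<^esub> k) \<otimes>\<^bsub>P\<^esub> x n)"
        if "u \<in> verts \<Gamma>" "f \<in> F2" "k \<in> F2" for u f k
        unfolding p_def using that F2 xP by (intro hdist_orbit) auto
      have wp: "P.wdist (p f) (p k) \<le> B * lam n" if "f \<in> F2" "k \<in> F2" for f k
        using elim(3) that wdist_orbit[OF subsetD[OF F2(1) that(1)] subsetD[OF F2(1) that(2)] xP, of n n]
        by (simp add: p_def)
      have lam: "0 \<le> e * lam n" "0 \<le> L * lam n" using e L0 lam_pos[of n] by (auto simp: less_imp_le)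
      have "(\<exists>J\<in>Hyper v. \<forall>\<tau>\<in>(\<lambda>t x. \<phi> n t \<otimes>\<^bsub>P\<^esub> x) ` T. \<tau> ` J = J) \<or>
        (\<exists>p'\<in>p ` F1. \<exists>q'\<in>p ` F1. \<exists>y\<in>carrier P. geodesic_between p' y q' \<and>
          (\<forall>\<tau>\<in>(\<lambda>t x. \<phi> n t \<otimes>\<^bsub>P\<^esub> x) ` T. hdist v y (\<tau> y) \<le> 14 * (e * lam n)))"
      proof (rule almost_fixed_or_stabilised[where p = "p \<one>\<^bsub>G\<^esub>" and q = "p h" and L = "L * lam n" and ?O2.0 = "p ` F2"])
        fix \<tau> assume "\<tau> \<in> (\<lambda>t x. \<phi> n t \<otimes>\<^bsub>P\<^esub> x) ` T"
        then obtain t where t: "t \<in> T" "t \<in> carrier G" "\<tau> = (\<lambda>x. \<phi> n t \<otimes>\<^bsub>P\<^esub> x)" using T by blast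
        show "symmetry \<tau>" unfolding t(3) using t(2) \<phi>_closed by (intro translation_symmetry v)
        have "t \<otimes>\<^bsub>G\<^esub> \<one>\<^bsub>G\<^esub> \<in> F1" "t \<otimes>\<^bsub>G\<^esub> h \<in> F1" using t(1) by (auto simp: F1_def F0_def)
        then show "\<tau> (p \<one>\<^bsub>G\<^esub>) \<in> p ` F1 \<and> \<tau> (p h) \<in> p ` F1"
          unfolding t(3) using tp[OF t(2) G.one_closed] tp[OF t(2) h(1)] by simp
        fix y assume "y \<in> p ` F1"
        then obtain f where f: "f \<in> F1" "y = p f" by blast
        have fc: "f \<in> carrier G" using f F1 by blast
        have "inv\<^bsub>G\<^esub> t \<otimes>\<^bsub>G\<^esub> f \<in> F2" using t f by (auto simp: F2_def)
        moreover have "\<tau> (p (inv\<^bsub>G\<^esub> t \<otimes>\<^bsub>G\<^esub> f)) = y"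
          unfolding t(3) using tp[of t "inv\<^bsub>G\<^esub> t \<otimes>\<^bsub>G\<^esub> f"] t(2) fc f by (simp flip: G.m_assoc)
        ultimately show "\<exists>z\<in>p ` F2. \<tau> z = y" by blast
      next
        show "p ` F1 \<subseteq> p ` F2" by (auto simp: F2_def)
        show "p ` F2 \<subseteq> carrier P" using pc F2 by auto
        show "p \<one>\<^bsub>G\<^esub> \<in> p ` F1" "p h \<in> p ` F1" by (auto simp: F1_def F0_def)
        show "L * lam n - e * lam n \<le> hdist v (p \<one>\<^bsub>G\<^esub>) (p h)"
          unfolding p1 using elim(1) by (simp add: p_def algebra_simps)
        show "hdist v y z \<le> L * lam n + e * lam n" if yz: "y \<in> p ` F2" "z \<in> p ` F2" for y z
        proof -
          obtain f k where "f \<in> F2" "k \<in> F2" "y = p f" "z = p k" using yz by blast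
          then show ?thesis using elim(2) hp[OF v] by (simp add: algebra_simps)
        qed
      qed (use lam in auto)
      then show ?case
      proof
        assume "\<exists>J\<in>Hyper v. \<forall>\<tau>\<in>(\<lambda>t x. \<phi> n t \<otimes>\<^bsub>P\<^esub> x) ` T. \<tau> ` J = J"
        then obtain J where "J \<in> Hyper v" "\<And>t. t \<in> T \<Longrightarrow> (\<lambda>x. \<phi> n t \<otimes>\<^bsub>P\<^esub> x) ` J = J" by blast
        then have "\<exists>H\<in>star_subgroups \<Gamma> \<G>. \<phi> n ` carrier G \<subseteq> H"
          by (intro stabiliser_in_star_subgroup[OF G.is_group T(3,2) hom v])
        then show ?thesis using no_star by blast
      next
        assume "\<exists>p'\<in>p ` F1. \<exists>q'\<in>p ` F1. \<exists>y\<in>carrier P. geodesic_between p' y q' \<and>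
          (\<forall>\<tau>\<in>(\<lambda>t x. \<phi> n t \<otimes>\<^bsub>P\<^esub> x) ` T. hdist v y (\<tau> y) \<le> 14 * (e * lam n))"
        then obtain f k y where fk: "f \<in> F1" "k \<in> F1" and y: "y \<in> carrier P" "geodesic_between (p f) y (p k)"
          and v14: "\<And>t. t \<in> T \<Longrightarrow> hdist v y (\<phi> n t \<otimes>\<^bsub>P\<^esub> y) \<le> 14 * (e * lam n)" by blast
        have fk2: "f \<in> F2" "k \<in> F2" using fk by (auto simp: F2_def)
        have fkG: "f \<in> carrier G" "k \<in> carrier G" using fk F1 by auto
        \<comment> \<open>The centre is on a geodesic from \<open>p f\<close> to \<open>p k\<close>,
          so every colour sees it no farther from \<open>p f\<close> than \<open>p k\<close>
          is.\<close>
        have le: "hdist u (p f) y \<le> hdist u (p f) (p k)" if "u \<in> verts \<Gamma>" for u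
          using tree_graded.btw_d[OF tree_graded_hyperplanes[OF that] y(2) pc pc]
            tree_graded.d_nonneg[OF tree_graded_hyperplanes[OF that] y(1) pc[OF fkG(2)]] fkG by simp
        have "P.wdist (p f) y \<le> (\<Sum>u\<in>verts \<Gamma>. hdist u (p f) y)"
          using pc[OF fkG(1)] y(1) by (rule wdist_le_sum_hdist)
        also have "\<dots> \<le> (\<Sum>u\<in>verts \<Gamma>. B * lam n)"
        proof (rule sum_mono)
          fix u assume u: "u \<in> verts \<Gamma>"
          show "hdist u (p f) y \<le> B * lam n"
            using le[OF u] hdist_le_wdist[OF u pc[OF fkG(1)] pc[OF fkG(2)]] wp[OF fk2] by linarith
        qed
        finally have "P.wdist (p f) y \<le> card (verts \<Gamma>) * B * lam n" by simp
        moreover have "P.wdist (x n) (p f) \<le> B * lam n"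
          using wp[of "\<one>\<^bsub>G\<^esub>" f] fk2 p1 by (simp add: F2_def F1_def F0_def)
        ultimately have "P.wdist (x n) y \<le> (B + card (verts \<Gamma>) * B) * lam n"
          using P.wdist_triangle[OF xP[of n] pc[OF fkG(1)] y(1)] by (simp add: algebra_simps)
        moreover have "hdist u y (\<phi> n t \<otimes>\<^bsub>P\<^esub> y) \<le> 14 * e * lam n" if u: "u \<in> insert v U" and t: "t \<in> T" for u t
        proof (cases "u = v")
          case True
          then show ?thesis using v14[OF t] by simp
        next
          case False
          then have uU: "u \<in> U" "u \<in> verts \<Gamma>" using u U by auto
          interpret Tu: tree_graded "carrier P" "Hyper u" "delta u" geodesic_between
            using uU(2) by (rule tree_graded_hyperplanes)
          have tG: "t \<in> carrier G" using t T by blast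
          have tf: "t \<otimes>\<^bsub>G\<^esub> f \<in> F2" using t fk by (auto simp: F2_def)
          have s: "hdist u (p f) (p k) \<le> e * lam n" "hdist u (p f) (p (t \<otimes>\<^bsub>G\<^esub> f)) \<le> e * lam n"
            using elim(4) uU hp[OF uU(2)] fk2 tf by auto
          have tc: "\<phi> n t \<in> carrier P" by (rule \<phi>_closed[OF tG])
          have fc: "p f \<in> carrier P" by (rule pc[OF fkG(1)])
          have "hdist u (\<phi> n t \<otimes>\<^bsub>P\<^esub> p f) (\<phi> n t \<otimes>\<^bsub>P\<^esub> y) = hdist u (p f) y"
            using uU(2) tc fc y(1) by (rule hdist_translate)
          then have s2: "hdist u (p (t \<otimes>\<^bsub>G\<^esub> f)) (\<phi> n t \<otimes>\<^bsub>P\<^esub> y) = hdist u (p f) y"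
            using tp[OF tG fkG(1)] by simp
          have tfc: "p (t \<otimes>\<^bsub>G\<^esub> f) \<in> carrier P" using tG fkG by (intro pc) simp
          have tyc: "\<phi> n t \<otimes>\<^bsub>P\<^esub> y \<in> carrier P" using tc y(1) by simp
          \<comment> \<open>From \<open>y\<close> to \<open>p f\<close>, on to its image, and from
            there to the image of \<open>y\<close>: three legs of length at most e * lam n
            each.\<close>
          have "hdist u y (\<phi> n t \<otimes>\<^bsub>P\<^esub> y) \<le> 3 * (e * lam n)"
            using Tu.d_triangle[OF y(1) fc tyc] Tu.d_triangle[OF fc tfc tyc] Tu.d_sym[OF y(1) fc]
              s s2 le[OF uU(2)] by linarith
          then show ?thesis using lam by simp
        qed
        ultimately show ?thesis using y(1) by blast
      qed
    qed
  qed
qed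

text \<open>For each precision, good points exist at \<omega>-almost every index; a diagonal
  sequence lets each index use the best precision it supports. The constant \<open>K\<close>, common
  to all precisions, keeps this sequence in the cone.\<close>

lemma small_insert:
  assumes T: "finite T" "T \<subseteq> carrier G" "generate G T = carrier G"
    and no_star: "\<not> (\<exists>i. \<exists>H\<in>star_subgroups \<Gamma> \<G>. \<phi> i ` carrier G \<subseteq> H)"
    and x: "x \<in> C.seqs" and U: "U \<subseteq> verts \<Gamma>" "\<And>u. u \<in> U \<Longrightarrow> small u x" and v: "v \<in> verts \<Gamma>"
  shows "\<exists>y\<in>C.seqs. \<forall>u\<in>insert v U. small u y"
proof -
  obtain K where K: "\<And>e. 0 < e \<Longrightarrow> eventually (\<lambda>n. \<exists>y\<in>carrier P. P.wdist (x n) y \<le> K * lam n \<and>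
    (\<forall>u\<in>insert v U. \<forall>t\<in>T. hdist u y (\<phi> n t \<otimes>\<^bsub>P\<^esub> y) \<le> 14 * e * lam n)) \<omega>"
    using almost_fixed_points[OF T no_star x U v] by blast
  define Q where "Q k n y \<longleftrightarrow> y \<in> carrier P \<and> P.wdist (x n) y \<le> K * lam n \<and>
    (\<forall>u\<in>insert v U. \<forall>t\<in>T. hdist u y (\<phi> n t \<otimes>\<^bsub>P\<^esub> y) \<le> 14 * (1 / real (Suc k)) * lam n)" for k n y
  have evQ: "eventually (\<lambda>n. \<exists>y. Q k n y) \<omega>" for k
    using K[of "1 / real (Suc k)"] by (simp add: Q_def Bex_def)
  \<comment> \<open>The cut-off k \<le> n guarantees that a best precision exists, and it holds
    eventually because \<omega> is non-principal.\<close>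
  define ks where "ks n = {k. k \<le> n \<and> (\<exists>y. Q k n y)}" for n
  \<comment> \<open>The default \<open>x n\<close> keeps the sequence in the graph product at
    indices that support no precision.\<close>
  define y where "y n = (if ks n = {} then x n else SOME y. Q (Max (ks n)) n y)" for n
  have fin: "finite (ks n)" for n unfolding ks_def by simp
  have Qy: "Q (Max (ks n)) n (y n)" if "ks n \<noteq> {}" for n
  proof -
    have "Max (ks n) \<in> ks n" using fin that by (rule Max_in)
    then have "\<exists>y. Q (Max (ks n)) n y" by (auto simp: ks_def)
    then show ?thesis unfolding y_def using that by (simp add: someI_ex)
  qed
  have yP: "y n \<in> carrier P" for n
    using Qy[of n] C.seqs_mem[OF x] by (cases "ks n = {}") (auto simp: Q_def y_def)
  have evk: "eventually (\<lambda>n. Q k n (y n)) \<omega>" for k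
    using evQ[of k] nonprincipal_eventually_ge[OF nonprincipal, of k]
  proof eventually_elim
    case (elim n)
    then have k: "k \<in> ks n" by (simp add: ks_def)
    then have le: "k \<le> Max (ks n)" using fin by simp
    have q: "Q (Max (ks n)) n (y n)" using Qy k by blast
    have "14 * (1 / real (Suc (Max (ks n)))) * lam n \<le> 14 * (1 / real (Suc k)) * lam n"
      using le lam_pos[of n] by (intro mult_right_mono mult_left_mono divide_left_mono) auto
    then show ?case using q unfolding Q_def by (meson order_trans)
  qed
  have "C.at_scale x y"
    unfolding C.at_scale_def using evk[of 0] by (auto simp: Q_def elim!: eventually_mono)
  then have "y \<in> C.seqs" using C.seqs_at_scale[OF x] yP by blast
  moreover have "small u y" if u: "u \<in> insert v U" for u
  proof (rule small_generators)
    show "u \<in> verts \<Gamma>" using u U v by auto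
    fix t and e :: real assume t: "t \<in> T" and e: "0 < e"
    obtain k where k: "1 / real (Suc k) < e / 14" using nat_approx_posE[of "e / 14"] e by auto
    show "eventually (\<lambda>n. hdist u (y n) (\<phi> n t \<otimes>\<^bsub>P\<^esub> y n) \<le> e * lam n) \<omega>"
      using evk[of k]
    proof eventually_elim
      case (elim n)
      then have "hdist u (y n) (\<phi> n t \<otimes>\<^bsub>P\<^esub> y n) \<le> 14 * (1 / real (Suc k)) * lam n"
        using u t by (auto simp: Q_def)
      also have "\<dots> \<le> e * lam n" using k lam_pos[of n] by (intro mult_right_mono) auto
      finally show ?case .
    qed
  qed (use yP T in auto)
  ultimately show ?thesis by blast
qed

theorem fixed_point_or_star_subgroup:
  assumes "finitely_generated G"
  shows "(\<exists>p\<in>C.points. \<forall>h\<in>carrier G. limit_action \<omega> P P.wdist lam b \<phi> h p = p) \<or>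
    (\<exists>i. \<exists>H\<in>star_subgroups \<Gamma> \<G>. \<phi> i ` carrier G \<subseteq> H)"
proof (rule disjCI)
  assume no_star: "\<not> (\<exists>i. \<exists>H\<in>star_subgroups \<Gamma> \<G>. \<phi> i ` carrier G \<subseteq> H)"
  obtain T where T: "finite T" "T \<subseteq> carrier G" "generate G T = carrier G"
    using assms by (auto simp: finitely_generated_def)
  have "\<exists>x\<in>C.seqs. \<forall>u\<in>U. small u x" if "U \<subseteq> verts \<Gamma>" for U
    using finite_subset[OF that finite_verts] that
  proof (induction U rule: finite_induct)
    case empty
    then show ?case using C.base_seqs by blast
  next
    case (insert v U)
    then obtain x where "x \<in> C.seqs" "\<And>u. u \<in> U \<Longrightarrow> small u x" by auto
    then show ?case using small_insert[OF T no_star] insert.prems by simp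
  qed
  then obtain x where x: "x \<in> C.seqs" "\<And>u. u \<in> verts \<Gamma> \<Longrightarrow> small u x" by blast
  have "limit_action \<omega> P P.wdist lam b \<phi> h (C.pt x) = C.pt x" if h: "h \<in> carrier G" for h
  proof -
    let ?y = "\<lambda>n. \<phi> n h \<otimes>\<^bsub>P\<^esub> x n"
    have y: "?y \<in> C.seqs" using translate_seqs[OF x(1) h] .
    have "C.pdist x ?y = 0"
    proof (rule C.pdist_zeroI[OF x(1) y])
      fix e :: real assume e: "0 < e"
      \<comment> \<open>An equal share of \<open>e\<close> for every colour; the added 1 keeps the
        denominator positive.\<close>
      define c where "c = e / (card (verts \<Gamma>) + 1)"
      have c: "0 < c" "card (verts \<Gamma>) * c \<le> e" using e by (auto simp: c_def field_simps)
      have "eventually (\<lambda>n. \<forall>u\<in>verts \<Gamma>. hdist u (x n) (?y n) \<le> c * lam n) \<omega>"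
        using finite_verts x(2) h c(1) by (intro eventually_ball_finite) (auto simp: small_def)
      then show "eventually (\<lambda>n. P.wdist (x n) (?y n) \<le> e * lam n) \<omega>"
      proof eventually_elim
        case (elim n)
        have "P.wdist (x n) (?y n) \<le> (\<Sum>u\<in>verts \<Gamma>. hdist u (x n) (?y n))"
          using C.seqs_mem[OF x(1)] C.seqs_mem[OF y] by (intro wdist_le_sum_hdist)
        also have "\<dots> \<le> (\<Sum>u\<in>verts \<Gamma>. c * lam n)" using elim by (intro sum_mono) auto
        also have "\<dots> = (card (verts \<Gamma>) * c) * lam n" by simp
        also have "\<dots> \<le> e * lam n" using c(2) lam_pos[of n] by (intro mult_right_mono) auto
        finally show ?case .
      qed
    qed
    then have "C.pt x = C.pt ?y" using C.pt_eq_iff[OF x(1) y] by simp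
    then show ?thesis using translate_pt[OF x(1) h] by simp
  qed
  moreover have "C.pt x \<in> C.points" using x(1) by (simp add: C.points_eq)
  ultimately show "\<exists>p\<in>C.points. \<forall>h\<in>carrier G. limit_action \<omega> P P.wdist lam b \<phi> h p = p" by blast
qed

end

theorem theorem1p18:
  fixes \<Gamma> :: "('v, 'e) pre_digraph"
    and \<G> :: "'v \<Rightarrow> 'a monoid"
    and S :: "'v \<Rightarrow> 'a set"
    and G :: "'g monoid"
    and \<phi> :: "nat \<Rightarrow> 'g \<Rightarrow> ('v \<times> 'a) list set set"
    and \<omega> :: "nat filter"
    and lam :: "nat \<Rightarrow> real"
    and b :: "nat \<Rightarrow> ('v \<times> 'a) list set set"
  assumes "Digraph.graph \<Gamma>"
    and "Digraph_Component.connected \<Gamma>"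
    and "\<And>u. u \<in> verts \<Gamma> \<Longrightarrow> group (\<G> u)"
    and "\<And>u. u \<in> verts \<Gamma> \<Longrightarrow> carrier (\<G> u) \<noteq> {\<one>\<^bsub>\<G> u\<^esub>}"
    and "\<And>u. u \<in> verts \<Gamma> \<Longrightarrow> S u \<subseteq> carrier (\<G> u) \<and> generate (\<G> u) (S u) = carrier (\<G> u)"
    and "group G"
    and "finitely_generated G"
    and "\<And>n. \<phi> n \<in> hom G (graph_product \<Gamma> \<G>)"
    and "nonprincipal_ultrafilter \<omega>"
    and "\<And>n. lam n > 0"
    and "filterlim lam at_top sequentially"
    and "\<And>n. b n \<in> carrier (graph_product \<Gamma> \<G>)"
    and "group_action G
           (asymptotic_cone \<omega> (carrier (graph_product \<Gamma> \<G>)) (gp_dist \<Gamma> \<G> S) lam b)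
           (limit_action \<omega> (graph_product \<Gamma> \<G>) (gp_dist \<Gamma> \<G> S) lam b \<phi>)"
    and "\<forall>p \<in> asymptotic_cone \<omega> (carrier (graph_product \<Gamma> \<G>)) (gp_dist \<Gamma> \<G> S) lam b.
           Metric_space.mbounded
             (asymptotic_cone \<omega> (carrier (graph_product \<Gamma> \<G>)) (gp_dist \<Gamma> \<G> S) lam b)
             (cone_dist \<omega> (carrier (graph_product \<Gamma> \<G>)) (gp_dist \<Gamma> \<G> S) lam b)
             (Group_Action.orbit G (limit_action \<omega> (graph_product \<Gamma> \<G>) (gp_dist \<Gamma> \<G> S) lam b \<phi>) p)"
  shows "(\<exists>p \<in> asymptotic_cone \<omega> (carrier (graph_product \<Gamma> \<G>)) (gp_dist \<Gamma> \<G> S) lam b.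
            \<forall>h \<in> carrier G. limit_action \<omega> (graph_product \<Gamma> \<G>) (gp_dist \<Gamma> \<G> S) lam b \<phi> h p = p)
       \<or> (\<exists>i. \<exists>H \<in> star_subgroups \<Gamma> \<G>. \<phi> i ` carrier G \<subseteq> H)"
proof -
  interpret M: marked_graph_of_groups \<Gamma> \<G> S
    using assms(1,3,5)
    by (simp add: marked_graph_of_groups_def graph_of_groups_def marked_graph_of_groups_axioms_def)
  interpret twisted_actions \<Gamma> \<G> S G \<phi> \<omega> lam b
    using assms(6,8-10,12-14) M.marked_graph_of_groups_axioms
    by (simp add: twisted_actions_def twisted_actions_axioms_def M.gp_dist_eq)
  show ?thesis using fixed_point_or_star_subgroup[OF assms(7)] unfolding M.gp_dist_eq .
qed

end
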